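(* Let $n\ge 1$. (Real case) For every $a\in\mathbb{R}^n$ with $|a|=1$, $$\frac1{17}<0.06011<A_{\mathbb{R}}(a,1)\le 1 .$$ (Complex case) For every $a\in\mathbb{C}^n$ with $|a|=1$, $$\frac1{27}<0.03789<A_{\mathbb{C}}(a,1)\le 1 .$$
   Context: Let $\mathbb{K}\in\{\mathbb{R},\mathbb{C}\}$, let $|\cdot|$ be the Euclidean norm and $\|\cdot\|_\infty$ the maximum norm on $\mathbb{K}^n$, and let $\langle\cdot,\cdot\rangle$ be the standard inner product. Put $\alpha=1/2$ if $\mathbb{K}=\mathbb{R}$ and $\alpha=1/\sqrt{\pi}$ if $\mathbb{K}=\mathbb{C}$, so that $Q_n=\{x\in\mathbb{K}^n:\|x\|_\infty\le\alpha\}$ has volume $1$ ($\mathbb{C}^n$ is identified with $\mathbb{R}^{2n}$ for volume computations). For $a\in\mathbb{K}^n$ with $|a|=1$ and $t\in\mathbb{K}$ let $$S(a,t)=\{x\in\mathbb{K}^n:\ \|x\|_\infty\le\alpha,\ \langle x,a\rangle=\alpha t\}=Q_n\cap(\alpha t\,a+a^\perp),$$ and let $A_{\mathbb{R}}(a,t)=\mathrm{vol}_{n-1}(S(a,t))$ when $\mathbb{K}=\mathbb{R}$ and $A_{\mathbb{C}}(a,t)=\mathrm{vol}_{2n-2}(S(a,t))$ when $\mathbb{K}=\mathbb{C}$, where volume is Lebesgue measure on the affine hyperplane (real dimension $n-1$, resp. $2n-2$); $\mathrm{vol}_0$ is counting measure. *)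

theory Defs
  imports "HOL-Analysis.Analysis"
begin

text \<open>
  Lebesgue measure on an affine subspace \<open>V\<close> of a Euclidean space: the image of the product
  Lebesgue measure under an isometric parametrisation of \<open>V\<close> by a base point and an orthonormal
  basis of the direction space. The result does not depend on the frame that is chosen. A single
  point has the frame with the empty basis, and the measure is then the unit point mass, that is,
  counting measure on \<open>V\<close>.
\<close>

definition orthonormal_frame :: "'a::euclidean_space set \<Rightarrow> 'a \<Rightarrow> 'a set \<Rightarrow> bool" where
  "orthonormal_frame V p B \<longleftrightarrow>
     pairwise orthogonal B \<and> (\<forall>b\<in>B. norm b = 1) \<and> V = (\<lambda>x. p + x) ` span B"

definition frame_measure :: "'a::euclidean_space \<Rightarrow> 'a set \<Rightarrow> 'a measure" where
  "frame_measure p B =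
     distr (\<Pi>\<^sub>M b\<in>B. (lborel :: real measure)) borel (\<lambda>c. p + (\<Sum>b\<in>B. c b *\<^sub>R b))"

definition affine_lborel :: "'a::euclidean_space set \<Rightarrow> 'a measure" where
  "affine_lborel V =
     (case (SOME (p, B). orthonormal_frame V p B) of (p, B) \<Rightarrow> frame_measure p B)"

lemma orthonormal_frame_exists:
  fixes V :: "'a::euclidean_space set"
  assumes "affine V" and "V \<noteq> {}"
  shows "\<exists>p B. orthonormal_frame V p B"
proof -
  obtain p where p: "p \<in> V"
    using assms by blast
  define W where "W = (\<lambda>x. - p + x) ` V"
  have "subspace W"
    unfolding W_def using affine_diffs_subspace[OF assms(1) p] .
  then obtain B where B: "pairwise orthogonal B" "\<And>b. b \<in> B \<Longrightarrow> norm b = 1" "span B = W"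
    using orthonormal_basis_subspace by metis
  have "V = (\<lambda>x. p + x) ` W"
    unfolding W_def by (simp add: image_image)
  with B show ?thesis
    unfolding orthonormal_frame_def by blast
qed

definition max_norm :: "'a::real_normed_vector ^ 'n \<Rightarrow> real" where
  "max_norm x = Max (range (\<lambda>i. norm (x $ i)))"

definition hermitian_inner :: "complex ^ 'n \<Rightarrow> complex ^ 'n \<Rightarrow> complex" where
  "hermitian_inner x y = (\<Sum>i\<in>UNIV. x $ i * cnj (y $ i))"

definition alpha_real :: real where
  "alpha_real = 1 / 2"

definition alpha_complex :: real where
  "alpha_complex = 1 / sqrt pi"

definition hyperplane_real :: "real ^ 'n \<Rightarrow> real \<Rightarrow> (real ^ 'n) set" where
  "hyperplane_real a t = {x. x \<bullet> a = alpha_real * t}"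

text \<open>For \<open>a\<close> nonzero, this set has real dimension \<open>2 * CARD('n) - 2\<close>.\<close>

definition hyperplane_complex :: "complex ^ 'n \<Rightarrow> complex \<Rightarrow> (complex ^ 'n) set" where
  "hyperplane_complex a t = {x. hermitian_inner x a = complex_of_real alpha_complex * t}"

definition section_real :: "real ^ 'n \<Rightarrow> real \<Rightarrow> (real ^ 'n) set" where
  "section_real a t = {x. max_norm x \<le> alpha_real} \<inter> hyperplane_real a t"

definition section_complex :: "complex ^ 'n \<Rightarrow> complex \<Rightarrow> (complex ^ 'n) set" where
  "section_complex a t = {x. max_norm x \<le> alpha_complex} \<inter> hyperplane_complex a t"

definition A_real :: "real ^ 'n \<Rightarrow> real \<Rightarrow> real" where
  "A_real a t = measure (affine_lborel (hyperplane_real a t)) (section_real a t)"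

text \<open>
  The Euclidean structure of \<^typ>\<open>complex ^ 'n\<close> underlying \<^const>\<open>affine_lborel\<close> is the one of the
  real space of twice the dimension, with inner product the real part of \<^const>\<open>hermitian_inner\<close>.
\<close>

definition A_complex :: "complex ^ 'n \<Rightarrow> complex \<Rightarrow> real" where
  "A_complex a t = measure (affine_lborel (hyperplane_complex a t)) (section_complex a t)"

end

theory Submission imports Defs "HOL-Probability.Probability" begin

text \<open>
  Write \<open>k\<close> for the real dimension of the scalars \<open>\<bbbK>\<close>, put \<open>d = k + 2\<close>, and let \<open>x\<^sub>j\<close> be independent
  and uniform in the unit ball of \<open>\<bbbK>\<close>. Rescaled to the unit ball, \<open>t \<mapsto> A(a, t)\<close> is up to a constant
  the density of \<open>X = \<Sum> x\<^sub>j a\<^sub>j\<close> (with conjugated coefficients in the complex case). By Archimedes,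
  \<open>x\<^sub>j\<close> is the projection of a uniform point of the unit sphere of \<open>\<real>\<^sup>d\<close>, so \<open>X\<close> is the projection of
  a rotation-invariant vector of \<open>\<real>\<^sup>d\<close> of random length \<open>R\<close>; that is, \<open>X\<close> is distributed as \<open>R v\<close> with
  \<open>v\<close> uniform in the ball and independent of \<open>R\<close>. The density of \<open>R v\<close> gives the formula
  \<open>A(a, 1) = E [R\<^sup>-\<^sup>k; R \<ge> 1]\<close>, from which both bounds follow.

  For two summands the formula for \<open>R\<close> is \<open>R\<^sup>2 = r\<^sup>2 + t\<^sup>2 + 2 r t w\<close>, with \<open>w\<close> the real part of
  another uniform point of the ball; this is \<open>nn_integral_ball_law_sum_real\<close>, a computation with
  distribution functions, and \<open>nn_integral_ball_law_sum_complex\<close>, where the group structure of the unit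
  quaternions replaces computation. Joining summands one by one (\<open>radius_law_Un\<close>) yields the law of
  \<open>R\<close> and the moments \<open>E R\<^sup>2 = 1\<close> and \<open>E R\<^sup>4 \<le> 1 + 2/d\<close>.

  The upper bound is \<open>R\<^sup>-\<^sup>k \<le> 1\<close> on \<open>R \<ge> 1\<close>. For the lower bound, \<open>R\<^sup>-\<^sup>k\<close> is at least a constant
  minus a multiple of \<open>(R\<^sup>2 - \<theta>)\<^sup>2\<close> on \<open>R \<ge> 1\<close>, so by the two moments it suffices to bound the probability
  of \<open>R \<ge> 1\<close> from below (\<open>radius_law_UNIV_exists\<close>). If all \<open>\<bar>a\<^sub>j\<bar>\<^sup>2\<close> are at most \<open>2/3\<close>, the indices
  split into two parts of weights between \<open>1/3\<close> and \<open>2/3\<close>. Given the lengths \<open>r\<close>, \<open>t\<close> of the two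
  partial sums, the inequality \<open>R\<^sup>2 \<ge> 2 r t (1 + w)\<close> bounds the conditional probability below by a
  concave quadratic polynomial in \<open>r\<^sup>2 t\<^sup>2\<close>, and the mean of such a polynomial is controlled by
  \<open>E r\<^sup>2\<close>, \<open>E r\<^sup>4\<close>, \<open>E t\<^sup>2\<close>, \<open>E t\<^sup>4\<close>. If one coordinate dominates, the second part is that coordinate
  alone and a quadratic polynomial in \<open>r\<^sup>2\<close> suffices.

  A density is determined only almost everywhere, while \<open>A(a, 1)\<close> is the volume of one section, and the
  density jumps at this level if \<open>a\<close> is a unit coordinate vector. The link is geometric. Since the cube
  is convex with interior point \<open>0\<close>, a shrunken copy of the section at level \<open>1\<close> lies in all sections
  at levels near \<open>1 - \<eta>\<close>, which gives the upper bound (\<open>section_le_1\<close>); since the cube is compact, the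
  volumes at levels just below \<open>1\<close> do not exceed in the limit the volume at level \<open>1\<close>, which gives the
  lower bound (\<open>section_lower\<close>). Fubini in the directions of a frame and of its orthogonal complement
  rests on the uniqueness of Haar measure (\<open>distr_eq_lborel\<close>).
\<close>


section \<open>Translation-invariant measures on a Euclidean space\<close>

lemma nn_integral_lborel_shift:
  fixes y :: "'a::euclidean_space" and f :: "'a \<Rightarrow> ennreal"
  assumes [measurable]: "f \<in> borel_measurable borel"
  shows "(\<integral>\<^sup>+x. f (x + y) \<partial>lborel) = (\<integral>\<^sup>+x. f x \<partial>lborel)"
proof -
  have "(\<integral>\<^sup>+x. f x \<partial>lborel) = (\<integral>\<^sup>+x. f x \<partial>distr lborel borel ((+) y))"
    by (simp add: lborel_distr_plus)
  also have "\<dots> = (\<integral>\<^sup>+x. f (x + y) \<partial>lborel)"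
    by (subst nn_integral_distr) (auto simp: add.commute)
  finally show ?thesis by simp
qed

lemma nn_integral_lborel_scale:
  fixes f :: "'a::euclidean_space \<Rightarrow> ennreal"
  assumes [measurable]: "f \<in> borel_measurable borel" and c: "c > 0"
  shows "(\<integral>\<^sup>+x. f x \<partial>lborel) = ennreal (c ^ DIM('a)) * (\<integral>\<^sup>+x. f (c *\<^sub>R x) \<partial>lborel)"
proof -
  have "(\<integral>\<^sup>+x. f x \<partial>lborel)
      = (\<integral>\<^sup>+x. f x \<partial>density (distr lborel borel (\<lambda>x. 0 + c *\<^sub>R x)) (\<lambda>_. \<bar>c\<bar> ^ DIM('a)))"
    using c by (intro arg_cong[where f = "\<lambda>M. integral\<^sup>N M f"] lborel_affine) simp
  also have "\<dots> = ennreal (c ^ DIM('a)) * (\<integral>\<^sup>+x. f (c *\<^sub>R x) \<partial>lborel)"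
    using c by (simp add: nn_integral_density nn_integral_distr nn_integral_cmult)
  finally show ?thesis .
qed

abbreviation gauss :: "'a::real_normed_vector \<Rightarrow> ennreal" where
  "gauss x \<equiv> ennreal (exp (- (norm x)\<^sup>2))"

definition gauss_mass :: ennreal where
  "gauss_mass = (\<integral>\<^sup>+x. gauss x \<partial>(lborel :: real measure))"

lemma gauss_mass_pos: "gauss_mass \<noteq> 0"
proof
  assume "gauss_mass = 0"
  then have "AE x in (lborel :: real measure). ennreal (exp (- (norm x)\<^sup>2)) = 0"
    unfolding gauss_mass_def by (subst (asm) nn_integral_0_iff_AE) auto
  then have "emeasure (lborel :: real measure) UNIV = 0"
    by (subst (asm) AE_iff_measurable[OF _ refl]) auto
  then show False by simp
qed

lemma gauss_mass_finite: "gauss_mass \<noteq> \<infinity>"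
proof -
  have h: "has_bochner_integral lborel (\<lambda>x::real. exp (- x\<^sup>2)) (2 * (sqrt pi / 2))"
    using has_bochner_integral_even_function[OF gaussian_moment_0] by simp
  have "gauss_mass = ennreal (\<integral>x. exp (- x\<^sup>2) \<partial>(lborel :: real measure))"
    unfolding gauss_mass_def using h by (simp add: nn_integral_eq_integral has_bochner_integral_iff)
  then show ?thesis by (metis ennreal_neq_top infinity_ennreal_def)
qed

lemma gauss_eq_prod:
  fixes c :: "'i \<Rightarrow> real"
  assumes "finite I" and "(norm x)\<^sup>2 = (\<Sum>i\<in>I. (c i)\<^sup>2)"
  shows "gauss x = (\<Prod>i\<in>I. gauss (c i))"
proof -
  have "exp (- (norm x)\<^sup>2) = (\<Prod>i\<in>I. exp (- (norm (c i))\<^sup>2))"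
    using assms by (simp add: exp_sum sum_negf[symmetric])
  then show ?thesis by (simp add: prod_ennreal)
qed

lemma nn_integral_gauss:
  "(\<integral>\<^sup>+x. gauss x \<partial>(lborel :: 'a::euclidean_space measure)) = gauss_mass ^ DIM('a)"
proof -
  have "gauss x = (\<Prod>b\<in>Basis. gauss (x \<bullet> b))" for x :: 'a
    by (rule gauss_eq_prod) (auto simp: norm_eq_sqrt_inner euclidean_inner[of x x] power2_eq_square sum_nonneg)
  then have "(\<integral>\<^sup>+x. gauss x \<partial>(lborel :: 'a measure)) = (\<integral>\<^sup>+x. (\<Prod>b\<in>Basis. ennreal (exp (- (norm (x \<bullet> b))\<^sup>2))) \<partial>(lborel :: 'a measure))"
    by simp
  also have "\<dots> = gauss_mass ^ DIM('a)"
    by (subst nn_integral_lborel_prod) (auto simp: gauss_mass_def)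
  finally show ?thesis .
qed

text \<open>
  Uniqueness of Haar measure, in the form in which it is used: a measurable map that pushes a
  measure forward to a translation-invariant one gives Lebesgue measure as soon as the Gaussian has
  the right integral. The proof computes the double integral of \<open>gauss y * f (T x + y)\<close> in both
  orders.
\<close>

lemma distr_eq_lborel:
  fixes T :: "'b \<Rightarrow> 'a::euclidean_space"
  assumes M: "sigma_finite_measure M" and T[measurable]: "T \<in> M \<rightarrow>\<^sub>M borel"
    and shift: "\<And>f y. f \<in> borel_measurable borel \<Longrightarrow> (\<integral>\<^sup>+x. f (T x + y) \<partial>M) = (\<integral>\<^sup>+x. (f (T x) :: ennreal) \<partial>M)"
    and gauss: "(\<integral>\<^sup>+x. gauss (T x) \<partial>M) = gauss_mass ^ DIM('a)"
  shows "distr M borel T = lborel"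
proof -
  interpret M: sigma_finite_measure M by fact
  interpret P: pair_sigma_finite "lborel :: 'a measure" M ..
  let ?g = "gauss_mass ^ DIM('a)"
  have g0: "?g \<noteq> 0" and ginf: "?g \<noteq> \<infinity>"
    using gauss_mass_pos gauss_mass_finite by (auto simp: power_eq_top_ennreal)
  have eq: "(\<integral>\<^sup>+x. f (T x) \<partial>M) = (\<integral>\<^sup>+y. f y \<partial>lborel)"
    if [measurable]: "f \<in> borel_measurable borel" for f :: "'a \<Rightarrow> ennreal"
  proof -
    have "?g * (\<integral>\<^sup>+x. f (T x) \<partial>M) = (\<integral>\<^sup>+y. gauss y * (\<integral>\<^sup>+x. f (T x + y) \<partial>M) \<partial>lborel)"
      by (simp add: nn_integral_gauss[symmetric] nn_integral_multc shift)
    also have "\<dots> = (\<integral>\<^sup>+y. (\<integral>\<^sup>+x. gauss y * f (T x + y) \<partial>M) \<partial>lborel)"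
      by (simp add: nn_integral_cmult)
    also have "\<dots> = (\<integral>\<^sup>+x. (\<integral>\<^sup>+y. gauss y * f (T x + y) \<partial>lborel) \<partial>M)"
      by (rule P.Fubini'[symmetric]) measurable
    also have "\<dots> = (\<integral>\<^sup>+x. (\<integral>\<^sup>+y. gauss (y - T x) * f y \<partial>lborel) \<partial>M)"
    proof (rule nn_integral_cong)
      fix x
      show "(\<integral>\<^sup>+y. gauss y * f (T x + y) \<partial>lborel) = (\<integral>\<^sup>+y. gauss (y - T x) * f y \<partial>lborel)"
        using nn_integral_lborel_shift[of "\<lambda>y. gauss (y - T x) * f y" "T x"]
        by (simp add: add.commute)
    qed
    also have "\<dots> = (\<integral>\<^sup>+y. (\<integral>\<^sup>+x. gauss (y - T x) * f y \<partial>M) \<partial>lborel)"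
      by (rule P.Fubini') measurable
    also have "\<dots> = (\<integral>\<^sup>+y. ?g * f y \<partial>lborel)"
    proof (rule nn_integral_cong)
      fix y
      have "(\<integral>\<^sup>+x. gauss (y - T x) \<partial>M) = (\<integral>\<^sup>+x. gauss (T x + (- y)) \<partial>M)"
        by (simp add: norm_minus_commute)
      also have "\<dots> = ?g"
        by (subst shift) (auto simp: gauss)
      finally show "(\<integral>\<^sup>+x. gauss (y - T x) * f y \<partial>M) = ?g * f y"
        by (simp add: nn_integral_multc)
    qed
    also have "\<dots> = ?g * (\<integral>\<^sup>+y. f y \<partial>lborel)"
      by (simp add: nn_integral_cmult)
    finally show ?thesis
      using g0 ginf by (simp add: ennreal_mult_cancel_left)
  qed
  show ?thesis
  proof (rule measure_eqI)
    fix A assume "A \<in> sets (distr M borel T)"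
    then have [measurable]: "A \<in> sets borel" by simp
    have "emeasure (distr M borel T) A = (\<integral>\<^sup>+x. indicator A (T x) \<partial>M)"
      by (simp add: nn_integral_distr flip: nn_integral_indicator)
    then show "emeasure (distr M borel T) A = emeasure lborel A"
      by (simp add: eq)
  qed simp
qed

lemma nn_integral_PiM_lborel_insert:
  fixes f :: "('i \<Rightarrow> 'k::euclidean_space) \<Rightarrow> ennreal"
  assumes "finite I" "i \<notin> I" "f \<in> borel_measurable (\<Pi>\<^sub>M i\<in>insert i I. lborel)"
  shows "(\<integral>\<^sup>+x. f x \<partial>(\<Pi>\<^sub>M i\<in>insert i I. lborel)) = (\<integral>\<^sup>+y. (\<integral>\<^sup>+x. f (x(i := y)) \<partial>(\<Pi>\<^sub>M i\<in>I. lborel)) \<partial>lborel)"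
proof -
  interpret product_sigma_finite "\<lambda>_::'i. lborel :: 'k measure" ..
  show ?thesis using assms by (rule product_nn_integral_insert_rev)
qed

lemma sigma_finite_PiM_lborel:
  "finite I \<Longrightarrow> sigma_finite_measure (\<Pi>\<^sub>M i\<in>I. (lborel :: 'k::euclidean_space measure))"
proof -
  interpret product_sigma_finite "\<lambda>_. lborel :: 'k measure" ..
  show "finite I \<Longrightarrow> sigma_finite_measure (\<Pi>\<^sub>M i\<in>I. (lborel :: 'k::euclidean_space measure))"
    by (rule sigma_finite)
qed

text \<open>
  The invariance properties of a product of Lebesgue measures over an arbitrary finite index set,
  which has no Euclidean structure of its own; by induction on the index set.
\<close>

lemma nn_integral_PiM_lborel_affine:
  fixes f :: "('i \<Rightarrow> 'k::euclidean_space) \<Rightarrow> ennreal"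
  assumes I: "finite I" and c: "c > 0" and f: "f \<in> borel_measurable (\<Pi>\<^sub>M i\<in>I. lborel)"
  shows "(\<integral>\<^sup>+x. f x \<partial>(\<Pi>\<^sub>M i\<in>I. lborel))
    = ennreal (c ^ (DIM('k) * card I)) * (\<integral>\<^sup>+x. f (\<lambda>i\<in>I. c *\<^sub>R x i + u i) \<partial>(\<Pi>\<^sub>M i\<in>I. lborel))"
  using I f
proof (induction I arbitrary: f rule: finite_induct)
  case empty
  then show ?case by (simp add: PiM_empty nn_integral_count_space_finite)
next
  case (insert i I)
  note fin = insert.hyps
  interpret sigma_finite_measure "\<Pi>\<^sub>M i\<in>I. (lborel :: 'k measure)"
    by (rule sigma_finite_PiM_lborel) fact
  note upd_meas = measurable_compose[OF measurable_fun_upd[of "insert i I" I i] insert.prems]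
  have cc: "ennreal (c ^ (DIM('k) * card (insert i I))) = ennreal (c ^ (DIM('k) * card I)) * ennreal (c ^ DIM('k))"
    using c by (simp add: fin power_add ennreal_mult'[symmetric] mult.commute)
  let ?s = "\<lambda>x. \<lambda>i\<in>I. c *\<^sub>R x i + u i" and ?t = "\<lambda>x. \<lambda>i\<in>insert i I. c *\<^sub>R x i + u i"
  have upd: "?t (x(i := y)) = (?s x)(i := c *\<^sub>R y + u i)" if "x \<in> space (\<Pi>\<^sub>M i\<in>I. (lborel :: 'k measure))" for x y
    using insert.hyps by (auto simp: fun_eq_iff)
  have s_meas: "(\<lambda>p. ?s (snd p)) \<in> N \<Otimes>\<^sub>M (\<Pi>\<^sub>M i\<in>I. lborel) \<rightarrow>\<^sub>M (\<Pi>\<^sub>M i\<in>I. lborel)" for N :: "'k measure"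
    by measurable
  have meas: "(\<lambda>y. \<integral>\<^sup>+x. f ((?s x)(i := y)) \<partial>(\<Pi>\<^sub>M i\<in>I. lborel)) \<in> borel_measurable borel"
    by (rule borel_measurable_nn_integral, subst case_prod_beta', rule upd_meas[OF _ s_meas]) auto
  have "(\<integral>\<^sup>+x. f x \<partial>(\<Pi>\<^sub>M i\<in>insert i I. lborel))
      = (\<integral>\<^sup>+y. ennreal (c ^ (DIM('k) * card I)) * (\<integral>\<^sup>+x. f ((?s x)(i := y)) \<partial>(\<Pi>\<^sub>M i\<in>I. lborel)) \<partial>lborel)"
    by (subst nn_integral_PiM_lborel_insert[OF fin insert.prems], intro nn_integral_cong, rule insert.IH, rule upd_meas) auto
  also have "\<dots> = ennreal (c ^ (DIM('k) * card I)) * (\<integral>\<^sup>+y. (\<integral>\<^sup>+x. f ((?s x)(i := y)) \<partial>(\<Pi>\<^sub>M i\<in>I. lborel)) \<partial>lborel)"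
    using meas by (intro nn_integral_cmult) simp
  also have "(\<integral>\<^sup>+y. (\<integral>\<^sup>+x. f ((?s x)(i := y)) \<partial>(\<Pi>\<^sub>M i\<in>I. lborel)) \<partial>lborel)
     = (\<integral>\<^sup>+y. (\<integral>\<^sup>+x. f ((?s x)(i := y + u i)) \<partial>(\<Pi>\<^sub>M i\<in>I. lborel)) \<partial>lborel)"
    by (rule nn_integral_lborel_shift[OF meas, symmetric])
  also have "\<dots> = ennreal (c ^ DIM('k)) * (\<integral>\<^sup>+y. (\<integral>\<^sup>+x. f ((?s x)(i := c *\<^sub>R y + u i)) \<partial>(\<Pi>\<^sub>M i\<in>I. lborel)) \<partial>lborel)"
    by (rule nn_integral_lborel_scale[OF _ c], rule measurable_compose[OF _ meas]) simp
  also have "(\<integral>\<^sup>+y. (\<integral>\<^sup>+x. f ((?s x)(i := c *\<^sub>R y + u i)) \<partial>(\<Pi>\<^sub>M i\<in>I. lborel)) \<partial>lborel)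
     = (\<integral>\<^sup>+y. (\<integral>\<^sup>+x. f (?t (x(i := y))) \<partial>(\<Pi>\<^sub>M i\<in>I. lborel)) \<partial>lborel)"
    by (intro nn_integral_cong) (simp only: upd)
  also have "\<dots> = (\<integral>\<^sup>+x. f (?t x) \<partial>(\<Pi>\<^sub>M i\<in>insert i I. lborel))"
    by (rule nn_integral_PiM_lborel_insert[OF fin, symmetric], rule measurable_compose[OF _ insert.prems]) measurable
  finally show ?case
    unfolding cc mult.assoc .
qed


lemma distr_lborel_isometry:
  fixes L :: "'a::euclidean_space \<Rightarrow> 'a"
  assumes L: "orthogonal_transformation L"
  shows "distr lborel borel L = lborel"
proof (rule distr_eq_lborel[OF sigma_finite_lborel])
  have lin: "linear L" and surj: "surj L"
    using L by (auto simp: orthogonal_transformation_linear orthogonal_transformation_surj)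
  then have [measurable]: "L \<in> borel_measurable borel"
    by (auto intro!: borel_measurable_continuous_onI linear_continuous_on simp: linear_conv_bounded_linear)
  show "L \<in> lborel \<rightarrow>\<^sub>M borel" by simp
  show "(\<integral>\<^sup>+x. gauss (L x) \<partial>lborel) = gauss_mass ^ DIM('a)"
    using L by (simp add: orthogonal_transformation_norm nn_integral_gauss)
  fix f :: "'a \<Rightarrow> ennreal" and y assume [measurable]: "f \<in> borel_measurable borel"
  obtain u where "L u = y" using surj by (metis surjD)
  then have "(\<integral>\<^sup>+x. f (L x + y) \<partial>lborel) = (\<integral>\<^sup>+x. f (L (x + u)) \<partial>lborel)"
    using lin by (simp add: linear_add)
  then show "(\<integral>\<^sup>+x. f (L x + y) \<partial>lborel) = (\<integral>\<^sup>+x. f (L x) \<partial>lborel)"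
    using nn_integral_lborel_shift[of "\<lambda>x. f (L x)" u] by simp
qed

lemma vec_lambda_measurable:
  "(\<lambda>x. \<chi> j. x j) \<in> (\<Pi>\<^sub>M j\<in>(UNIV::'n::finite set). lborel) \<rightarrow>\<^sub>M (borel :: ('k::euclidean_space ^ 'n) measure)"
proof -
  have axis: "(axis j :: 'k \<Rightarrow> 'k ^ 'n) \<in> borel_measurable borel" for j
    unfolding axis_def by (intro borel_measurable_continuous_onI continuous_on_vec_lambda, case_tac "i = j") simp_all
  have "(\<chi> j. x j) = (\<Sum>j\<in>UNIV. axis j (x j))" for x :: "'n \<Rightarrow> 'k"
    by (auto simp: vec_eq_iff axis_def if_distrib[of "\<lambda>v. v $ _"] cong: if_cong)
  then show ?thesis
    by (simp only:) (intro borel_measurable_sum measurable_compose[OF _ axis], simp)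
qed

lemma distr_PiM_vec:
  "distr (\<Pi>\<^sub>M j\<in>(UNIV::'n::finite set). lborel) borel (\<lambda>x. \<chi> j. x j) = (lborel :: ('k::euclidean_space ^ 'n) measure)"
proof (rule distr_eq_lborel[OF sigma_finite_PiM_lborel])
  let ?M = "\<Pi>\<^sub>M j\<in>(UNIV::'n set). (lborel :: 'k measure)"
  interpret product_sigma_finite "\<lambda>_::'n. lborel :: 'k measure" ..
  note meas[measurable] = vec_lambda_measurable[where 'k = 'k and 'n = 'n]
  show "(\<lambda>x. \<chi> j. x j) \<in> ?M \<rightarrow>\<^sub>M (borel :: ('k ^ 'n) measure)" by (rule meas)
  have "gauss (\<chi> j. x j) = (\<Prod>j\<in>UNIV. gauss (norm (x j)))" for x :: "'n \<Rightarrow> 'k"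
    by (rule gauss_eq_prod) (auto simp: norm_vec_def L2_set_def sum_nonneg)
  then show "(\<integral>\<^sup>+x. gauss (\<chi> j. x j) \<partial>?M) = gauss_mass ^ DIM('k ^ 'n)"
    by (simp add: product_nn_integral_prod[where f = "\<lambda>_ x. gauss x"] nn_integral_gauss flip: power_mult)
       (simp add: mult.commute)
  fix f :: "'k ^ 'n \<Rightarrow> ennreal" and y assume f[measurable]: "f \<in> borel_measurable borel"
  show "(\<integral>\<^sup>+x. f ((\<chi> j. x j) + y) \<partial>?M) = (\<integral>\<^sup>+x. f (\<chi> j. x j) \<partial>?M)"
    using nn_integral_PiM_lborel_affine[of UNIV 1 "\<lambda>x. f (\<chi> j. x j)" "\<lambda>j. y $ j"] measurable_compose[OF meas f]
    by (simp add: restrict_def plus_vec_def)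
qed simp

lemma nn_integral_vec:
  fixes f :: "'k::euclidean_space ^ 'n \<Rightarrow> ennreal"
  assumes f: "f \<in> borel_measurable borel"
  shows "(\<integral>\<^sup>+x. f x \<partial>lborel) = (\<integral>\<^sup>+x. f (\<chi> j. x j) \<partial>(\<Pi>\<^sub>M j\<in>UNIV. lborel))"
  by (subst distr_PiM_vec[symmetric], subst nn_integral_distr) (use f vec_lambda_measurable in auto)

text \<open>
  Fubini along an orthogonal splitting: \<open>E\<close> parametrises one summand isometrically and \<open>B\<close> is an
  orthonormal basis of the other. The map is onto, so translations of the target lift to translations
  of the parameters, and by Pythagoras the Gaussian factors.
\<close>

lemma distr_orthogonal_split:
  fixes B :: "'a::euclidean_space set" and E :: "'k::euclidean_space \<Rightarrow> 'a"
  assumes B: "pairwise orthogonal B" "\<And>b. b \<in> B \<Longrightarrow> norm b = 1"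
    and E: "linear E" "\<And>z. norm (E z) = norm z"
    and span: "span B = {w. \<forall>z. E z \<bullet> w = 0}"
  shows "distr (lborel \<Otimes>\<^sub>M (\<Pi>\<^sub>M b\<in>B. lborel)) borel (\<lambda>(z, c). E z + (\<Sum>b\<in>B. c b *\<^sub>R b)) = lborel"
proof (rule distr_eq_lborel)
  have indep: "independent B"
    using B by (intro pairwise_orthogonal_independent) (auto dest: B(2))
  then have fin: "finite B" by (rule independent_imp_finite)
  let ?M = "\<Pi>\<^sub>M b\<in>B. (lborel :: real measure)"
  let ?S = "\<lambda>c. \<Sum>b\<in>B. c b *\<^sub>R b"
  let ?T = "\<lambda>(z, c). E z + ?S c"
  interpret product_sigma_finite "\<lambda>_::'a. lborel :: real measure" ..
  interpret M: sigma_finite_measure ?M by (rule sigma_finite_PiM_lborel) fact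
  interpret P: pair_sigma_finite "lborel :: 'k measure" ?M ..
  show "sigma_finite_measure ((lborel :: 'k measure) \<Otimes>\<^sub>M ?M)" ..
  have [measurable]: "E \<in> borel_measurable borel"
    using E(1) by (intro borel_measurable_continuous_onI linear_continuous_on) (simp add: linear_conv_bounded_linear)
  show T[measurable]: "?T \<in> lborel \<Otimes>\<^sub>M ?M \<rightarrow>\<^sub>M borel" by measurable
  have fst: "(\<integral>\<^sup>+x. g (?T x) \<partial>(lborel \<Otimes>\<^sub>M ?M)) = (\<integral>\<^sup>+z. (\<integral>\<^sup>+c. g (E z + ?S c) \<partial>?M) \<partial>lborel)"
    if "g \<in> borel_measurable borel" for g
    using M.nn_integral_fst[OF measurable_compose[OF T that]] by simp
  have inj: "inj E" using E by (metis linear_injective_0 norm_eq_zero)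
  have "dim (range E) = DIM('k)"
    using dim_image_eq[OF E(1)] inj by (simp add: subspace_UNIV) 
  moreover have "subspace (range E)"
    using E(1) by (rule linear_subspace_image) simp
  moreover have "span B = {y \<in> UNIV. \<forall>x\<in>range E. orthogonal x y}"
    by (auto simp: span orthogonal_def)
  ultimately have "dim (span B) + DIM('k) = DIM('a)"
    using dim_subspace_orthogonal_to_vectors[of "range E" UNIV] by (simp add: subspace_UNIV)
  then have card: "card B + DIM('k) = DIM('a)"
    using indep by (simp add: dim_eq_card_independent)
  have nrm: "(norm (E z + ?S c))\<^sup>2 = (norm z)\<^sup>2 + (\<Sum>b\<in>B. (c b)\<^sup>2)" for z c
  proof -
    have S: "?S c \<in> span B" by (intro span_sum span_scale span_base)
    then have "E z \<bullet> ?S c = 0" using span by auto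
    then have "(norm (E z + ?S c))\<^sup>2 = (norm (E z))\<^sup>2 + (norm (?S c))\<^sup>2"
      by (intro norm_add_Pythagorean) (auto simp: orthogonal_def)
    also have "(norm (?S c))\<^sup>2 = (\<Sum>b\<in>B. (norm (c b *\<^sub>R b))\<^sup>2)"
      using B by (intro norm_sum_Pythagorean fin) (auto simp: pairwise_def orthogonal_def)
    finally show ?thesis using B E by simp
  qed
  have gauss_eq: "gauss (E z + ?S c) = gauss z * (\<Prod>b\<in>B. gauss (c b))" for z c
    using fin by (simp add: nrm exp_sum sum_negf[symmetric] prod_ennreal exp_diff exp_minus divide_inverse ennreal_mult'[symmetric] mult.commute prod_nonneg)
  have "(\<integral>\<^sup>+x. gauss (?T x) \<partial>(lborel \<Otimes>\<^sub>M ?M)) = (\<integral>\<^sup>+z. (\<integral>\<^sup>+c. gauss (E z + ?S c) \<partial>?M) \<partial>lborel)"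
    by (rule fst) measurable
  also have "\<dots> = gauss_mass ^ DIM('k) * gauss_mass ^ card B"
    unfolding gauss_eq using fin
    by (simp add: nn_integral_cmult nn_integral_multc product_nn_integral_prod[where f = "\<lambda>_ x. gauss x"] nn_integral_gauss gauss_mass_def[symmetric] del: real_norm_def)
  finally show "(\<integral>\<^sup>+x. gauss (?T x) \<partial>(lborel \<Otimes>\<^sub>M ?M)) = gauss_mass ^ DIM('a)"
    using card by (simp add: power_add[symmetric] add.commute)
  fix f :: "'a \<Rightarrow> ennreal" and y assume f[measurable]: "f \<in> borel_measurable borel"
  obtain y1 y2 where "y1 \<in> span (range E)" and y2: "\<And>w. w \<in> span (range E) \<Longrightarrow> orthogonal y2 w" and y: "y = y1 + y2"
    using orthogonal_subspace_decomp_exists[of "range E" y] by blast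
  then obtain z0 where z0: "y1 = E z0"
    using E(1) by (metis linear_subspace_image rangeE span_eq_iff subspace_UNIV)
  have "y2 \<in> span B" unfolding span using y2[OF span_base, OF rangeI] by (simp add: orthogonal_def inner_commute)
  then obtain u where u: "y2 = ?S u"
    using fin by (auto simp: span_finite)
  have "(\<integral>\<^sup>+x. f (?T x + y) \<partial>(lborel \<Otimes>\<^sub>M ?M)) = (\<integral>\<^sup>+z. (\<integral>\<^sup>+c. f (E (z + z0) + ?S (\<lambda>b\<in>B. c b + u b)) \<partial>?M) \<partial>lborel)"
    by (subst fst, measurable)
       (simp add: y z0 u linear_add[OF E(1)] scaleR_left_distrib sum.distrib algebra_simps)
  also have "\<dots> = (\<integral>\<^sup>+z. (\<integral>\<^sup>+c. f (E (z + z0) + ?S c) \<partial>?M) \<partial>lborel)"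
  proof (rule nn_integral_cong)
    fix z
    show "(\<integral>\<^sup>+c. f (E (z + z0) + ?S (\<lambda>b\<in>B. c b + u b)) \<partial>?M) = (\<integral>\<^sup>+c. f (E (z + z0) + ?S c) \<partial>?M)"
      using nn_integral_PiM_lborel_affine[OF fin, of 1 "\<lambda>c. f (E (z + z0) + ?S c)" u] by simp
  qed
  also have "\<dots> = (\<integral>\<^sup>+z. (\<integral>\<^sup>+c. f (E z + ?S c) \<partial>?M) \<partial>lborel)"
    by (rule nn_integral_lborel_shift) measurable
  also have "\<dots> = (\<integral>\<^sup>+x. f (?T x) \<partial>(lborel \<Otimes>\<^sub>M ?M))"
    by (rule fst[symmetric]) measurable
  finally show "(\<integral>\<^sup>+x. f (?T x + y) \<partial>(lborel \<Otimes>\<^sub>M ?M)) = (\<integral>\<^sup>+x. f (?T x) \<partial>(lborel \<Otimes>\<^sub>M ?M))" .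
qed

section \<open>The uniform law on the unit ball and sums of two uniform vectors\<close>

definition ball_law :: "'k::euclidean_space measure" where
  "ball_law = uniform_measure lborel (cball 0 1)"

lemma sets_ball_law[simp, measurable_cong]: "sets ball_law = sets borel"
  and space_ball_law[simp]: "space ball_law = UNIV"
  by (simp_all add: ball_law_def)

lemma emeasure_unit_cball:
  "emeasure lborel (cball 0 1 :: 'k::euclidean_space set) \<noteq> 0"
  "emeasure lborel (cball 0 1 :: 'k::euclidean_space set) \<noteq> \<infinity>"
  using unit_ball_vol_pos[of "real DIM('k)"] by (auto simp: emeasure_cball simp del: unit_ball_vol_pos)

lemma prob_space_ball_law: "prob_space (ball_law :: 'k::euclidean_space measure)"
  unfolding ball_law_def by (rule prob_space_uniform_measure) (use emeasure_unit_cball in auto)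

lemma nn_integral_ball_law:
  fixes f :: "'k::euclidean_space \<Rightarrow> ennreal"
  assumes [measurable]: "f \<in> borel_measurable borel"
  shows "(\<integral>\<^sup>+v. f v \<partial>ball_law) = (\<integral>\<^sup>+v. f v * indicator (cball 0 1) v \<partial>lborel) / emeasure lborel (cball 0 1 :: 'k set)"
  unfolding ball_law_def by (rule nn_integral_uniform_measure) auto

lemma AE_ball_law: "AE v in (ball_law :: 'k::euclidean_space measure). norm v \<le> 1"
  unfolding ball_law_def by (rule AE_uniform_measureI) auto

subsection \<open>Uniform points of the three-dimensional sphere\<close>

lemma borel_measurable_fst_snd[measurable (raw)]:
  fixes f :: "'c \<Rightarrow> complex \<times> complex"
  assumes f: "f \<in> M \<rightarrow>\<^sub>M borel"
  shows "(\<lambda>x. fst (f x)) \<in> M \<rightarrow>\<^sub>M borel" "(\<lambda>x. snd (f x)) \<in> M \<rightarrow>\<^sub>M borel"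
  by (rule measurable_compose[OF f], intro borel_measurable_continuous_onI continuous_intros)+

text \<open>
  The disc of radius \<open>\<surd>s\<close> has area \<open>\<pi> s\<close>.
\<close>

lemma distr_norm_square_complex:
  "distr (lborel :: complex measure) borel (\<lambda>z. (norm z)\<^sup>2) = density lborel (\<lambda>s. ennreal pi * indicator {0..} s)"
    (is "?L = ?R")
proof (rule measure_eqI_generator_eq[where E = "range (\<lambda>x::real. {..x})" and \<Omega> = UNIV and A = "\<lambda>n::nat. {..real n}"])
  show "Int_stable (range (\<lambda>x::real. {..x}))"
    by (auto simp: Int_stable_def)
  show "sets ?L = sigma_sets UNIV (range (\<lambda>x::real. {..x}))" "sets ?R = sigma_sets UNIV (range (\<lambda>x::real. {..x}))"
    by (simp_all add: borel_eq_atMost)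
  have L: "emeasure ?L {..x} = ennreal (if 0 \<le> x then pi * x else 0)" for x
  proof (cases "0 \<le> x")
    case True
    have "(norm z)\<^sup>2 \<le> x \<longleftrightarrow> norm z \<le> sqrt x" for z :: complex
      using real_sqrt_le_iff[of "(norm z)\<^sup>2" x] by simp
    then have "(\<lambda>z::complex. (norm z)\<^sup>2) -` {..x} = cball 0 (sqrt x)"
      by auto
    then show ?thesis
      using True by (simp add: emeasure_distr emeasure_cball eval_unit_ball_vol)
  next
    case False
    then have "(\<lambda>z::complex. (norm z)\<^sup>2) -` {..x} = {}"
      by (auto simp: not_le) (metis linorder_not_less order_trans zero_le_power2)
    then show ?thesis using False by (simp add: emeasure_distr)
  qed
  have R: "emeasure ?R {..x} = ennreal (if 0 \<le> x then pi * x else 0)" for x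
  proof -
    have "emeasure ?R {..x} = (\<integral>\<^sup>+s. ennreal pi * indicator {0..x} s \<partial>lborel)"
      by (subst emeasure_density) (auto intro!: nn_integral_cong split: split_indicator)
    also have "\<dots> = ennreal (if 0 \<le> x then pi * x else 0)"
      by (simp add: nn_integral_cmult emeasure_lborel_Icc_eq ennreal_mult'[symmetric])
    finally show ?thesis .
  qed
  show "emeasure ?L X = emeasure ?R X" if "X \<in> range (\<lambda>x::real. {..x})" for X
    using that L R by auto
  show "emeasure ?L {..real n} \<noteq> \<infinity>" for n by (simp add: L)
  show "(\<Union>n. {..real n}) = UNIV" by (auto intro: real_arch_simple)
qed auto

text \<open>
  The uniform law of the unit sphere of \<open>\<complex>\<^sup>2\<close>, as the law of a normalised Gaussian vector: in this form
  its invariance under isometries is inherited from Lebesgue measure.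
\<close>

definition sphere_law :: "(complex \<times> complex) measure" where
  "sphere_law = distr (density lborel (\<lambda>x. gauss x / gauss_mass ^ 4)) borel (\<lambda>x. x /\<^sub>R norm x)"

lemma sets_sphere_law[simp, measurable_cong]: "sets sphere_law = sets borel"
  and space_sphere_law[simp]: "space sphere_law = UNIV"
  by (simp_all add: sphere_law_def)

lemma nn_integral_sphere_law:
  assumes [measurable]: "f \<in> borel_measurable borel"
  shows "(\<integral>\<^sup>+u. f u \<partial>sphere_law) = (\<integral>\<^sup>+x. gauss x * f (x /\<^sub>R norm x) \<partial>lborel) / gauss_mass ^ 4"
proof -
  have "(\<integral>\<^sup>+u. f u \<partial>sphere_law) = (\<integral>\<^sup>+x. gauss x / gauss_mass ^ 4 * f (x /\<^sub>R norm x) \<partial>lborel)"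
    unfolding sphere_law_def by (simp add: nn_integral_distr nn_integral_density)
  also have "\<dots> = (\<integral>\<^sup>+x. gauss x * f (x /\<^sub>R norm x) / gauss_mass ^ 4 \<partial>lborel)"
    by (simp add: divide_ennreal_def mult_ac)
  also have "\<dots> = (\<integral>\<^sup>+x. gauss x * f (x /\<^sub>R norm x) \<partial>lborel) / gauss_mass ^ 4"
    by (rule nn_integral_divide) measurable
  finally show ?thesis .
qed

lemma gauss_mass_pow4: "gauss_mass ^ 4 \<noteq> 0" "gauss_mass ^ 4 \<noteq> \<infinity>"
  using gauss_mass_pos gauss_mass_finite by (auto simp: power_eq_top_ennreal)

lemma prob_space_sphere_law: "prob_space sphere_law"
proof
  have "emeasure sphere_law (space sphere_law) = (\<integral>\<^sup>+u. 1 \<partial>sphere_law)" by simp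
  also have "\<dots> = gauss_mass ^ 4 / gauss_mass ^ 4"
    by (subst nn_integral_sphere_law) (simp_all add: nn_integral_gauss)
  also have "\<dots> = 1" using gauss_mass_pow4 by (intro ennreal_divide_self) (auto simp: less_top)
  finally show "emeasure sphere_law (space sphere_law) = 1" .
qed

lemma AE_sphere_law: "AE u in sphere_law. norm u = 1"
proof -
  have "AE x in (lborel :: (complex \<times> complex) measure). x \<noteq> 0" by (rule AE_lborel_singleton)
  then have "AE x in density lborel (\<lambda>x :: complex \<times> complex. gauss x / gauss_mass ^ 4). norm (x /\<^sub>R norm x) = 1"
    by (subst AE_density) auto
  then show ?thesis
    unfolding sphere_law_def by (subst AE_distr_iff) auto
qed

lemma nn_integral_sphere_law_isometry:
  assumes [measurable]: "f \<in> borel_measurable borel" and L: "orthogonal_transformation L"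
  shows "(\<integral>\<^sup>+u. f (L u) \<partial>sphere_law) = (\<integral>\<^sup>+u. f u \<partial>sphere_law)"
proof -
  have [measurable]: "L \<in> borel_measurable borel"
    using orthogonal_transformation_linear[OF L]
    by (intro borel_measurable_continuous_onI linear_continuous_on) (simp add: linear_conv_bounded_linear)
  have "(\<integral>\<^sup>+x. gauss x * f (L (x /\<^sub>R norm x)) \<partial>lborel) = (\<integral>\<^sup>+x. gauss (L x) * f (L x /\<^sub>R norm (L x)) \<partial>lborel)"
    using L by (simp add: orthogonal_transformation_norm orthogonal_transformation_scaleR)
  also have "\<dots> = (\<integral>\<^sup>+x. gauss x * f (x /\<^sub>R norm x) \<partial>distr lborel borel L)"
    by (subst nn_integral_distr) auto
  finally show ?thesis
    by (simp add: nn_integral_sphere_law distr_lborel_isometry[OF L])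
qed

text \<open>
  Archimedes: the projection of the uniform law of the unit sphere of \<open>\<complex>\<^sup>2\<close> to the first coordinate
  is the uniform law of the disc. For the Gaussian vector \<open>(z, w)\<close> one replaces \<open>w\<close> by \<open>\<bar>w\<bar>\<^sup>2\<close>, whose
  law has constant density, and then \<open>\<bar>w\<bar>\<^sup>2\<close> by \<open>s = \<bar>z\<bar>\<^sup>2 + \<bar>w\<bar>\<^sup>2\<close>; for fixed \<open>s\<close> the variable
  \<open>z\<close> ranges over a disc of radius \<open>\<surd>s\<close> with constant density.
\<close>

lemma nn_integral_sphere_law_fst:
  fixes f :: "complex \<Rightarrow> ennreal"
  assumes [measurable]: "f \<in> borel_measurable borel"
  shows "(\<integral>\<^sup>+u. f (fst u) \<partial>sphere_law) = (\<integral>\<^sup>+v. f v \<partial>ball_law)"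
proof -
  have [measurable]: "cball 0 1 \<in> sets (borel :: complex measure)" by simp
  have f_fst: "(\<lambda>u. f (fst u)) \<in> borel_measurable (borel :: (complex \<times> complex) measure)" by measurable
  define C where "C = (\<integral>\<^sup>+s. ennreal pi * ennreal (exp (- s)) * indicator {0..} s * ennreal s \<partial>lborel)"
  have main: "(\<integral>\<^sup>+x. gauss x * f (fst (x /\<^sub>R norm x)) \<partial>(lborel :: (complex \<times> complex) measure)) = C * (\<integral>\<^sup>+v. f v * indicator (cball 0 1) v \<partial>lborel)"
    if [measurable]: "f \<in> borel_measurable borel" for f :: "complex \<Rightarrow> ennreal"
  proof -
    let ?h = "\<lambda>z s. ennreal (exp (- s)) * f (z /\<^sub>R sqrt s)"
    have "(\<integral>\<^sup>+x. gauss x * f (fst (x /\<^sub>R norm x)) \<partial>(lborel :: (complex \<times> complex) measure))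
        = (\<integral>\<^sup>+x. ?h (fst x) ((norm (fst x))\<^sup>2 + (norm (snd x))\<^sup>2) \<partial>((lborel :: complex measure) \<Otimes>\<^sub>M (lborel :: complex measure)))"
      unfolding lborel_prod by (intro nn_integral_cong) (auto simp: norm_prod_def)
    also have "\<dots> = (\<integral>\<^sup>+z. (\<integral>\<^sup>+w. ?h z ((norm z)\<^sup>2 + (norm w)\<^sup>2) \<partial>(lborel :: complex measure)) \<partial>lborel)"
      by (subst lborel.nn_integral_fst[symmetric]) auto
    also have "\<dots> = (\<integral>\<^sup>+z. (\<integral>\<^sup>+s. ?h z ((norm z)\<^sup>2 + s) \<partial>distr (lborel :: complex measure) borel (\<lambda>w. (norm w)\<^sup>2)) \<partial>lborel)"
      by (subst nn_integral_distr) auto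
    also have "\<dots> = (\<integral>\<^sup>+z. (\<integral>\<^sup>+s. ennreal pi * indicator {0..} s * ?h z ((norm z)\<^sup>2 + s) \<partial>lborel) \<partial>lborel)"
      unfolding distr_norm_square_complex by (subst nn_integral_density) auto
    also have "\<dots> = (\<integral>\<^sup>+z. (\<integral>\<^sup>+s. ennreal pi * indicator {(norm z)\<^sup>2..} s * ?h z s \<partial>lborel) \<partial>lborel)"
    proof (rule nn_integral_cong)
      fix z :: complex
      have "(\<integral>\<^sup>+s. ennreal pi * indicator {(norm z)\<^sup>2..} s * ?h z s \<partial>lborel)
          = (\<integral>\<^sup>+s. ennreal pi * indicator {(norm z)\<^sup>2..} (s + (norm z)\<^sup>2) * ?h z (s + (norm z)\<^sup>2) \<partial>lborel)"
        by (rule nn_integral_lborel_shift[symmetric]) measurable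
      also have "\<dots> = (\<integral>\<^sup>+s. ennreal pi * indicator {0..} s * ?h z ((norm z)\<^sup>2 + s) \<partial>lborel)"
        by (intro nn_integral_cong) (auto simp: add.commute split: split_indicator)
      finally show "(\<integral>\<^sup>+s. ennreal pi * indicator {0..} s * ?h z ((norm z)\<^sup>2 + s) \<partial>lborel)
          = (\<integral>\<^sup>+s. ennreal pi * indicator {(norm z)\<^sup>2..} s * ?h z s \<partial>lborel)" by simp
    qed
    also have "\<dots> = (\<integral>\<^sup>+s. (\<integral>\<^sup>+z. ennreal pi * indicator {z. (norm z)\<^sup>2 \<le> s} z * ?h z s \<partial>lborel) \<partial>lborel)"
      by (subst lborel_pair.Fubini') (auto intro!: nn_integral_cong split: split_indicator)
    also have "\<dots> = (\<integral>\<^sup>+s. ennreal pi * ennreal (exp (- s)) * indicator {0..} s * ennreal s * (\<integral>\<^sup>+v. f v * indicator (cball 0 1) v \<partial>lborel) \<partial>lborel)"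
    proof (rule nn_integral_cong_AE, rule AE_mp[OF AE_lborel_singleton[of 0]], rule AE_I2, rule impI)
      fix s :: real assume s0: "s \<noteq> 0"
      show "(\<integral>\<^sup>+z. ennreal pi * indicator {z. (norm z)\<^sup>2 \<le> s} z * ?h z s \<partial>lborel)
         = ennreal pi * ennreal (exp (- s)) * indicator {0..} s * ennreal s * (\<integral>\<^sup>+v. f v * indicator (cball 0 1) v \<partial>lborel)"
      proof (cases "0 \<le> s")
        case False
        then have "\<not> (norm z)\<^sup>2 \<le> s" for z :: complex using zero_le_power2[of "norm z"] by linarith
        then show ?thesis using False by simp
      next
        case True
        then have s: "s > 0" using s0 by simp
        have ind: "indicator {z. (norm z)\<^sup>2 \<le> s} (sqrt s *\<^sub>R v) = (indicator (cball 0 1) v :: ennreal)" for v :: complex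
          using s by (auto simp: power_mult_distrib mult_le_cancel_left_pos power2_le_iff_abs_le abs_square_le_1 split: split_indicator)
        have "(\<integral>\<^sup>+z. ennreal pi * indicator {z. (norm z)\<^sup>2 \<le> s} z * ?h z s \<partial>lborel)
            = ennreal (sqrt s ^ DIM(complex)) * (\<integral>\<^sup>+v. ennreal pi * indicator {z. (norm z)\<^sup>2 \<le> s} (sqrt s *\<^sub>R v) * ?h (sqrt s *\<^sub>R v) s \<partial>lborel)"
          using s by (intro nn_integral_lborel_scale) auto
        also have "\<dots> = ennreal s * (\<integral>\<^sup>+v. (ennreal pi * ennreal (exp (- s))) * (f v * indicator (cball 0 1) v) \<partial>lborel)"
          using s by (simp add: ind mult_ac)
        also have "\<dots> = ennreal s * ((ennreal pi * ennreal (exp (- s))) * (\<integral>\<^sup>+v. f v * indicator (cball 0 1) v \<partial>lborel))"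
          by (intro arg_cong[where f = "(*) (ennreal s)"] nn_integral_cmult) measurable
        finally show ?thesis using True by (simp add: mult_ac)
      qed
    qed
    also have "\<dots> = C * (\<integral>\<^sup>+v. f v * indicator (cball 0 1) v \<partial>lborel)"
      unfolding C_def by (rule nn_integral_multc) measurable
    finally show ?thesis .
  qed
  let ?b = "emeasure lborel (cball 0 1 :: complex set)"
  have Cb: "gauss_mass ^ 4 = C * ?b"
    using main[of "\<lambda>_. 1"] nn_integral_gauss[where 'a = "complex \<times> complex"] by simp
  have b: "?b \<noteq> 0" "?b \<noteq> \<infinity>" by (rule emeasure_unit_cball)+
  have C: "C \<noteq> 0" "C \<noteq> \<infinity>"
    using gauss_mass_pow4 b unfolding Cb by (auto simp: ennreal_mult_eq_top_iff)
  let ?I = "\<integral>\<^sup>+v. f v * indicator (cball 0 1) v \<partial>lborel"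
  have "(\<integral>\<^sup>+u. f (fst u) \<partial>sphere_law) = C * ?I / (C * ?b)"
    unfolding nn_integral_sphere_law[OF f_fst] main[OF assms] Cb ..
  also have "\<dots> = ?I / ?b"
    using C by (metis divide_mult_eq mult.commute)
  also have "\<dots> = (\<integral>\<^sup>+v. f v \<partial>ball_law)"
    by (simp add: nn_integral_ball_law)
  finally show ?thesis .
qed


subsection \<open>Quaternions and the complex key identity\<close>

text \<open>
  The product of the quaternions \<open>z + w j\<close>, written as pairs \<open>(z, w)\<close>.
\<close>

definition qmult :: "complex \<times> complex \<Rightarrow> complex \<times> complex \<Rightarrow> complex \<times> complex" where
  "qmult p q = (fst p * fst q - snd p * cnj (snd q), fst p * snd q + snd p * cnj (fst q))"

lemma norm_qmult: "norm (qmult p q) = norm p * norm q"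
proof -
  have "(norm (qmult p q))\<^sup>2 = (norm p)\<^sup>2 * (norm q)\<^sup>2"
    by (simp add: norm_prod_def qmult_def cmod_power2) (simp add: power2_eq_square algebra_simps)
  then show ?thesis by (metis norm_ge_zero power2_eq_imp_eq power_mult_distrib mult_nonneg_nonneg)
qed

lemma linear_qmult_left: "linear (qmult p)" and linear_qmult_right: "linear (\<lambda>p. qmult p q)"
  by (auto intro!: linearI prod_eqI simp: qmult_def scaleR_conv_of_real algebra_simps)

lemma qmult_one: "qmult p (1, 0) = p"
  by (simp add: qmult_def)

lemma qmult_isometry:
  assumes "norm q = 1"
  shows "orthogonal_transformation (qmult q)" "orthogonal_transformation (\<lambda>p. qmult p q)"
  using assms by (simp_all add: orthogonal_transformation linear_qmult_left linear_qmult_right norm_qmult)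

lemma qmult_measurable[measurable]:
  assumes [measurable]: "f \<in> M \<rightarrow>\<^sub>M borel" "g \<in> M \<rightarrow>\<^sub>M borel"
  shows "(\<lambda>x. qmult (f x) (g x)) \<in> M \<rightarrow>\<^sub>M borel"
proof -
  have "continuous_on UNIV (\<lambda>p. qmult (fst p) (snd p))"
    unfolding qmult_def by (intro continuous_intros)
  then have "(\<lambda>p. qmult (fst p) (snd p)) \<in> borel \<Otimes>\<^sub>M borel \<rightarrow>\<^sub>M borel"
    unfolding borel_prod by (rule borel_measurable_continuous_onI)
  from measurable_compose[OF measurable_Pair[OF assms] this] show ?thesis by simp
qed

lemma norm_one_plus_unit:
  fixes q :: "complex \<times> complex"
  assumes "norm q = 1"
  shows "(norm (r *\<^sub>R (1, 0) + t *\<^sub>R q))\<^sup>2 = r\<^sup>2 + t\<^sup>2 + 2 * r * t * (fst q \<bullet> 1)"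
proof -
  have "(norm (r *\<^sub>R (1, 0) + t *\<^sub>R q))\<^sup>2
      = r\<^sup>2 * ((1, 0) \<bullet> (1 :: complex, 0 :: complex)) + t\<^sup>2 * (q \<bullet> q) + 2 * r * t * (q \<bullet> (1, 0))"
    unfolding power2_norm_eq_inner by (simp add: inner_add inner_commute power2_eq_square del: inner_Pair scaleR_Pair)
  moreover have "q \<bullet> q = 1" using assms by (simp add: norm_eq_1)
  moreover have "q \<bullet> (1, 0) = fst q \<bullet> 1" by (cases q) simp
  ultimately show ?thesis by simp
qed

text \<open>
  Multiplication by a unit quaternion on either side is an isometry. Hence for independent uniform
  \<open>u\<close>, \<open>u'\<close> on the sphere one may write \<open>u' = u q\<close> with \<open>q\<close> uniform and independent of \<open>u\<close>, so
  \<open>r u + t u' = u (r + t q)\<close>, whose law given \<open>q\<close> is that of \<open>\<bar>r + t q\<bar> u\<close>. Projecting to the first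
  coordinate gives the law of the sum of two uniform points of discs.
\<close>

lemma nn_integral_ball_law_sum_complex:
  fixes f :: "complex \<Rightarrow> ennreal"
  assumes [measurable]: "f \<in> borel_measurable borel"
  shows "(\<integral>\<^sup>+v. (\<integral>\<^sup>+v'. f (r *\<^sub>R v + t *\<^sub>R v') \<partial>ball_law) \<partial>ball_law)
    = (\<integral>\<^sup>+w. (\<integral>\<^sup>+v. f (sqrt (r\<^sup>2 + t\<^sup>2 + 2 * r * t * (w \<bullet> 1)) *\<^sub>R v) \<partial>ball_law) \<partial>(ball_law :: complex measure))"
proof -
  interpret S: prob_space sphere_law by (rule prob_space_sphere_law)
  interpret P: pair_sigma_finite sphere_law sphere_law ..
  interpret B: prob_space "ball_law :: complex measure" by (rule prob_space_ball_law)
  let ?x = "\<lambda>q. r *\<^sub>R (1, 0) + t *\<^sub>R q"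
  have "(\<integral>\<^sup>+v. (\<integral>\<^sup>+v'. f (r *\<^sub>R v + t *\<^sub>R v') \<partial>ball_law) \<partial>ball_law)
      = (\<integral>\<^sup>+u. (\<integral>\<^sup>+v'. f (r *\<^sub>R fst u + t *\<^sub>R v') \<partial>ball_law) \<partial>sphere_law)"
    by (rule nn_integral_sphere_law_fst[symmetric]) measurable
  also have "\<dots> = (\<integral>\<^sup>+u. (\<integral>\<^sup>+u'. f (r *\<^sub>R fst u + t *\<^sub>R fst u') \<partial>sphere_law) \<partial>sphere_law)"
    by (intro nn_integral_cong nn_integral_sphere_law_fst[symmetric]) measurable
  also have "\<dots> = (\<integral>\<^sup>+u. (\<integral>\<^sup>+q. f (r *\<^sub>R fst u + t *\<^sub>R fst (qmult u q)) \<partial>sphere_law) \<partial>sphere_law)"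
  proof (rule nn_integral_cong_AE, rule AE_mp[OF AE_sphere_law], rule AE_I2, rule impI)
    fix u :: "complex \<times> complex" assume "norm u = 1"
    then show "(\<integral>\<^sup>+u'. f (r *\<^sub>R fst u + t *\<^sub>R fst u') \<partial>sphere_law) = (\<integral>\<^sup>+q. f (r *\<^sub>R fst u + t *\<^sub>R fst (qmult u q)) \<partial>sphere_law)"
      by (intro nn_integral_sphere_law_isometry[symmetric, where f = "\<lambda>u'. f (r *\<^sub>R fst u + t *\<^sub>R fst u')"] qmult_isometry) measurable
  qed
  also have "\<dots> = (\<integral>\<^sup>+u. (\<integral>\<^sup>+q. f (fst (qmult u (?x q))) \<partial>sphere_law) \<partial>sphere_law)"
    by (simp add: linear_add[OF linear_qmult_left] linear_scale[OF linear_qmult_left] qmult_one del: scaleR_Pair)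
  also have "\<dots> = (\<integral>\<^sup>+q. (\<integral>\<^sup>+u. f (fst (qmult u (?x q))) \<partial>sphere_law) \<partial>sphere_law)"
    by (rule P.Fubini') measurable
  also have "\<dots> = (\<integral>\<^sup>+q. (\<integral>\<^sup>+v. f (sqrt (r\<^sup>2 + t\<^sup>2 + 2 * r * t * (fst q \<bullet> 1)) *\<^sub>R v) \<partial>ball_law) \<partial>sphere_law)"
  proof (rule nn_integral_cong_AE, rule AE_mp[OF AE_sphere_law], rule AE_I2, rule impI)
    fix q :: "complex \<times> complex" assume q: "norm q = 1"
    let ?R = "norm (?x q)"
    have R: "?R = sqrt (r\<^sup>2 + t\<^sup>2 + 2 * r * t * (fst q \<bullet> 1))"
      unfolding norm_one_plus_unit[OF q, symmetric] by simp
    have "(\<integral>\<^sup>+u. f (fst (qmult u (?x q))) \<partial>sphere_law) = (\<integral>\<^sup>+u. f (?R *\<^sub>R fst u) \<partial>sphere_law)"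
    proof (cases "?R = 0")
      case True
      then have x0: "?x q = 0" by simp
      show ?thesis unfolding x0 by (simp add: linear_0[OF linear_qmult_left])
    next
      case False
      then have unit: "norm (?x q /\<^sub>R ?R) = 1" by simp
      have "qmult u (?x q) = ?R *\<^sub>R qmult u (?x q /\<^sub>R ?R)" for u
        using False by (simp add: linear_scale[OF linear_qmult_left])
      then have "(\<integral>\<^sup>+u. f (fst (qmult u (?x q))) \<partial>sphere_law) = (\<integral>\<^sup>+u. f (?R *\<^sub>R fst (qmult u (?x q /\<^sub>R ?R))) \<partial>sphere_law)"
        by simp
      also have "\<dots> = (\<integral>\<^sup>+u. f (?R *\<^sub>R fst u) \<partial>sphere_law)"
        by (intro nn_integral_sphere_law_isometry[where f = "\<lambda>u. f (?R *\<^sub>R fst u)"] qmult_isometry unit) measurable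
      finally show ?thesis .
    qed
    also have "\<dots> = (\<integral>\<^sup>+v. f (?R *\<^sub>R v) \<partial>ball_law)"
      by (rule nn_integral_sphere_law_fst) measurable
    finally show "(\<integral>\<^sup>+u. f (fst (qmult u (?x q))) \<partial>sphere_law)
        = (\<integral>\<^sup>+v. f (sqrt (r\<^sup>2 + t\<^sup>2 + 2 * r * t * (fst q \<bullet> 1)) *\<^sub>R v) \<partial>ball_law)"
      by (simp only: R)
  qed
  also have "\<dots> = (\<integral>\<^sup>+w. (\<integral>\<^sup>+v. f (sqrt (r\<^sup>2 + t\<^sup>2 + 2 * r * t * (w \<bullet> 1)) *\<^sub>R v) \<partial>ball_law) \<partial>(ball_law :: complex measure))"
    by (rule nn_integral_sphere_law_fst[where f = "\<lambda>w. \<integral>\<^sup>+v. f (sqrt (r\<^sup>2 + t\<^sup>2 + 2 * r * t * (w \<bullet> 1)) *\<^sub>R v) \<partial>ball_law"]) measurable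
  finally show ?thesis .
qed

text \<open>
  The four real coordinates of a uniform point of the sphere are exchanged by isometries, and their
  squares add up to 1.
\<close>

lemma nn_integral_ball_law_square_complex:
  "(\<integral>\<^sup>+v. ennreal ((v \<bullet> 1)\<^sup>2) \<partial>(ball_law :: complex measure)) = ennreal (1 / 4)"
proof -
  interpret S: prob_space sphere_law by (rule prob_space_sphere_law)
  let ?J = "\<integral>\<^sup>+u. ennreal ((Re (fst u))\<^sup>2) \<partial>sphere_law"
  have J: "(\<integral>\<^sup>+u. ennreal ((Re (fst (L u)))\<^sup>2) \<partial>sphere_law) = ?J" if "orthogonal_transformation L" for L :: "complex \<times> complex \<Rightarrow> complex \<times> complex"
    by (rule nn_integral_sphere_law_isometry[where f = "\<lambda>u. ennreal ((Re (fst u))\<^sup>2)", OF _ that]) measurable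
  have lin: "linear (\<lambda>u :: complex \<times> complex. (\<i> * fst u, snd u))" "linear (\<lambda>u :: complex \<times> complex. (snd u, fst u))"
      "linear (\<lambda>u :: complex \<times> complex. (\<i> * snd u, fst u))"
    by (auto intro!: linearI simp: algebra_simps)
  have 1: "(\<integral>\<^sup>+u. ennreal ((Im (fst u))\<^sup>2) \<partial>sphere_law) = ?J"
    using J[of "\<lambda>u. (\<i> * fst u, snd u)"] lin(1)
    by (simp add: orthogonal_transformation norm_prod_def norm_mult)
  have 2: "(\<integral>\<^sup>+u. ennreal ((Re (snd u))\<^sup>2) \<partial>sphere_law) = ?J"
    using J[of "\<lambda>u. (snd u, fst u)"] lin(2)
    by (simp add: orthogonal_transformation norm_prod_def add.commute)
  have 3: "(\<integral>\<^sup>+u. ennreal ((Im (snd u))\<^sup>2) \<partial>sphere_law) = ?J"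
    using J[of "\<lambda>u. (\<i> * snd u, fst u)"] lin(3)
    by (simp add: orthogonal_transformation norm_prod_def norm_mult add.commute)
  have "4 * ?J = ?J + ?J + ?J + ?J"
    by (simp add: numeral_Bit0 distrib_right add.assoc del: one_add_one)
  also have "\<dots> = (\<integral>\<^sup>+u. ennreal ((Re (fst u))\<^sup>2) + ennreal ((Im (fst u))\<^sup>2) + ennreal ((Re (snd u))\<^sup>2) + ennreal ((Im (snd u))\<^sup>2) \<partial>sphere_law)"
    by (simp add: nn_integral_add 1 2 3)
  also have "\<dots> = (\<integral>\<^sup>+u. 1 \<partial>sphere_law)"
  proof (rule nn_integral_cong_AE, rule AE_mp[OF AE_sphere_law], rule AE_I2, rule impI)
    fix u :: "complex \<times> complex" assume "norm u = 1"
    then have "(Re (fst u))\<^sup>2 + (Im (fst u))\<^sup>2 + (Re (snd u))\<^sup>2 + (Im (snd u))\<^sup>2 = 1"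
      by (simp add: norm_prod_def cmod_power2 real_sqrt_eq_1_iff add.assoc)
    then show "ennreal ((Re (fst u))\<^sup>2) + ennreal ((Im (fst u))\<^sup>2) + ennreal ((Re (snd u))\<^sup>2) + ennreal ((Im (snd u))\<^sup>2) = 1"
      by (simp add: ennreal_plus[symmetric] del: ennreal_plus)
  qed
  finally have "4 * ?J = 1" using S.emeasure_space_1 by simp
  moreover have "4 * ennreal (1/4) = 1"
    by (simp add: ennreal_mult'[symmetric] flip: ennreal_numeral)
  ultimately have "4 * ?J = 4 * ennreal (1/4)" by simp
  then have "?J = ennreal (1/4)" by (simp add: ennreal_mult_cancel_left)
  then show ?thesis
    using nn_integral_sphere_law_fst[of "\<lambda>v. ennreal ((Re v)\<^sup>2)"] by (simp add: inner_complex_def)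
qed

subsection \<open>The real key identity\<close>

lemma nn_integral_ball_law_real:
  fixes f F :: "real \<Rightarrow> real"
  assumes cont: "continuous_on {-1..1} F"
    and deriv: "\<And>x. -1 < x \<Longrightarrow> x < 1 \<Longrightarrow> (F has_real_derivative f x) (at x)"
    and nonneg: "\<And>x. 0 \<le> f x" and f: "f \<in> borel_measurable borel"
  shows "(\<integral>\<^sup>+v. ennreal (f v) \<partial>ball_law) = ennreal ((F 1 - F (-1)) / 2)"
proof -
  have "(f has_integral (F 1 - F (-1))) {-1..1}"
    using deriv by (intro fundamental_theorem_of_calculus_interior cont)
      (auto simp: has_real_derivative_iff_has_vector_derivative)
  then have i: "(\<integral>\<^sup>+v. ennreal (indicator {-1..1} v * f v) \<partial>lborel) = ennreal (F 1 - F (-1))"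
    using nonneg by (intro nn_integral_has_integral_lebesgue)
  have "0 \<le> F 1 - F (-1)"
    using has_integral_nonneg[OF \<open>(f has_integral _) _\<close>] nonneg by auto
  have e: "emeasure lborel (cball 0 1 :: real set) = 2"
    by (simp add: cball_eq_atLeastAtMost)
  have "(\<integral>\<^sup>+v. ennreal (f v) \<partial>ball_law) = (\<integral>\<^sup>+v. ennreal (f v) * indicator (cball 0 1) v \<partial>lborel) / 2"
    unfolding e[symmetric] ball_law_def by (rule nn_integral_uniform_measure) (use f in auto)
  also have "(\<integral>\<^sup>+v. ennreal (f v) * indicator (cball 0 1) v \<partial>lborel) = (\<integral>\<^sup>+v. ennreal (indicator {-1..1} v * f v) \<partial>lborel)"
    by (intro nn_integral_cong) (auto simp: cball_eq_atLeastAtMost split: split_indicator)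
  finally show ?thesis
    using \<open>0 \<le> F 1 - F (-1)\<close> by (simp add: i ennreal_divide_numeral)
qed

lemma emeasure_ball_law_real_atMost:
  assumes "\<rho> > 0"
  shows "emeasure ball_law {v :: real. \<rho> * v \<le> c} = ennreal ((max 0 (c + \<rho>) - max 0 (c - \<rho>)) / (2 * \<rho>))"
proof -
  have "emeasure ball_law {v :: real. \<rho> * v \<le> c} = emeasure lborel (cball 0 1 \<inter> {v :: real. \<rho> * v \<le> c}) / emeasure lborel (cball 0 1 :: real set)"
    unfolding ball_law_def by (subst emeasure_uniform_measure) auto
  also have "cball 0 1 \<inter> {v. \<rho> * v \<le> c} = {-1 .. min 1 (c / \<rho>)}"
    using assms by (auto simp: cball_eq_atLeastAtMost field_simps)
  also have "emeasure lborel {-1 .. min 1 (c / \<rho>)} = ennreal ((max 0 (c + \<rho>) - max 0 (c - \<rho>)) / \<rho>)"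
    using assms by (auto simp: emeasure_lborel_Icc_eq min_def max_def field_simps)
  finally show ?thesis
    using assms by (simp add: cball_eq_atLeastAtMost ennreal_divide_numeral)
qed

lemma has_derivative_half_square_pos:
  "((\<lambda>x. (max 0 x)\<^sup>2 / 2) has_real_derivative max 0 x) (at (x::real))"
proof (cases x "0 :: real" rule: linorder_cases)
  case equal
  have "((\<lambda>h. ((max 0 h)\<^sup>2 / 2) / h) \<longlongrightarrow> 0) (at (0::real))"
  proof (rule Lim_null_comparison)
    show "\<forall>\<^sub>F h in at (0::real). norm (((max 0 h)\<^sup>2 / 2) / h) \<le> \<bar>h\<bar>"
      by (auto simp: max_def power2_eq_square)
    show "((\<lambda>h. \<bar>h\<bar>) \<longlongrightarrow> 0) (at (0::real))"
      by (intro tendsto_eq_intros) auto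
  qed
  then show ?thesis using equal by (simp add: DERIV_def)
next
  case greater
  have "((\<lambda>x. x\<^sup>2 / 2) has_real_derivative x) (at x)" by (auto intro!: derivative_eq_intros)
  then have "((\<lambda>x. (max 0 x)\<^sup>2 / 2) has_real_derivative x) (at x)"
    by (rule has_field_derivative_transform_within_open[where S = "{0<..}"]) (use greater in auto)
  then show ?thesis using greater by simp
next
  case less
  have "((\<lambda>x. 0) has_real_derivative 0) (at x)" by simp
  then have "((\<lambda>x. (max 0 x)\<^sup>2 / 2) has_real_derivative 0) (at x)"
    by (rule has_field_derivative_transform_within_open[where S = "{..<0}"]) (use less in auto)
  then show ?thesis using less by simp
qed

text \<open>
  Both sides are compared through their distribution functions. Write \<open>H\<close> for half the square of the
  positive part. Averaging the distribution function of a uniform variable amounts to integrating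
  differences of \<open>H'\<close>, and on both sides this produces the same second difference of \<open>H\<close>. On the right
  the antiderivative in \<open>w\<close> is \<open>(H (c + R) + H (c - R)) / (2 r t)\<close>, because \<open>R' = r t / R\<close>.
\<close>

lemma nn_integral_ball_law_sum_real:
  fixes f :: "real \<Rightarrow> ennreal"
  assumes f[measurable]: "f \<in> borel_measurable borel" and "0 \<le> r" "0 \<le> t"
  shows "(\<integral>\<^sup>+v. (\<integral>\<^sup>+v'. f (r *\<^sub>R v + t *\<^sub>R v') \<partial>ball_law) \<partial>ball_law)
    = (\<integral>\<^sup>+w. (\<integral>\<^sup>+v. f (sqrt (r\<^sup>2 + t\<^sup>2 + 2 * r * t * (w \<bullet> 1)) *\<^sub>R v) \<partial>ball_law) \<partial>(ball_law :: real measure))"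
proof -
  let ?U = "ball_law :: real measure"
  interpret U: prob_space ?U by (rule prob_space_ball_law)
  interpret P: pair_prob_space ?U ?U ..
  have U1: "emeasure ?U UNIV = 1" using U.emeasure_space_1 by simp
  consider "r = 0" | "t = 0" | "0 < r" "0 < t" using assms by fastforce
  then show ?thesis
  proof cases
    assume "r = 0" then show ?thesis using assms U1 by simp
  next
    assume "t = 0" then show ?thesis using assms U1 by simp
  next
    assume r: "0 < r" and t: "0 < t"
    let ?R = "\<lambda>w. sqrt (r\<^sup>2 + t\<^sup>2 + 2 * r * t * w)"
    let ?X1 = "\<lambda>(v, v'). r * v + t * v'" and ?X2 = "\<lambda>(w, v). ?R w * v"
    let ?M1 = "distr (?U \<Otimes>\<^sub>M ?U) borel ?X1" and ?M2 = "distr (?U \<Otimes>\<^sub>M ?U) borel ?X2"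
    let ?H = "\<lambda>x::real. (max 0 x)\<^sup>2 / 2"
    have [measurable]: "?X1 \<in> ?U \<Otimes>\<^sub>M ?U \<rightarrow>\<^sub>M borel" "?X2 \<in> ?U \<Otimes>\<^sub>M ?U \<rightarrow>\<^sub>M borel"
      by measurable
    have e1: "emeasure ?M1 {..c} = ennreal ((?H (c + r + t) - ?H (c + r - t) - ?H (c - r + t) + ?H (c - r - t)) / (4 * r * t))" for c
    proof -
      let ?G = "\<lambda>v'. (?H (c - r - t * v') - ?H (c + r - t * v')) / (2 * r * t)"
      have "emeasure ?M1 {..c} = (\<integral>\<^sup>+v'. (\<integral>\<^sup>+v. indicator {v. r * v \<le> c - t * v'} v \<partial>?U) \<partial>?U)"
      proof -
        have "emeasure ?M1 {..c} = (\<integral>\<^sup>+p. indicator {..c} (?X1 p) \<partial>(?U \<Otimes>\<^sub>M ?U))"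
          by (simp add: nn_integral_distr flip: nn_integral_indicator)
        also have "\<dots> = (\<integral>\<^sup>+v'. (\<integral>\<^sup>+v. indicator {..c} (?X1 (v, v')) \<partial>?U) \<partial>?U)"
          by (rule P.nn_integral_snd[symmetric]) measurable
        also have "\<dots> = (\<integral>\<^sup>+v'. (\<integral>\<^sup>+v. indicator {v. r * v \<le> c - t * v'} v \<partial>?U) \<partial>?U)"
          by (intro nn_integral_cong) (auto split: split_indicator)
        finally show ?thesis .
      qed
      also have "\<dots> = (\<integral>\<^sup>+v'. ennreal ((max 0 (c - t * v' + r) - max 0 (c - t * v' - r)) / (2 * r)) \<partial>?U)"
        by (subst nn_integral_indicator) (auto simp: emeasure_ball_law_real_atMost[OF r])
      also have "\<dots> = ennreal ((?G 1 - ?G (-1)) / 2)"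
      proof (rule nn_integral_ball_law_real)
        fix x :: real
        have H: "((\<lambda>v'. ?H (k - t * v')) has_real_derivative max 0 (k - t * x) * (- t)) (at x)" for k
          by (rule DERIV_chain2[where f = ?H, OF has_derivative_half_square_pos]) (auto intro!: derivative_eq_intros)
        have "((\<lambda>v'. (?H (c - r - t * v') - ?H (c + r - t * v')) / (2 * r * t)) has_real_derivative
            (max 0 (c - r - t * x) * (- t) - max 0 (c + r - t * x) * (- t)) / (2 * r * t)) (at x)"
          by (intro DERIV_cdivide DERIV_diff H)
        then show "(?G has_real_derivative (max 0 (c - t * x + r) - max 0 (c - t * x - r)) / (2 * r)) (at x)"
          using r t by (auto elim!: DERIV_cong simp: field_simps)
        show "0 \<le> (max 0 (c - t * x + r) - max 0 (c - t * x - r)) / (2 * r)" using r by auto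
      qed (use r t in \<open>auto intro!: continuous_intros\<close>)
      also have "(?G 1 - ?G (-1)) / 2 = (?H (c + r + t) - ?H (c + r - t) - ?H (c - r + t) + ?H (c - r - t)) / (4 * r * t)"
      proof -
        have "((a - b) / (2 * r * t) - (x - y) / (2 * r * t)) / 2 = (y - b - x + a) / (4 * r * t)" for a b x y
          using r t by (simp add: field_simps)
        from this[of "?H (c - r - t)" "?H (c + r - t)" "?H (c - r + t)" "?H (c + r + t)"] show ?thesis
          by (simp only: mult_1_right mult_minus1_right diff_minus_eq_add)
      qed
      finally show ?thesis .
    qed
    have e2: "emeasure ?M2 {..c} = ennreal ((?H (c + r + t) - ?H (c + r - t) - ?H (c - r + t) + ?H (c - r - t)) / (4 * r * t))" for c
    proof -
      \<comment> \<open>at \<open>w = -1\<close> and \<open>r = t\<close> the radius vanishes, so this endpoint is excluded\<close>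
      have R0: "0 < r\<^sup>2 + t\<^sup>2 + 2 * r * t * w" if "-1 < w" for w
      proof -
        have "2 * r * t * (w + 1) > 0" using r t that by simp
        moreover have "r\<^sup>2 + t\<^sup>2 + 2 * r * t * w = (r - t)\<^sup>2 + 2 * r * t * (w + 1)"
          by (simp add: power2_eq_square algebra_simps)
        ultimately show ?thesis by (metis add_nonneg_pos zero_le_power2)
      qed
      let ?F = "\<lambda>w. (?H (c + ?R w) + ?H (c - ?R w)) / (2 * r * t)"
      let ?f = "\<lambda>w. (max 0 (c + ?R w) - max 0 (c - ?R w)) / (2 * ?R w)"
      have "emeasure ?M2 {..c} = (\<integral>\<^sup>+w. (\<integral>\<^sup>+v. indicator {v. ?R w * v \<le> c} v \<partial>?U) \<partial>?U)"
      proof -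
        have "emeasure ?M2 {..c} = (\<integral>\<^sup>+p. indicator {..c} (?X2 p) \<partial>(?U \<Otimes>\<^sub>M ?U))"
          by (simp add: nn_integral_distr flip: nn_integral_indicator)
        also have "\<dots> = (\<integral>\<^sup>+w. (\<integral>\<^sup>+v. indicator {..c} (?X2 (w, v)) \<partial>?U) \<partial>?U)"
          by (rule U.nn_integral_fst[symmetric]) measurable
        also have "\<dots> = (\<integral>\<^sup>+w. (\<integral>\<^sup>+v. indicator {v. ?R w * v \<le> c} v \<partial>?U) \<partial>?U)"
          by (intro nn_integral_cong) (auto split: split_indicator)
        finally show ?thesis .
      qed
      also have "\<dots> = (\<integral>\<^sup>+w. ennreal (?f w) \<partial>?U)"
      proof (rule nn_integral_cong_AE)
        have "AE w in lborel. w \<noteq> (-1 :: real)" by (rule AE_lborel_singleton)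
        then have "AE w in ?U. w \<noteq> -1 \<and> norm w \<le> 1"
          unfolding ball_law_def by (intro AE_uniform_measureI) auto
        then show "AE w in ?U. (\<integral>\<^sup>+v. indicator {v. ?R w * v \<le> c} v \<partial>?U) = ennreal (?f w)"
          by eventually_elim (subst nn_integral_indicator, auto intro!: emeasure_ball_law_real_atMost R0 real_sqrt_gt_zero)
      qed
      also have "\<dots> = ennreal ((?F 1 - ?F (-1)) / 2)"
      proof (rule nn_integral_ball_law_real)
        show "continuous_on {-1..1} ?F" using r t by (auto intro!: continuous_intros)
        fix w :: real
        show "(?F has_real_derivative ?f w) (at w)" if "-1 < w"
        proof -
          have dR: "(?R has_real_derivative r * t / ?R w) (at w)"
            using R0[OF that] by (auto intro!: derivative_eq_intros simp: field_simps)
          have "((\<lambda>w. ?H (c + ?R w)) has_real_derivative max 0 (c + ?R w) * (r * t / ?R w)) (at w)"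
            by (rule DERIV_chain2[where f = ?H, OF has_derivative_half_square_pos], rule DERIV_cong[OF DERIV_add[OF DERIV_const dR]]) simp
          moreover have "((\<lambda>w. ?H (c - ?R w)) has_real_derivative max 0 (c - ?R w) * (- (r * t / ?R w))) (at w)"
            by (rule DERIV_chain2[where f = ?H, OF has_derivative_half_square_pos], rule DERIV_cong[OF DERIV_diff[OF DERIV_const dR]]) simp
          ultimately have "(?F has_real_derivative (max 0 (c + ?R w) * (r * t / ?R w) + max 0 (c - ?R w) * (- (r * t / ?R w))) / (2 * r * t)) (at w)"
            by (intro DERIV_cdivide DERIV_add)
          moreover have "?R w > 0" using R0[OF that] by simp
          ultimately show ?thesis
            using r t by (auto elim!: DERIV_cong simp: field_simps)
        qed
        have "0 \<le> (max 0 (c + R) - max 0 (c - R)) / (2 * R)" for R :: real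
          by (cases "0 \<le> R") (auto intro!: divide_nonneg_nonneg divide_nonpos_nonpos simp: max_def)
        then show "0 \<le> ?f w" .
        show "?f \<in> borel_measurable borel" by measurable
      qed
      also have "?R 1 = r + t" using r t by (intro real_sqrt_unique) (auto simp: power2_eq_square algebra_simps)
      also have "?R (-1) = \<bar>r - t\<bar>" by (intro real_sqrt_unique) (auto simp: power2_eq_square algebra_simps)
      finally show ?thesis using r t
        by (cases "r \<le> t") (simp_all add: algebra_simps diff_divide_distrib add_divide_distrib)
    qed
    have "?M1 = ?M2"
    proof (rule cdf_unique)
      show "real_distribution ?M1" "real_distribution ?M2"
        by (auto intro!: P.real_distribution_distr)
      show "cdf ?M1 = cdf ?M2"
        by (simp add: fun_eq_iff cdf_def measure_def e1 e2)
    qed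
    then have "(\<integral>\<^sup>+x. f x \<partial>?M1) = (\<integral>\<^sup>+x. f x \<partial>?M2)" by simp
    then show ?thesis
      by (simp add: nn_integral_distr U.nn_integral_fst[symmetric] case_prod_beta')
  qed
qed



lemma nn_integral_ball_law_square_real:
  "(\<integral>\<^sup>+v. ennreal ((v \<bullet> 1)\<^sup>2) \<partial>(ball_law :: real measure)) = ennreal (1 / 3)"
proof -
  have "(\<integral>\<^sup>+v. ennreal ((\<lambda>v. v\<^sup>2) v) \<partial>(ball_law :: real measure)) = ennreal (((\<lambda>x. x ^ 3 / 3) 1 - (\<lambda>x. x ^ 3 / 3) (-1)) / 2)"
    by (rule nn_integral_ball_law_real) (auto intro!: continuous_intros derivative_eq_intros)
  then show ?thesis by simp
qed

lemma measure_ball_law_tail_real: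
  assumes "-1 \<le> w" "w \<le> 1"
  shows "measure (ball_law :: real measure) {v. w \<le> v \<bullet> 1} = 1/2 - w/2"
proof -
  have "cball 0 1 \<inter> {v. w \<le> v \<bullet> 1} = {w .. 1}"
    using assms by (auto simp: cball_eq_atLeastAtMost)
  then have "emeasure (ball_law :: real measure) {v. w \<le> v \<bullet> 1} = ennreal (1 - w) / 2"
    unfolding ball_law_def using assms by (subst emeasure_uniform_measure) (auto simp: cball_eq_atLeastAtMost)
  also have "\<dots> = ennreal ((1 - w) / 2)" using assms by (simp add: ennreal_divide_numeral)
  finally show ?thesis using assms by (simp add: measure_def diff_divide_distrib)
qed

subsection \<open>Symmetries of the uniform law\<close>

lemma nn_integral_ball_law_isometry:
  fixes f :: "'k::euclidean_space \<Rightarrow> ennreal" and L :: "'k \<Rightarrow> 'k"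
  assumes [measurable]: "f \<in> borel_measurable borel" and L: "orthogonal_transformation L"
  shows "(\<integral>\<^sup>+v. f (L v) \<partial>ball_law) = (\<integral>\<^sup>+v. f v \<partial>ball_law)"
proof -
  have [measurable]: "L \<in> borel_measurable borel"
    using orthogonal_transformation_linear[OF L]
    by (intro borel_measurable_continuous_onI linear_continuous_on) (simp add: linear_conv_bounded_linear)
  have [measurable]: "cball 0 1 \<in> sets (borel :: 'k measure)" by simp
  have "(\<integral>\<^sup>+v. f (L v) * indicator (cball 0 1) v \<partial>lborel) = (\<integral>\<^sup>+v. f (L v) * indicator (cball 0 1) (L v) \<partial>lborel)"
    using L by (intro nn_integral_cong) (auto simp: orthogonal_transformation_norm split: split_indicator)
  also have "\<dots> = (\<integral>\<^sup>+v. f v * indicator (cball 0 1) v \<partial>distr lborel borel L)"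
    by (subst nn_integral_distr) auto
  finally show ?thesis
    by (simp add: nn_integral_ball_law distr_lborel_isometry[OF L])
qed

text \<open>
  Multiplication by a scalar of norm 1 is an isometry, so only the norm of the coefficient matters.
\<close>

lemma nn_integral_ball_law_mult:
  fixes f :: "'k::{real_normed_field, euclidean_space} \<Rightarrow> ennreal"
  assumes [measurable]: "f \<in> borel_measurable borel"
  shows "(\<integral>\<^sup>+v. f (v * a) \<partial>ball_law) = (\<integral>\<^sup>+v. f (norm a *\<^sub>R v) \<partial>ball_law)"
proof (cases "a = 0")
  case False
  define u where "u = a /\<^sub>R norm a"
  have "norm u = 1" using False by (simp add: u_def)
  then have "orthogonal_transformation (\<lambda>v. v * u)"
    by (auto simp: orthogonal_transformation norm_mult algebra_simps intro!: linearI)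
  moreover have "v * a = norm a *\<^sub>R (v * u)" for v
    using False by (simp add: u_def)
  ultimately show ?thesis
    using nn_integral_ball_law_isometry[of "\<lambda>v. f (norm a *\<^sub>R v)" "\<lambda>v. v * u"] by simp
qed simp

subsection \<open>Tails of the real part of a uniform point of the disc\<close>

lemma emeasure_ball_law_complex:
  assumes [measurable]: "A \<in> sets borel"
  shows "emeasure ball_law A = emeasure lborel (cball 0 1 \<inter> A :: complex set) / ennreal pi"
  unfolding ball_law_def by (subst emeasure_uniform_measure) (auto simp: emeasure_cball eval_unit_ball_vol)

lemma measure_ball_law_Re_strip:
  assumes "0 \<le> w"
  shows "measure ball_law {v :: complex. 0 \<le> Re v \<and> Re v < w} \<le> 2/3 * w"
proof -
  have "emeasure lborel (cball 0 1 \<inter> {v :: complex. 0 \<le> Re v \<and> Re v < w}) \<le> emeasure lborel (cbox (Complex 0 (-1)) (Complex w 1))"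
  proof (rule emeasure_mono)
    have "\<bar>Im v\<bar> \<le> 1" if "cmod v \<le> 1" for v using abs_Im_le_cmod[of v] that by linarith
    then show "cball 0 1 \<inter> {v :: complex. 0 \<le> Re v \<and> Re v < w} \<subseteq> cbox (Complex 0 (-1)) (Complex w 1)"
      by (force simp: cbox_def Basis_complex_def inner_complex_def abs_le_iff)
  qed simp
  also have "\<dots> = ennreal (2 * w)"
    using assms by (subst emeasure_lborel_cbox) (auto simp: Basis_complex_def inner_complex_def)
  finally have "emeasure ball_law {v :: complex. 0 \<le> Re v \<and> Re v < w} \<le> ennreal (2 * w) / ennreal pi"
    by (subst emeasure_ball_law_complex) (auto intro: divide_right_mono_ennreal)
  also have "\<dots> = ennreal (2 * w / pi)" using assms by (simp add: divide_ennreal)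
  also have "\<dots> \<le> ennreal (2/3 * w)"
    using assms pi_gt3 mult_right_mono[of 3 pi w] by (intro ennreal_leI) (simp add: field_simps)
  finally show ?thesis using assms unfolding measure_def by (intro enn2real_leI) auto
qed

lemma measure_ball_law_Re_uminus:
  assumes [measurable]: "Measurable.pred borel P"
  shows "measure ball_law {v :: complex. P (- Re v)} = measure ball_law {v :: complex. P (Re v)}"
proof -
  have "(\<integral>\<^sup>+v. indicator {v. P (Re v)} (- v) \<partial>(ball_law :: complex measure)) = (\<integral>\<^sup>+v. indicator {v. P (Re v)} v \<partial>ball_law)"
    by (rule nn_integral_ball_law_isometry) (auto simp: orthogonal_transformation intro!: linearI)
  also have "(\<integral>\<^sup>+v. indicator {v. P (Re v)} (- v) \<partial>(ball_law :: complex measure)) = (\<integral>\<^sup>+v. indicator {v. P (- Re v)} v \<partial>ball_law)"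
    by (intro nn_integral_cong) (auto split: split_indicator)
  finally show ?thesis by (simp add: measure_def)
qed

text \<open>
  Compressing the half disc by the factor \<open>w\<close> in the real direction maps it into the strip and
  multiplies areas by \<open>w\<close>.
\<close>

lemma measure_ball_law_Re_strip_lower:
  assumes "0 \<le> w" "w \<le> 1"
  shows "w * measure ball_law {v :: complex. 0 < Re v} \<le> measure ball_law {v :: complex. 0 < Re v \<and> Re v \<le> w}"
proof (cases "w = 0")
  case False
  interpret prob_space "ball_law :: complex measure" by (rule prob_space_ball_law)
  let ?c = "\<lambda>j::complex. if j = 1 then w else 1"
  let ?T = "\<lambda>v::complex. 0 + (\<Sum>j\<in>Basis. (?c j * (v \<bullet> j)) *\<^sub>R j)"
  have T: "?T v = Complex (w * Re v) (Im v)" for v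
    by (simp add: Basis_complex_def inner_complex_def complex_eq_iff)
  have T_meas[measurable]: "?T \<in> borel_measurable borel" by measurable
  let ?A = "cball 0 1 \<inter> {v :: complex. 0 < Re v}" and ?B = "cball 0 1 \<inter> {v :: complex. 0 < Re v \<and> Re v \<le> w}"
  have [measurable]: "?A \<in> sets borel" and B_meas[measurable]: "?B \<in> sets borel" by (auto intro!: sets.Int)
  have sub: "?A \<subseteq> ?T -` ?B"
  proof
    fix v assume v: "v \<in> ?A"
    then have "\<bar>Re v\<bar> \<le> 1" using abs_Re_le_cmod[of v] by auto
    have "(w * Re v)\<^sup>2 \<le> (Re v)\<^sup>2"
      using assms v by (intro power_mono) (auto intro: mult_left_le_one_le)
    then have "cmod (Complex (w * Re v) (Im v)) \<le> cmod v" by (simp add: cmod_def)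
    then show "v \<in> ?T -` ?B"
      using v assms False \<open>\<bar>Re v\<bar> \<le> 1\<close> unfolding vimage_def mem_Collect_eq T
      by (auto simp: intro: mult_left_le)
  qed
  have "emeasure lborel ?B = emeasure (density (distr lborel borel ?T) (\<lambda>_. ennreal (\<Prod>j\<in>Basis. \<bar>?c j\<bar>))) ?B"
    using False by (intro arg_cong2[where f = emeasure] lborel_affine_euclidean refl) auto
  also have "\<dots> = ennreal w * emeasure lborel (?T -` ?B)"
    using assms by (subst emeasure_density_const) (auto simp: emeasure_distr Basis_complex_def)
  finally have "emeasure lborel ?B = ennreal w * emeasure lborel (?T -` ?B)" .
  moreover have "ennreal w * emeasure lborel ?A \<le> ennreal w * emeasure lborel (?T -` ?B)"
    using sub by (intro mult_left_mono emeasure_mono) (use measurable_sets_borel[OF T_meas B_meas] in simp_all)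
  ultimately have "ennreal w * emeasure ball_law {v :: complex. 0 < Re v} \<le> emeasure ball_law {v :: complex. 0 < Re v \<and> Re v \<le> w}"
    by (subst (1 2) emeasure_ball_law_complex) (auto simp: ennreal_times_divide intro!: divide_right_mono_ennreal)
  then show ?thesis
    using assms by (simp add: emeasure_eq_measure ennreal_mult'[symmetric])
qed simp

text \<open>
  For \<open>w \<ge> 0\<close> the missing part of the half disc lies in a strip whose area is at most \<open>2 w\<close>, and
  \<open>2 / \<pi> \<le> 2 / 3\<close>. For \<open>w \<le> 0\<close> a compressed half disc is added.
\<close>

lemma measure_ball_law_tail_complex:
  shows "0 \<le> w \<Longrightarrow> 1/2 - 2/3 * w \<le> measure ball_law {v :: complex. w \<le> v \<bullet> 1}"
    and "-1 \<le> w \<Longrightarrow> w \<le> 0 \<Longrightarrow> 1/2 - w/2 \<le> measure ball_law {v :: complex. w \<le> v \<bullet> 1}"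
proof -
  interpret prob_space "ball_law :: complex measure" by (rule prob_space_ball_law)
  let ?p = "prob {v. 0 < Re v}" and ?e = "prob {v. Re v = 0}"
  have m: "prob {v. Re v < 0} = ?p"
    using measure_ball_law_Re_uminus[of "\<lambda>x. 0 < x"] by simp
  have "prob UNIV = prob ({v. 0 < Re v} \<union> {v. Re v = 0} \<union> {v. Re v < 0})"
    by (intro arg_cong[where f = prob]) auto
  also have "\<dots> = ?p + ?e + prob {v. Re v < 0}"
    by (subst finite_measure_Union; (subst finite_measure_Union)?) (auto simp: space_ball_law)
  finally have sum: "2 * ?p + ?e = 1" using m prob_space by simp
  have e0: "0 \<le> ?e" by simp
  have i: "{v :: complex. w \<le> v \<bullet> 1} = {v. w \<le> Re v}" by (simp add: inner_complex_def)
  {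
    assume w: "0 \<le> w"
    have "?p + ?e = prob ({v. 0 < Re v} \<union> {v. Re v = 0})"
      by (subst finite_measure_Union) (auto simp: space_ball_law)
    also have "\<dots> = prob ({v. 0 \<le> Re v \<and> Re v < w} \<union> {v. w \<le> Re v})"
      using w by (intro arg_cong[where f = prob]) auto
    also have "\<dots> = prob {v. 0 \<le> Re v \<and> Re v < w} + prob {v. w \<le> Re v}"
      by (subst finite_measure_Union) (auto simp: space_ball_law)
    finally show "1/2 - 2/3 * w \<le> prob {v. w \<le> v \<bullet> 1}"
      using sum e0 measure_ball_law_Re_strip[OF w] unfolding i by linarith
  }
  {
    assume w: "-1 \<le> w" "w \<le> 0"
    have "prob {v. w \<le> Re v} = prob ({v. 0 < Re v} \<union> {v. Re v = 0} \<union> {v. w \<le> Re v \<and> Re v < 0})"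
      using w by (intro arg_cong[where f = prob]) auto
    also have "\<dots> = ?p + ?e + prob {v. w \<le> Re v \<and> Re v < 0}"
      by (subst finite_measure_Union; (subst finite_measure_Union)?) (auto simp: space_ball_law)
    also have "prob {v. w \<le> Re v \<and> Re v < 0} = prob {v. 0 < Re v \<and> Re v \<le> - w}"
      using measure_ball_law_Re_uminus[of "\<lambda>x. 0 < x \<and> x \<le> - w"] by (simp add: conj_commute)
    finally have *: "?p + ?e + (- w) * ?p \<le> prob {v. w \<le> Re v}"
      using measure_ball_law_Re_strip_lower[of "- w"] w by simp
    have "(1 - w) * (?p + ?e / 2) \<le> ?p + ?e + (- w) * ?p"
      using w e0 mult_right_mono[of "- w" 1 ?e] by (simp add: algebra_simps)
    moreover have "?p + ?e / 2 = 1 / 2" using sum by simp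
    ultimately show "1/2 - w/2 \<le> prob {v. w \<le> v \<bullet> 1}"
      using * by (simp add: inner_complex_def diff_divide_distrib)
  }
qed

section \<open>The radial law of a sum of independent uniform vectors\<close>

text \<open>
  What the real and the complex case have in common. With \<open>d\<close> the dimension of the scalars plus 2, the
  parameter \<open>K2\<close> is \<open>1 + 2/d\<close>, the constant in the moment inequality \<open>E R\<^sup>4 \<le> K2 (E R\<^sup>2)\<^sup>2\<close> for the
  radial laws, so that \<open>(K2 - 1) / 2\<close> is \<open>1/d\<close>; the inner product with 1 is the real part.
\<close>

locale uniform_ball =
  fixes U :: "'k::{real_normed_field, euclidean_space} measure" and K2 :: real
  assumes U_eq: "U = ball_law"
    and sum_law: "\<And>(f :: 'k \<Rightarrow> ennreal) r t. f \<in> borel_measurable borel \<Longrightarrow> 0 \<le> r \<Longrightarrow> 0 \<le> t \<Longrightarrow>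
      (\<integral>\<^sup>+v. (\<integral>\<^sup>+v'. f (r *\<^sub>R v + t *\<^sub>R v') \<partial>U) \<partial>U)
        = (\<integral>\<^sup>+w. (\<integral>\<^sup>+v. f (sqrt (r\<^sup>2 + t\<^sup>2 + 2 * r * t * (w \<bullet> 1)) *\<^sub>R v) \<partial>U) \<partial>U)"
    and second_moment: "(\<integral>\<^sup>+v. ennreal ((v \<bullet> 1)\<^sup>2) \<partial>U) = ennreal ((K2 - 1) / 2)"
    and K2: "1 \<le> K2" "K2 \<le> 5/3"
    and tail_nonneg: "\<And>w. 0 \<le> w \<Longrightarrow> 1/2 - 2/3 * w \<le> measure U {v. w \<le> v \<bullet> 1}"
    and tail_nonpos: "\<And>w. -1 \<le> w \<Longrightarrow> w \<le> 0 \<Longrightarrow> 1/2 - w/2 \<le> measure U {v. w \<le> v \<bullet> 1}"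
begin

lemma sets_U[simp, measurable_cong]: "sets U = sets borel"
  and space_U[simp]: "space U = UNIV"
  by (simp_all add: U_eq)

sublocale U: prob_space U
  unfolding U_eq by (rule prob_space_ball_law)

lemma U_UNIV[simp]: "emeasure U UNIV = 1"
  using U.emeasure_space_1 by simp

lemma AE_U_inner: "AE w in U. \<bar>w \<bullet> 1\<bar> \<le> 1"
proof -
  have "AE w in U. norm w \<le> 1" unfolding U_eq by (rule AE_ball_law)
  then show ?thesis
  proof eventually_elim
    case (elim w)
    then show ?case using Cauchy_Schwarz_ineq2[of w 1] by simp
  qed
qed

text \<open>
  Adding the values at \<open>w\<close> and \<open>- w\<close> makes odd terms cancel inside a nonnegative integral.
\<close>

lemma nn_integral_U_symmetrise:
  fixes g :: "real \<Rightarrow> ennreal"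
  assumes [measurable]: "g \<in> borel_measurable borel"
  shows "2 * (\<integral>\<^sup>+w. g (w \<bullet> 1) \<partial>U) = (\<integral>\<^sup>+w. g (w \<bullet> 1) + g (- (w \<bullet> 1)) \<partial>U)"
proof -
  have "(\<integral>\<^sup>+w. g (- (w \<bullet> 1)) \<partial>U) = (\<integral>\<^sup>+w. g (w \<bullet> 1) \<partial>U)"
    unfolding U_eq using nn_integral_ball_law_isometry[of "\<lambda>w :: 'k. g (w \<bullet> 1)" uminus]
    by (simp add: orthogonal_transformation linearI)
  then show ?thesis
    by (simp add: nn_integral_add mult_2)
qed

text \<open>
  \<open>radius_law J a \<rho>\<close>: for independent uniform \<open>x\<^sub>j\<close> in the unit ball, the sum of the \<open>x\<^sub>j a\<^sub>j\<close> over
  \<open>J\<close> is distributed as \<open>R v\<close> with \<open>R\<close> of law \<open>\<rho>\<close> and an independent uniform \<open>v\<close>. The moments of \<open>R\<close> are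
  part of the notion, so that they are carried along when sums are joined.
\<close>

definition radius_law :: "'i set \<Rightarrow> ('i \<Rightarrow> 'k) \<Rightarrow> real measure \<Rightarrow> bool" where
  "radius_law J a \<rho> \<longleftrightarrow> prob_space \<rho> \<and> sets \<rho> = sets borel \<and> (AE R in \<rho>. 0 \<le> R) \<and>
     (\<forall>f\<in>borel_measurable borel. (\<integral>\<^sup>+x. f (\<Sum>j\<in>J. x j * a j) \<partial>(\<Pi>\<^sub>M j\<in>J. U)) = (\<integral>\<^sup>+R. (\<integral>\<^sup>+v. (f (R *\<^sub>R v) :: ennreal) \<partial>U) \<partial>\<rho>)) \<and>
     (\<integral>\<^sup>+R. ennreal (R\<^sup>2) \<partial>\<rho>) = ennreal (\<Sum>j\<in>J. (norm (a j))\<^sup>2) \<and>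
     (\<integral>\<^sup>+R. ennreal (R ^ 4) \<partial>\<rho>) \<le> ennreal (K2 * (\<Sum>j\<in>J. (norm (a j))\<^sup>2)\<^sup>2)"

text \<open>
  The law of the length of \<open>r u + t u'\<close> for independent \<open>r\<close>, \<open>t\<close> and independent uniform points \<open>u\<close>,
  \<open>u'\<close> of the sphere of \<open>\<real>\<^sup>d\<close>.
\<close>

definition join_radii :: "real measure \<Rightarrow> real measure \<Rightarrow> real measure" where
  "join_radii \<rho> \<rho>' = distr (\<rho> \<Otimes>\<^sub>M (\<rho>' \<Otimes>\<^sub>M U)) borel (\<lambda>(r, t, w). sqrt (r\<^sup>2 + t\<^sup>2 + 2 * r * t * (w \<bullet> 1)))"

lemma join_radii_props:
  assumes "prob_space \<rho>" and [measurable_cong]: "sets \<rho> = sets borel"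
    and "prob_space \<rho>'" and [measurable_cong]: "sets \<rho>' = sets borel"
  shows sets_join_radii: "sets (join_radii \<rho> \<rho>') = sets borel"
    and prob_space_join_radii: "prob_space (join_radii \<rho> \<rho>')"
    and nn_integral_join_radii: "f \<in> borel_measurable borel \<Longrightarrow>
      (\<integral>\<^sup>+R. f R \<partial>join_radii \<rho> \<rho>') = (\<integral>\<^sup>+r. (\<integral>\<^sup>+t. (\<integral>\<^sup>+w. f (sqrt (r\<^sup>2 + t\<^sup>2 + 2 * r * t * (w \<bullet> 1))) \<partial>U) \<partial>\<rho>') \<partial>\<rho>)"
proof -
  interpret r1: prob_space \<rho> by fact
  interpret r2: prob_space \<rho>' by fact
  interpret P2: pair_prob_space \<rho>' U ..
  interpret P1: pair_prob_space \<rho> "\<rho>' \<Otimes>\<^sub>M U" ..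
  have [measurable]: "(\<lambda>(r, t, w). sqrt (r\<^sup>2 + t\<^sup>2 + 2 * r * t * (w \<bullet> 1))) \<in> \<rho> \<Otimes>\<^sub>M (\<rho>' \<Otimes>\<^sub>M U) \<rightarrow>\<^sub>M borel"
    by measurable
  show "sets (join_radii \<rho> \<rho>') = sets borel" by (simp add: join_radii_def)
  show "prob_space (join_radii \<rho> \<rho>')"
    unfolding join_radii_def by (rule P1.prob_space_distr) measurable
  assume [measurable]: "f \<in> borel_measurable borel"
  show "(\<integral>\<^sup>+R. f R \<partial>join_radii \<rho> \<rho>') = (\<integral>\<^sup>+r. (\<integral>\<^sup>+t. (\<integral>\<^sup>+w. f (sqrt (r\<^sup>2 + t\<^sup>2 + 2 * r * t * (w \<bullet> 1))) \<partial>U) \<partial>\<rho>') \<partial>\<rho>)"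
  proof -
    let ?X = "\<lambda>(r, t, w). sqrt (r\<^sup>2 + t\<^sup>2 + 2 * r * t * (w \<bullet> 1))"
    have "(\<integral>\<^sup>+R. f R \<partial>join_radii \<rho> \<rho>') = (\<integral>\<^sup>+p. f (?X p) \<partial>(\<rho> \<Otimes>\<^sub>M (\<rho>' \<Otimes>\<^sub>M U)))"
      unfolding join_radii_def by (rule nn_integral_distr) measurable
    also have "\<dots> = (\<integral>\<^sup>+r. (\<integral>\<^sup>+q. f (?X (r, q)) \<partial>(\<rho>' \<Otimes>\<^sub>M U)) \<partial>\<rho>)"
      by (rule P2.P.nn_integral_fst[symmetric]) measurable
    also have "\<dots> = (\<integral>\<^sup>+r. (\<integral>\<^sup>+t. (\<integral>\<^sup>+w. f (?X (r, t, w)) \<partial>U) \<partial>\<rho>') \<partial>\<rho>)"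
      by (intro nn_integral_cong U.nn_integral_fst[symmetric]) measurable
    finally show ?thesis by simp
  qed
qed

lemma cross_term_bound:
  fixes r t w :: real
  assumes "\<bar>w\<bar> \<le> 1"
  shows "\<bar>2 * r * t * w\<bar> \<le> r\<^sup>2 + t\<^sup>2"
proof -
  have "\<bar>2 * r * t * w\<bar> \<le> 2 * \<bar>r\<bar> * \<bar>t\<bar>"
    using assms mult_left_mono[of "\<bar>w\<bar>" 1 "2 * \<bar>r\<bar> * \<bar>t\<bar>"] by (simp add: abs_mult)
  also have "\<dots> \<le> r\<^sup>2 + t\<^sup>2"
    using sum_squares_bound[of "\<bar>r\<bar>" "\<bar>t\<bar>"] by simp
  finally show ?thesis .
qed

lemma nn_integral_U_square:
  "(\<integral>\<^sup>+w. ennreal ((sqrt (r\<^sup>2 + t\<^sup>2 + 2 * r * t * (w \<bullet> 1)))\<^sup>2) \<partial>U) = ennreal (r\<^sup>2) + ennreal (t\<^sup>2)"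
proof -
  have "2 * (\<integral>\<^sup>+w. ennreal ((sqrt (r\<^sup>2 + t\<^sup>2 + 2 * r * t * (w \<bullet> 1)))\<^sup>2) \<partial>U)
      = (\<integral>\<^sup>+w. ennreal ((sqrt (r\<^sup>2 + t\<^sup>2 + 2 * r * t * (w \<bullet> 1)))\<^sup>2) + ennreal ((sqrt (r\<^sup>2 + t\<^sup>2 + 2 * r * t * (- (w \<bullet> 1))))\<^sup>2) \<partial>U)"
    by (rule nn_integral_U_symmetrise) measurable
  also have "\<dots> = (\<integral>\<^sup>+w. ennreal (2 * (r\<^sup>2 + t\<^sup>2)) \<partial>U)"
  proof (rule nn_integral_cong_AE, use AE_U_inner in eventually_elim)
    case (elim w)
    then show ?case
      using cross_term_bound[OF elim, of r t] by (simp add: abs_le_iff ennreal_plus[symmetric] del: ennreal_plus)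
  qed
  also have "\<dots> = 2 * (ennreal (r\<^sup>2) + ennreal (t\<^sup>2))"
    by (simp add: ennreal_mult'[symmetric] ennreal_plus[symmetric] del: ennreal_plus flip: ennreal_numeral)
  finally show ?thesis by (simp only: ennreal_mult_cancel_left) simp
qed

lemma nn_integral_U_fourth:
  "(\<integral>\<^sup>+w. ennreal ((sqrt (r\<^sup>2 + t\<^sup>2 + 2 * r * t * (w \<bullet> 1))) ^ 4) \<partial>U) = ennreal (r ^ 4) + ennreal (2 * K2) * ennreal (r\<^sup>2) * ennreal (t\<^sup>2) + ennreal (t ^ 4)"
proof -
  let ?a = "r\<^sup>2 + t\<^sup>2" and ?b = "2 * r * t"
  have "2 * (\<integral>\<^sup>+w. ennreal ((sqrt (?a + ?b * (w \<bullet> 1))) ^ 4) \<partial>U)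
      = (\<integral>\<^sup>+w. ennreal ((sqrt (?a + ?b * (w \<bullet> 1))) ^ 4) + ennreal ((sqrt (?a + ?b * (- (w \<bullet> 1)))) ^ 4) \<partial>U)"
    by (rule nn_integral_U_symmetrise) measurable
  also have "\<dots> = (\<integral>\<^sup>+w. ennreal (2 * ?a\<^sup>2) + ennreal (2 * ?b\<^sup>2) * ennreal ((w \<bullet> 1)\<^sup>2) \<partial>U)"
  proof (rule nn_integral_cong_AE, use AE_U_inner in eventually_elim)
    case (elim w)
    have s4: "(sqrt x) ^ 4 = x\<^sup>2" if "0 \<le> x" for x :: real
      using that power_mult[of "sqrt x" 2 2] by simp
    have "?b * (w \<bullet> 1) \<le> ?a" "- (?b * (w \<bullet> 1)) \<le> ?a"
      using cross_term_bound[OF elim, of r t] by (simp_all only: abs_le_iff)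
    then have "(sqrt (?a + ?b * (w \<bullet> 1))) ^ 4 + (sqrt (?a + ?b * (- (w \<bullet> 1)))) ^ 4 = 2 * ?a\<^sup>2 + 2 * ?b\<^sup>2 * (w \<bullet> 1)\<^sup>2"
      by (subst (1 2) s4) (auto simp: power2_eq_square algebra_simps)
    then show ?case
      by (simp add: ennreal_plus[symmetric] ennreal_mult'[symmetric] del: ennreal_plus)
  qed
  also have "\<dots> = ennreal (2 * ?a\<^sup>2) + ennreal (2 * ?b\<^sup>2) * ennreal ((K2 - 1) / 2)"
    by (simp add: nn_integral_add nn_integral_cmult second_moment)
  also have "\<dots> = ennreal (2 * (r ^ 4 + 2 * K2 * r\<^sup>2 * t\<^sup>2 + t ^ 4))"
    using K2 by (simp add: ennreal_plus[symmetric] ennreal_mult'[symmetric] del: ennreal_plus)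
      (simp add: power2_eq_square power4_eq_xxxx field_simps)
  also have "\<dots> = 2 * (ennreal (r ^ 4) + ennreal (2 * K2) * ennreal (r\<^sup>2) * ennreal (t\<^sup>2) + ennreal (t ^ 4))"
    using K2 by (simp add: ennreal_mult'[symmetric] ennreal_plus[symmetric] del: ennreal_plus flip: ennreal_numeral)
  finally show ?thesis by (simp only: ennreal_mult_cancel_left) simp
qed

text \<open>
  Given the two lengths, the key identity turns the sum of two uniform vectors into one. For the moments,
  the cross term \<open>2 r t w\<close> has mean 0 and mean square \<open>4 r\<^sup>2 t\<^sup>2 / d\<close>, so with \<open>s\<close>, \<open>s'\<close> the two weights
  the fourth moment is at most \<open>K2 s\<^sup>2 + K2 s'\<^sup>2 + (2 + 4/d) s s' = K2 (s + s')\<^sup>2\<close>.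
\<close>

lemma radius_law_Un:
  assumes I: "radius_law I a \<rho>" and J: "radius_law J a \<rho>'" and fin: "finite I" "finite J" and disj: "I \<inter> J = {}"
  shows "radius_law (I \<union> J) a (join_radii \<rho> \<rho>')"
proof -
  have r1: "prob_space \<rho>" and s1[measurable_cong]: "sets \<rho> = sets borel"
    and r2: "prob_space \<rho>'" and s2[measurable_cong]: "sets \<rho>' = sets borel"
    using I J by (auto simp: radius_law_def)
  interpret r1: prob_space \<rho> by fact
  interpret r2: prob_space \<rho>' by fact
  interpret product_sigma_finite "\<lambda>_. U" ..
  interpret MI: finite_product_sigma_finite "\<lambda>_. U" I by standard fact
  interpret MJ: finite_product_sigma_finite "\<lambda>_. U" J by standard fact
  interpret P_Ir: pair_sigma_finite "\<Pi>\<^sub>M j\<in>I. U" \<rho>' ..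
  interpret P_rr: pair_sigma_finite \<rho> \<rho>' ..
  note J_int = nn_integral_join_radii[OF r1 s1 r2 s2]
  have sets_join: "sets (join_radii \<rho> \<rho>') = sets borel" by (rule sets_join_radii[OF r1 s1 r2 s2])
  have space_join: "space (join_radii \<rho> \<rho>') = UNIV" using sets_eq_imp_space_eq[OF sets_join] by simp
  let ?s = "\<lambda>J. \<Sum>j\<in>J. (norm (a j))\<^sup>2"
  show ?thesis
    unfolding radius_law_def
  proof (intro conjI ballI)
    show prob_join: "prob_space (join_radii \<rho> \<rho>')" and "sets (join_radii \<rho> \<rho>') = sets borel"
      using prob_space_join_radii[OF r1 s1 r2 s2] sets_join_radii[OF r1 s1 r2 s2] by auto
    show "AE R in join_radii \<rho> \<rho>'. 0 \<le> R"
    proof -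
      have "(\<integral>\<^sup>+w. indicator {..<0} (sqrt (r\<^sup>2 + t\<^sup>2 + 2 * r * t * (w \<bullet> 1))) \<partial>U) = (\<integral>\<^sup>+w. 0 \<partial>U)" for r t
      proof (rule nn_integral_cong_AE, use AE_U_inner in eventually_elim)
        case (elim w)
        then show ?case using cross_term_bound[of "w \<bullet> 1" r t] by (auto simp: abs_le_iff split: split_indicator)
      qed
      then have "(\<integral>\<^sup>+R. indicator {..<0} R \<partial>join_radii \<rho> \<rho>') = 0"
        by (subst J_int) simp_all
      then show ?thesis
        by (subst AE_iff_nn_integral) (auto simp: not_le lessThan_def space_join sets_join)
    qed
    have sum: "?s (I \<union> J) = ?s I + ?s J" using fin disj by (rule sum.union_disjoint)
    have m2: "(\<integral>\<^sup>+R. ennreal (R\<^sup>2) \<partial>\<rho>) = ennreal (?s I)" "(\<integral>\<^sup>+R. ennreal (R\<^sup>2) \<partial>\<rho>') = ennreal (?s J)"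
      and m4: "(\<integral>\<^sup>+R. ennreal (R ^ 4) \<partial>\<rho>) \<le> ennreal (K2 * (?s I)\<^sup>2)" "(\<integral>\<^sup>+R. ennreal (R ^ 4) \<partial>\<rho>') \<le> ennreal (K2 * (?s J)\<^sup>2)"
      using I J by (auto simp: radius_law_def)
    have s0: "0 \<le> ?s I" "0 \<le> ?s J" by (auto intro: sum_nonneg)
    show "(\<integral>\<^sup>+R. ennreal (R\<^sup>2) \<partial>join_radii \<rho> \<rho>') = ennreal (?s (I \<union> J))"
      using s0 r1.emeasure_space_1 r2.emeasure_space_1
      by (subst J_int) (simp_all add: nn_integral_U_square nn_integral_add m2 sum)
    have "(\<integral>\<^sup>+R. ennreal (R ^ 4) \<partial>join_radii \<rho> \<rho>')
        = (\<integral>\<^sup>+R. ennreal (R ^ 4) \<partial>\<rho>) + ennreal (2 * K2) * ennreal (?s I) * ennreal (?s J) + (\<integral>\<^sup>+R. ennreal (R ^ 4) \<partial>\<rho>')"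
      using r1.emeasure_space_1 r2.emeasure_space_1
      by (subst J_int) (simp_all add: nn_integral_U_fourth nn_integral_add nn_integral_cmult nn_integral_multc m2)
    also have "\<dots> \<le> ennreal (K2 * (?s I)\<^sup>2) + ennreal (2 * K2) * ennreal (?s I) * ennreal (?s J) + ennreal (K2 * (?s J)\<^sup>2)"
      by (intro add_mono m4 order_refl)
    also have "\<dots> = ennreal (K2 * (?s (I \<union> J))\<^sup>2)"
      unfolding sum using s0 K2
      by (simp add: ennreal_mult'[symmetric] ennreal_plus[symmetric] del: ennreal_plus) (simp add: power2_eq_square algebra_simps)
    finally show "(\<integral>\<^sup>+R. ennreal (R ^ 4) \<partial>join_radii \<rho> \<rho>') \<le> ennreal (K2 * (?s (I \<union> J))\<^sup>2)" .
    fix f :: "'k \<Rightarrow> ennreal" assume f[measurable]: "f \<in> borel_measurable borel"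
    have lawI: "(\<integral>\<^sup>+x. g (\<Sum>j\<in>I. x j * a j) \<partial>(\<Pi>\<^sub>M j\<in>I. U)) = (\<integral>\<^sup>+R. (\<integral>\<^sup>+v. g (R *\<^sub>R v) \<partial>U) \<partial>\<rho>)"
      and lawJ: "(\<integral>\<^sup>+x. g (\<Sum>j\<in>J. x j * a j) \<partial>(\<Pi>\<^sub>M j\<in>J. U)) = (\<integral>\<^sup>+R. (\<integral>\<^sup>+v. g (R *\<^sub>R v) \<partial>U) \<partial>\<rho>')"
      if "g \<in> borel_measurable borel" for g :: "'k \<Rightarrow> ennreal"
      using I J that by (auto simp: radius_law_def)
    have "(\<integral>\<^sup>+x. f (\<Sum>j\<in>I \<union> J. x j * a j) \<partial>(\<Pi>\<^sub>M j\<in>I \<union> J. U))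
        = (\<integral>\<^sup>+x. (\<integral>\<^sup>+y. f (\<Sum>j\<in>I \<union> J. merge I J (x, y) j * a j) \<partial>(\<Pi>\<^sub>M j\<in>J. U)) \<partial>(\<Pi>\<^sub>M j\<in>I. U))"
      by (rule product_nn_integral_fold[OF disj fin]) measurable
    also have "\<dots> = (\<integral>\<^sup>+x. (\<integral>\<^sup>+y. f ((\<Sum>j\<in>I. x j * a j) + (\<Sum>j\<in>J. y j * a j)) \<partial>(\<Pi>\<^sub>M j\<in>J. U)) \<partial>(\<Pi>\<^sub>M j\<in>I. U))"
    proof -
      have "(\<Sum>j\<in>I \<union> J. merge I J (x, y) j * a j) = (\<Sum>j\<in>I. x j * a j) + (\<Sum>j\<in>J. y j * a j)" for x y
        using fin disj by (subst sum.union_disjoint) (auto simp: merge_def intro!: arg_cong2[where f = "(+)"] sum.cong)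
      then show ?thesis by simp
    qed
    also have "\<dots> = (\<integral>\<^sup>+x. (\<integral>\<^sup>+t. (\<integral>\<^sup>+v'. f ((\<Sum>j\<in>I. x j * a j) + t *\<^sub>R v') \<partial>U) \<partial>\<rho>') \<partial>(\<Pi>\<^sub>M j\<in>I. U))"
      by (intro nn_integral_cong lawJ) measurable
    also have "\<dots> = (\<integral>\<^sup>+t. (\<integral>\<^sup>+x. (\<integral>\<^sup>+v'. f ((\<Sum>j\<in>I. x j * a j) + t *\<^sub>R v') \<partial>U) \<partial>(\<Pi>\<^sub>M j\<in>I. U)) \<partial>\<rho>')"
      by (rule P_Ir.Fubini'[symmetric]) measurable
    also have "\<dots> = (\<integral>\<^sup>+t. (\<integral>\<^sup>+r. (\<integral>\<^sup>+v. (\<integral>\<^sup>+v'. f (r *\<^sub>R v + t *\<^sub>R v') \<partial>U) \<partial>U) \<partial>\<rho>) \<partial>\<rho>')"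
      by (intro nn_integral_cong lawI) measurable
    also have "\<dots> = (\<integral>\<^sup>+r. (\<integral>\<^sup>+t. (\<integral>\<^sup>+v. (\<integral>\<^sup>+v'. f (r *\<^sub>R v + t *\<^sub>R v') \<partial>U) \<partial>U) \<partial>\<rho>') \<partial>\<rho>)"
      by (rule P_rr.Fubini') measurable
    also have "\<dots> = (\<integral>\<^sup>+r. (\<integral>\<^sup>+t. (\<integral>\<^sup>+w. (\<integral>\<^sup>+v. f (sqrt (r\<^sup>2 + t\<^sup>2 + 2 * r * t * (w \<bullet> 1)) *\<^sub>R v) \<partial>U) \<partial>U) \<partial>\<rho>') \<partial>\<rho>)"
    proof (rule nn_integral_cong_AE)
      have "AE r in \<rho>. 0 \<le> r" using I by (auto simp: radius_law_def)
      then show "AE r in \<rho>. (\<integral>\<^sup>+t. (\<integral>\<^sup>+v. (\<integral>\<^sup>+v'. f (r *\<^sub>R v + t *\<^sub>R v') \<partial>U) \<partial>U) \<partial>\<rho>')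
         = (\<integral>\<^sup>+t. (\<integral>\<^sup>+w. (\<integral>\<^sup>+v. f (sqrt (r\<^sup>2 + t\<^sup>2 + 2 * r * t * (w \<bullet> 1)) *\<^sub>R v) \<partial>U) \<partial>U) \<partial>\<rho>')"
      proof eventually_elim
        case (elim r)
        note r = this
        show ?case
        proof (rule nn_integral_cong_AE)
          have "AE t in \<rho>'. 0 \<le> t" using J by (auto simp: radius_law_def)
          then show "AE t in \<rho>'. (\<integral>\<^sup>+v. (\<integral>\<^sup>+v'. f (r *\<^sub>R v + t *\<^sub>R v') \<partial>U) \<partial>U)
             = (\<integral>\<^sup>+w. (\<integral>\<^sup>+v. f (sqrt (r\<^sup>2 + t\<^sup>2 + 2 * r * t * (w \<bullet> 1)) *\<^sub>R v) \<partial>U) \<partial>U)"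
            by eventually_elim (rule sum_law[OF f r])
        qed
      qed
    qed
    also have "\<dots> = (\<integral>\<^sup>+R. (\<integral>\<^sup>+v. f (R *\<^sub>R v) \<partial>U) \<partial>join_radii \<rho> \<rho>')"
      by (rule J_int[symmetric]) measurable
    finally show "(\<integral>\<^sup>+x. f (\<Sum>j\<in>I \<union> J. x j * a j) \<partial>(\<Pi>\<^sub>M j\<in>I \<union> J. U)) = (\<integral>\<^sup>+R. (\<integral>\<^sup>+v. f (R *\<^sub>R v) \<partial>U) \<partial>join_radii \<rho> \<rho>')" .
  qed
qed

lemma radius_law_singleton: "radius_law {i} a (return borel (norm (a i)))"
proof -
  interpret product_sigma_finite "\<lambda>_. U" ..
  have "(\<integral>\<^sup>+x. f (x i * a i) \<partial>(\<Pi>\<^sub>M j\<in>{i}. U)) = (\<integral>\<^sup>+v. f (norm (a i) *\<^sub>R v) \<partial>U)"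
    if [measurable]: "f \<in> borel_measurable borel" for f :: "'k \<Rightarrow> ennreal"
    using nn_integral_ball_law_mult[OF that, of "a i"] product_nn_integral_singleton[of "\<lambda>x. f (x * a i)" i]
    by (simp add: U_eq)
  moreover have "(norm (a i)) ^ 4 \<le> K2 * ((norm (a i))\<^sup>2)\<^sup>2"
    using K2 mult_right_mono[of 1 K2 "(norm (a i)) ^ 4"] by (simp flip: power_mult)
  ultimately show ?thesis
    by (auto simp: radius_law_def prob_space_return nn_integral_return AE_return intro!: ennreal_leI)
qed

lemma radius_law_empty: "radius_law {} a (return borel 0)"
  by (auto simp: radius_law_def prob_space_return nn_integral_return AE_return PiM_empty nn_integral_count_space_finite)

lemma radius_law_exists:
  assumes "finite J"
  obtains \<rho> where "radius_law J a \<rho>"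
proof -
  have "\<exists>\<rho>. radius_law J a \<rho>" using assms
  proof (induction rule: finite_induct)
    case empty then show ?case using radius_law_empty by blast
  next
    case (insert i J)
    then obtain \<rho> where "radius_law J a \<rho>" by blast
    from radius_law_Un[OF radius_law_singleton this] insert.hyps show ?case by auto
  qed
  then show ?thesis using that by blast
qed

end

section \<open>The sum is long with substantial probability\<close>

context uniform_ball
begin

lemma tail_emeasure:
  assumes "\<And>v. w \<le> v \<bullet> 1 \<Longrightarrow> \<bar>v \<bullet> 1\<bar> \<le> 1 \<Longrightarrow> v \<in> A" and "c \<le> measure U {v. w \<le> v \<bullet> 1}" and [measurable]: "A \<in> sets borel"
  shows "ennreal c \<le> (\<integral>\<^sup>+v. indicator A v \<partial>U)"
proof -
  have "ennreal c \<le> emeasure U {v. w \<le> v \<bullet> 1}"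
    using assms(2) by (simp add: U.emeasure_eq_measure ennreal_leI)
  also have "\<dots> \<le> emeasure U A"
  proof (rule emeasure_mono_AE)
    show "AE v in U. v \<in> {v. w \<le> v \<bullet> 1} \<longrightarrow> v \<in> A"
      using AE_U_inner by eventually_elim (use assms(1) in auto)
  qed simp
  finally show ?thesis by simp
qed

text \<open>
  After multiplication by \<open>2 y\<close> this says that a quintic is nonnegative. The quintic has a small positive
  minimum near \<open>7/4\<close>; dividing by \<open>(y - 7/4)\<^sup>2\<close> leaves a cubic that is at least \<open>13/20\<close> for \<open>y \<ge> 1\<close>,
  and a linear remainder that \<open>13/20 (y - 7/4)\<^sup>2\<close> absorbs.
\<close>

lemma quintic_bound:
  fixes y :: real
  assumes "1 \<le> y"
  shows "3/40 * (y\<^sup>2 - 1/3) * (13/2 - y\<^sup>2) \<le> 1/2 - (1 / y - 1) / 2"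
proof -
  let ?c = "3/20 * y ^ 3 + 21/40 * y\<^sup>2 + 113/320 * y - 119/320 - 13/20"
  have y: "y ^ 3 \<ge> 1" "y\<^sup>2 \<ge> 1" using assms by (auto intro: one_le_power)
  then have "0 \<le> ?c" using assms by linarith
  then have "0 \<le> (y - 7/4)\<^sup>2 * ?c" by (intro mult_nonneg_nonneg) auto
  moreover have "0 \<le> 13/20 * (y - 9/5)\<^sup>2" by simp
  moreover have "13/20 * (y - 9/5)\<^sup>2 = 13/20 * y\<^sup>2 - 117/50 * y + 1053/500"
    by (simp add: power2_eq_square algebra_simps)
  moreover have "(y - 7/4)\<^sup>2 * ?c = 3/20 * y ^ 5 - 41/40 * y ^ 3 + 93/40 * y - 1 - (13/20 * (y - 7/4)\<^sup>2 + 711/5120 - 297/5120 * y)"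
    by (simp add: eval_nat_numeral field_simps)
  moreover have "13/20 * (y - 7/4)\<^sup>2 = 13/20 * y\<^sup>2 - 91/40 * y + 637/320"
    by (simp add: power2_eq_square algebra_simps)
  ultimately have "0 \<le> 3/20 * y ^ 5 - 41/40 * y ^ 3 + 93/40 * y - 1"
    using assms by linarith
  also have "\<dots> = 2 * y * (1/2 - (1 / y - 1) / 2 - 3/40 * (y\<^sup>2 - 1/3) * (13/2 - y\<^sup>2))"
    using assms by (simp add: power2_eq_square eval_nat_numeral field_simps)
  finally show ?thesis using assms by (simp add: zero_le_mult_iff)
qed

text \<open>
  The cube of \<open>y\<close> lies below its chord over the interval from \<open>4/7\<close> to \<open>1\<close>.
\<close>

lemma cubic_bound:
  fixes y :: real
  assumes "4/7 \<le> y" "y \<le> 1" "1/3 \<le> y\<^sup>2"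
  shows "3/40 * (y\<^sup>2 - 1/3) * (13/2 - y\<^sup>2) \<le> 1/2 - 2/3 * (1 / y - 1)"
proof -
  \<comment> \<open>the third root \<open>- 11/7\<close> makes the sum of the roots 0, so that there is no quadratic term\<close>
  have "0 \<le> (1 - y) * (y - 4/7) * (y + 11/7)" using assms by (intro mult_nonneg_nonneg) auto
  moreover have "(1 - y) * (y - 4/7) * (y + 11/7) = 93/49 * y - 44/49 - y ^ 3"
    by (simp add: power3_eq_cube field_simps)
  ultimately have y3: "y ^ 3 \<le> 93/49 * y - 44/49" by linarith
  have "(y\<^sup>2 - 1/3) * (13/2 - y\<^sup>2) \<le> (y\<^sup>2 - 1/3) * (37/6)"
    using assms by (intro mult_left_mono) auto
  then have "y * ((y\<^sup>2 - 1/3) * (13/2 - y\<^sup>2)) \<le> y * ((y\<^sup>2 - 1/3) * (37/6))"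
    using assms by (intro mult_left_mono) auto
  also have "\<dots> = 37/6 * (y ^ 3 - y / 3)"
    by (simp add: power2_eq_square power3_eq_cube algebra_simps)
  finally have "y * ((y\<^sup>2 - 1/3) * (13/2 - y\<^sup>2)) \<le> 37/6 * (93/49 * y - 44/49 - y / 3)"
    using y3 by (elim order_trans) simp
  moreover have "y * (3/40 * (y\<^sup>2 - 1/3) * (13/2 - y\<^sup>2)) = 3/40 * (y * ((y\<^sup>2 - 1/3) * (13/2 - y\<^sup>2)))"
    by simp
  ultimately have "y * (3/40 * (y\<^sup>2 - 1/3) * (13/2 - y\<^sup>2)) \<le> 3/40 * (37/6 * (93/49 * y - 44/49 - y / 3))"
    by linarith
  also have "\<dots> \<le> 7/6 * y - 2/3" using assms by simp
  also have "\<dots> = y * (1/2 - 2/3 * (1 / y - 1))" using assms by (simp add: field_simps)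
  finally show ?thesis using assms by simp
qed

lemma ennreal_add_le: "0 \<le> b \<Longrightarrow> ennreal (a + b) \<le> ennreal a + ennreal b"
  by (cases "0 \<le> a") (auto simp: ennreal_neg intro: ennreal_leI)

text \<open>
  With \<open>G = 4 r\<^sup>2 t\<^sup>2\<close> one has \<open>r\<^sup>2 + t\<^sup>2 + 2 r t w \<ge> \<surd>G (1 + w)\<close>, so the probability in \<open>w\<close> that
  the joint radius is at least 1 is bounded below by a function of \<open>G\<close>, and this function lies above the
  concave quadratic polynomial \<open>3/40 (G - 1/3) (13/2 - G)\<close>. The negative terms of the polynomial stand on
  the right, since all integrals are of nonnegative functions.
\<close>

lemma joint_radius_pointwise:
  assumes "0 \<le> r" "0 \<le> t"
  shows "ennreal (3/40 * (41/6) * (4 * r\<^sup>2 * t\<^sup>2))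
    \<le> (\<integral>\<^sup>+w. indicator {1..} (sqrt (r\<^sup>2 + t\<^sup>2 + 2 * r * t * (w \<bullet> 1))) \<partial>U) + ennreal (3/40 * (13/6 + 16 * r ^ 4 * t ^ 4))"
proof -
  define y where "y = 2 * r * t"
  let ?I = "\<integral>\<^sup>+w. indicator {1..} (sqrt (r\<^sup>2 + t\<^sup>2 + 2 * r * t * (w \<bullet> 1))) \<partial>U"
  have y0: "0 \<le> y" and yy: "y\<^sup>2 = 4 * r\<^sup>2 * t\<^sup>2" and y4: "y ^ 4 = 16 * r ^ 4 * t ^ 4"
    using assms by (simp_all add: y_def power_mult_distrib)
  have q: "3/40 * (y\<^sup>2 - 1/3) * (13/2 - y\<^sup>2) + 3/40 * (13/6 + y ^ 4) = 3/40 * (41/6) * y\<^sup>2"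
    by (simp add: power2_eq_square power4_eq_xxxx field_simps)
  have tail: "ennreal c \<le> ?I" if y: "0 < y" and c: "c \<le> measure U {v. 1 / y - 1 \<le> v \<bullet> 1}" for c
  proof -
    have "y \<le> r\<^sup>2 + t\<^sup>2" using sum_squares_bound[of r t] by (simp add: y_def)
    then have "1 \<le> r\<^sup>2 + t\<^sup>2 + 2 * r * t * x" if "1 / y - 1 \<le> x" for x
    proof -
      have "1 / y \<le> 1 + x" using that by simp
      then have "1 \<le> y + y * x" using y by (simp add: pos_divide_le_eq algebra_simps)
      then show ?thesis using \<open>y \<le> r\<^sup>2 + t\<^sup>2\<close> unfolding y_def[symmetric] by linarith
    qed
    then have "ennreal c \<le> (\<integral>\<^sup>+w. indicator {w. 1 \<le> sqrt (r\<^sup>2 + t\<^sup>2 + 2 * r * t * (w \<bullet> 1))} w \<partial>U)"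
      by (intro tail_emeasure[OF _ c]) auto
    then show ?thesis by (simp add: indicator_def)
  qed
  have "ennreal (3/40 * (y\<^sup>2 - 1/3) * (13/2 - y\<^sup>2)) \<le> ?I"
  proof (cases "1/3 \<le> y\<^sup>2 \<and> y\<^sup>2 \<le> 13/2")
    case False
    then have "3/40 * (y\<^sup>2 - 1/3) * (13/2 - y\<^sup>2) \<le> 0" by (auto simp: mult_le_0_iff)
    then show ?thesis by (simp add: ennreal_neg)
  next
    case True
    then have y47: "4/7 \<le> y" using y0 by (intro power2_le_imp_le[of "4/7" y]) (auto simp: power2_eq_square)
    show ?thesis
    proof (cases "1 \<le> y")
      case y1: True
      then have "-1 \<le> 1 / y - 1" "1 / y - 1 \<le> 0" by auto
      from order_trans[OF quintic_bound[OF y1] tail_nonpos[OF this]] show ?thesis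
        using y1 by (intro tail) auto
    next
      case y1: False
      then have "0 \<le> 1 / y - 1" using y47 by auto
      from order_trans[OF cubic_bound[OF y47 _ True[THEN conjunct1]] tail_nonneg[OF this]] show ?thesis
        using y1 y47 by (intro tail) auto
    qed
  qed
  then have "ennreal (3/40 * (y\<^sup>2 - 1/3) * (13/2 - y\<^sup>2)) + ennreal (3/40 * (13/6 + y ^ 4)) \<le> ?I + ennreal (3/40 * (13/6 + y ^ 4))"
    by (intro add_right_mono)
  moreover have "ennreal (3/40 * (41/6) * y\<^sup>2) \<le> ennreal (3/40 * (y\<^sup>2 - 1/3) * (13/2 - y\<^sup>2)) + ennreal (3/40 * (13/6 + y ^ 4))"
    unfolding q[symmetric] by (rule ennreal_add_le) simp
  ultimately show ?thesis unfolding yy y4 by (rule order_trans[rotated])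
qed

lemma ennreal_le_diffI:
  assumes "ennreal a \<le> x + ennreal b" "0 \<le> b"
  shows "ennreal (a - b) \<le> x"
proof (cases "a \<le> b")
  case False
  have "ennreal (a - b) + ennreal b = ennreal a" using False assms by (simp flip: ennreal_plus)
  then have "ennreal b + ennreal (a - b) \<le> ennreal b + x" using assms by (simp add: add.commute)
  then show ?thesis by (simp add: ennreal_add_left_cancel_le)
qed (simp add: ennreal_neg)

text \<open>
  Integration of the pointwise bound. With \<open>e = 4 s (1 - s)\<close> it gives
  \<open>3/40 (41/6 e - 13/6 - K2\<^sup>2 e\<^sup>2)\<close>, a concave function of \<open>e\<close>, which on \<open>8/9 \<le> e \<le> 1\<close> is smallest
  at \<open>e = 8/9\<close>; the constants are the rounded coefficients of its value there.
\<close>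

lemma joint_radius_balanced:
  assumes I: "radius_law I a \<rho>" and J: "radius_law J a \<rho>'"
    and s: "s = (\<Sum>j\<in>I. (norm (a j))\<^sup>2)" "1 - s = (\<Sum>j\<in>J. (norm (a j))\<^sup>2)" "1/3 \<le> s" "s \<le> 2/3"
  shows "ennreal (293/1000 - 593/10000 * K2\<^sup>2) \<le> emeasure (join_radii \<rho> \<rho>') {1..}"
proof -
  have r1: "prob_space \<rho>" and s1[measurable_cong]: "sets \<rho> = sets borel" and AE1: "AE R in \<rho>. 0 \<le> R"
    and r2: "prob_space \<rho>'" and s2[measurable_cong]: "sets \<rho>' = sets borel" and AE2: "AE R in \<rho>'. 0 \<le> R"
    and m2: "(\<integral>\<^sup>+R. ennreal (R\<^sup>2) \<partial>\<rho>) = ennreal s" "(\<integral>\<^sup>+R. ennreal (R\<^sup>2) \<partial>\<rho>') = ennreal (1 - s)"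
    and m4: "(\<integral>\<^sup>+R. ennreal (R ^ 4) \<partial>\<rho>) \<le> ennreal (K2 * s\<^sup>2)" "(\<integral>\<^sup>+R. ennreal (R ^ 4) \<partial>\<rho>') \<le> ennreal (K2 * (1 - s)\<^sup>2)"
    using I J unfolding radius_law_def s(1,2)[symmetric] by auto
  interpret r1: prob_space \<rho> by fact
  interpret r2: prob_space \<rho>' by fact
  let ?P = "emeasure (join_radii \<rho> \<rho>') {1..}"
  let ?i = "\<lambda>r t. \<integral>\<^sup>+w. indicator {1..} (sqrt (r\<^sup>2 + t\<^sup>2 + 2 * r * t * (w \<bullet> 1))) \<partial>U"
  have "(\<integral>\<^sup>+R. indicator {1..} R \<partial>join_radii \<rho> \<rho>') = (\<integral>\<^sup>+r. (\<integral>\<^sup>+t. ?i r t \<partial>\<rho>') \<partial>\<rho>)"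
    by (rule nn_integral_join_radii[OF r1 s1 r2 s2]) measurable
  then have P: "?P = (\<integral>\<^sup>+r. (\<integral>\<^sup>+t. ?i r t \<partial>\<rho>') \<partial>\<rho>)"
    by (subst (asm) nn_integral_indicator) (simp_all add: sets_join_radii[OF r1 s1 r2 s2])
  have "ennreal (3/40 * (41/6) * (4 * s * (1 - s))) = (\<integral>\<^sup>+r. (\<integral>\<^sup>+t. ennreal (3/40 * (41/6) * 4) * ennreal (r\<^sup>2) * ennreal (t\<^sup>2) \<partial>\<rho>') \<partial>\<rho>)"
  proof -
    have "(\<integral>\<^sup>+r. (\<integral>\<^sup>+t. ennreal (3/40 * (41/6) * 4) * ennreal (r\<^sup>2) * ennreal (t\<^sup>2) \<partial>\<rho>') \<partial>\<rho>)
        = ennreal (3/40 * (41/6) * 4) * ennreal s * ennreal (1 - s)"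
      by (simp add: nn_integral_cmult nn_integral_multc m2)
    also have "\<dots> = ennreal (3/40 * (41/6) * (4 * s * (1 - s)))"
      using s(3,4) by (simp add: ennreal_mult'[symmetric] field_simps)
    finally show ?thesis by simp
  qed
  also have "\<dots> \<le> (\<integral>\<^sup>+r. (\<integral>\<^sup>+t. ?i r t + (ennreal (3/40 * (13/6)) + ennreal (3/40 * 16) * ennreal (r ^ 4) * ennreal (t ^ 4)) \<partial>\<rho>') \<partial>\<rho>)"
  proof (rule nn_integral_mono_AE, use AE1 in eventually_elim, rule nn_integral_mono_AE, use AE2 in eventually_elim)
    fix r t :: real assume "0 \<le> r" "0 \<le> t"
    from joint_radius_pointwise[OF this]
    show "ennreal (3/40 * (41/6) * 4) * ennreal (r\<^sup>2) * ennreal (t\<^sup>2)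
      \<le> ?i r t + (ennreal (3/40 * (13/6)) + ennreal (3/40 * 16) * ennreal (r ^ 4) * ennreal (t ^ 4))"
      by (simp add: ennreal_mult'[symmetric] ennreal_plus[symmetric] distrib_left mult.assoc del: ennreal_plus)
  qed
  also have "\<dots> = ?P + (ennreal (3/40 * (13/6)) + ennreal (3/40 * 16) * (\<integral>\<^sup>+R. ennreal (R ^ 4) \<partial>\<rho>) * (\<integral>\<^sup>+R. ennreal (R ^ 4) \<partial>\<rho>'))"
    using r1.emeasure_space_1 r2.emeasure_space_1
    by (simp add: P nn_integral_add nn_integral_cmult nn_integral_multc)
  also have "\<dots> \<le> ?P + (ennreal (3/40 * (13/6)) + ennreal (3/40 * 16) * ennreal (K2 * s\<^sup>2) * ennreal (K2 * (1 - s)\<^sup>2))"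
    by (intro add_left_mono mult_mono m4) auto
  also have "\<dots> = ?P + ennreal (3/40 * (13/6 + K2\<^sup>2 * (4 * s * (1 - s))\<^sup>2))"
    using s K2 by (simp add: ennreal_mult'[symmetric] ennreal_plus[symmetric] del: ennreal_plus)
      (simp add: power2_eq_square algebra_simps)
  finally have main: "ennreal (3/40 * (41/6) * (4 * s * (1 - s)) - 3/40 * (13/6 + K2\<^sup>2 * (4 * s * (1 - s))\<^sup>2)) \<le> ?P"
    by (intro ennreal_le_diffI) auto
  define e where "e = 4 * s * (1 - s)"
  have "0 \<le> (s - 1/3) * (2/3 - s)" using s by (intro mult_nonneg_nonneg) auto
  then have e1: "8/9 \<le> e" by (simp add: e_def field_simps)
  have e2: "e \<le> 1" using zero_le_power2[of "2 * s - 1"] by (simp add: e_def power2_eq_square algebra_simps)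
  have "(e - 8/9) * (K2\<^sup>2 * (e + 8/9)) \<le> (e - 8/9) * (41/6)"
  proof (intro mult_left_mono)
    have "K2\<^sup>2 \<le> (5/3)\<^sup>2" using K2 by (intro power_mono) auto
    then have "K2\<^sup>2 * (e + 8/9) \<le> (5/3)\<^sup>2 * (17/9)" using e1 e2 by (intro mult_mono) auto
    then show "K2\<^sup>2 * (e + 8/9) \<le> 41/6" by (simp add: power2_eq_square)
  qed (use e1 in auto)
  moreover have "(e - 8/9) * (K2\<^sup>2 * (e + 8/9)) = K2\<^sup>2 * e\<^sup>2 - 64/81 * K2\<^sup>2"
    by (simp add: power2_eq_square field_simps)
  ultimately have "K2\<^sup>2 * e\<^sup>2 \<le> 41/6 * e - 41/6 * (8/9) + 64/81 * K2\<^sup>2"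
    by (simp add: left_diff_distrib)
  then have "293/1000 - 593/10000 * K2\<^sup>2 \<le> 3/40 * (41/6) * e - 3/40 * (13/6 + K2\<^sup>2 * e\<^sup>2)"
    using zero_le_power2[of K2] unfolding distrib_left by linarith
  then show ?thesis
    using main unfolding e_def[symmetric] by (meson ennreal_leI order_trans)
qed


text \<open>
  Here \<open>x = r\<^sup>2 / s\<close>. The radius is at least 1 if \<open>x + 2 b r w / s \<ge> 1\<close>, and \<open>b\<^sup>2 \<ge> 2 s\<close>. So \<open>w \<ge> 0\<close>
  suffices for \<open>x \<ge> 1\<close>, and \<open>w \<ge> 17/50\<close> suffices for \<open>x \<ge> 2/5\<close>. The resulting step function lies
  above \<open>7/50 (x - 2/5) (4 - x)\<close>.
\<close>

lemma dominant_radius_pointwise: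
  assumes "0 \<le> r" "0 \<le> b" "2/3 \<le> b\<^sup>2" "s = 1 - b\<^sup>2" "0 < s"
  shows "ennreal (7/50 * (22/5) / s * r\<^sup>2) \<le> (\<integral>\<^sup>+w. indicator {1..} (sqrt (r\<^sup>2 + b\<^sup>2 + 2 * r * b * (w \<bullet> 1))) \<partial>U) + ennreal (7/50 * (8/5 + r ^ 4 / s\<^sup>2))"
proof -
  define x where "x = r\<^sup>2 / s"
  let ?I = "\<integral>\<^sup>+w. indicator {1..} (sqrt (r\<^sup>2 + b\<^sup>2 + 2 * r * b * (w \<bullet> 1))) \<partial>U"
  have x0: "0 \<le> x" and rx: "r\<^sup>2 = x * s" and x2: "r ^ 4 / s\<^sup>2 = x\<^sup>2"
    using assms by (auto simp: x_def power_divide simp flip: power_mult)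
  have tail: "ennreal c \<le> ?I" if w: "0 \<le> w" "s \<le> r\<^sup>2 + 2 * r * b * w" and c: "c \<le> 1/2 - 2/3 * w" for c w
  proof -
    have "1 \<le> r\<^sup>2 + b\<^sup>2 + 2 * r * b * u" if "w \<le> u" for u
      using mult_left_mono[OF that, of "2 * r * b"] w assms by simp
    then have "ennreal c \<le> (\<integral>\<^sup>+w. indicator {w. 1 \<le> sqrt (r\<^sup>2 + b\<^sup>2 + 2 * r * b * (w \<bullet> 1))} w \<partial>U)"
      by (intro tail_emeasure[OF _ order_trans[OF c tail_nonneg[OF w(1)]]]) auto
    then show ?thesis by (simp add: indicator_def)
  qed
  have q: "7/50 * (x - 2/5) * (4 - x) + 7/50 * (8/5 + x\<^sup>2) = 7/50 * (22/5) * x"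
    by (simp add: power2_eq_square field_simps)
  have "ennreal (7/50 * (x - 2/5) * (4 - x)) \<le> ?I"
  proof (cases "2/5 \<le> x \<and> x \<le> 4")
    case False
    then have "7/50 * (x - 2/5) * (4 - x) \<le> 0" by (auto simp: mult_le_0_iff)
    then show ?thesis by (simp add: ennreal_neg)
  next
    case x: True
    show ?thesis
    proof (cases "1 \<le> x")
      case True
      have "0 \<le> (x - 11/5)\<^sup>2" by simp
      then have "7/50 * (x - 2/5) * (4 - x) \<le> 1/2 - 2/3 * 0" by (simp add: power2_eq_square field_simps)
      moreover have "s \<le> r\<^sup>2 + 2 * r * b * 0" using True assms by (simp add: rx)
      ultimately show ?thesis by (intro tail[of 0]) auto
    next
      case False
      have "(89/100 * s)\<^sup>2 \<le> (r * b)\<^sup>2"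
      proof -
        have "(89/100 * s)\<^sup>2 \<le> 2/5 * s * (2 * s)" by (simp add: power2_eq_square)
        also have "\<dots> \<le> r\<^sup>2 * b\<^sup>2"
          using x assms(5) mult_right_mono[of "2/5" x s] assms(3,4) by (intro mult_mono) (auto simp: rx)
        finally show ?thesis by (simp add: power_mult_distrib)
      qed
      then have "89/100 * s \<le> r * b" by (rule power2_le_imp_le) (use assms in auto)
      moreover have "2/5 * s \<le> x * s" using x assms by (intro mult_right_mono) auto
      ultimately have "s \<le> x * s + 2 * (r * b) * (17/50)" using assms(5) by linarith
      then have "s \<le> r\<^sup>2 + 2 * r * b * (17/50)" by (simp add: rx)
      moreover have "7/50 * (x - 2/5) * (4 - x) \<le> 1/2 - 2/3 * (17/50)"
      proof -
        have "(x - 2/5) * (4 - x) \<le> 9/5" 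
        proof -
          have "0 \<le> (1 - x) * (17/5 - x)" using False by (intro mult_nonneg_nonneg) auto
          then show ?thesis by (simp add: field_simps)
        qed
        then have "7/50 * ((x - 2/5) * (4 - x)) \<le> 7/50 * (9/5)" by (intro mult_left_mono) auto
        also have "\<dots> \<le> 1/2 - 2/3 * (17/50)" by simp
        finally show ?thesis by (simp only: mult.assoc)
      qed
      ultimately show ?thesis by (intro tail[of "17/50"]) auto
    qed
  qed
  then have "ennreal (7/50 * (x - 2/5) * (4 - x)) + ennreal (7/50 * (8/5 + x\<^sup>2)) \<le> ?I + ennreal (7/50 * (8/5 + x\<^sup>2))"
    by (intro add_right_mono)
  moreover have "ennreal (7/50 * (22/5) * x) \<le> ennreal (7/50 * (x - 2/5) * (4 - x)) + ennreal (7/50 * (8/5 + x\<^sup>2))"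
    unfolding q[symmetric] by (rule ennreal_add_le) simp
  ultimately have "ennreal (7/50 * (22/5) * x) \<le> ?I + ennreal (7/50 * (8/5 + x\<^sup>2))"
    by (rule order_trans[rotated])
  then show ?thesis unfolding x2 by (simp add: x_def)
qed

text \<open>
  If \<open>b = 1\<close> the remaining weight \<open>s\<close> is 0 and \<open>x\<close> is undefined, but then \<open>w \<ge> 0\<close> always suffices.
\<close>

lemma joint_radius_dominant:
  assumes I: "radius_law I a \<rho>"
    and s: "1 - b\<^sup>2 = (\<Sum>j\<in>I. (norm (a j))\<^sup>2)" and b: "0 \<le> b" "2/3 \<le> b\<^sup>2" "b\<^sup>2 \<le> 1"
  shows "ennreal (293/1000 - 593/10000 * K2\<^sup>2) \<le> emeasure (join_radii \<rho> (return borel b)) {1..}"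
proof -
  have r1: "prob_space \<rho>" and s1[measurable_cong]: "sets \<rho> = sets borel" and AE1: "AE R in \<rho>. 0 \<le> R"
    and m2: "(\<integral>\<^sup>+R. ennreal (R\<^sup>2) \<partial>\<rho>) = ennreal (1 - b\<^sup>2)"
    and m4: "(\<integral>\<^sup>+R. ennreal (R ^ 4) \<partial>\<rho>) \<le> ennreal (K2 * (1 - b\<^sup>2)\<^sup>2)"
    using I unfolding radius_law_def s[symmetric] by auto
  interpret r1: prob_space \<rho> by fact
  have r2: "prob_space (return borel b)" by (rule prob_space_return) simp
  let ?P = "emeasure (join_radii \<rho> (return borel b)) {1..}"
  let ?i = "\<lambda>r. \<integral>\<^sup>+w. indicator {1..} (sqrt (r\<^sup>2 + b\<^sup>2 + 2 * r * b * (w \<bullet> 1))) \<partial>U"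
  have "(\<integral>\<^sup>+R. indicator {1..} R \<partial>join_radii \<rho> (return borel b)) = (\<integral>\<^sup>+r. (\<integral>\<^sup>+t. (\<integral>\<^sup>+w. indicator {1..} (sqrt (r\<^sup>2 + t\<^sup>2 + 2 * r * t * (w \<bullet> 1))) \<partial>U) \<partial>return borel b) \<partial>\<rho>)"
    by (rule nn_integral_join_radii[OF r1 s1 r2 sets_return]) measurable
  also have "\<dots> = (\<integral>\<^sup>+r. ?i r \<partial>\<rho>)"
    by (intro nn_integral_cong nn_integral_return) measurable
  finally have P: "?P = (\<integral>\<^sup>+r. ?i r \<partial>\<rho>)"
    by (subst (asm) nn_integral_indicator) (simp_all add: sets_join_radii[OF r1 s1 r2 sets_return])
  have K: "293/1000 - 593/10000 * K2\<^sup>2 \<le> 7/50 * (14/5 - K2)"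
    using zero_le_power2[of "K2 - 59/50"] K2 by (simp add: power2_eq_square algebra_simps)
  show ?thesis
  proof (cases "b\<^sup>2 = 1")
    case True
    have "ennreal (1/2) \<le> ?i r" if "0 \<le> r" for r
    proof -
      have "1 \<le> r\<^sup>2 + b\<^sup>2 + 2 * r * b * u" if "0 \<le> u" for u
        using that \<open>0 \<le> r\<close> b True by simp
      then have "ennreal (1/2) \<le> (\<integral>\<^sup>+w. indicator {w. 1 \<le> sqrt (r\<^sup>2 + b\<^sup>2 + 2 * r * b * (w \<bullet> 1))} w \<partial>U)"
        using tail_nonneg[of 0] by (intro tail_emeasure[of 0]) auto
      then show ?thesis by (simp add: indicator_def)
    qed
    then have "AE r in \<rho>. ennreal (1/2) \<le> ?i r" using AE1 by auto
    then have "(\<integral>\<^sup>+r. ennreal (1/2) \<partial>\<rho>) \<le> ?P" unfolding P by (rule nn_integral_mono_AE)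
    then have "ennreal (1/2) \<le> ?P" using r1.emeasure_space_1 by simp
    moreover have "293/1000 - 593/10000 * K2\<^sup>2 \<le> 1/2" using zero_le_power2[of K2] by linarith
    ultimately show ?thesis by (meson ennreal_leI order_trans)
  next
    case False
    define s where "s = 1 - b\<^sup>2"
    have s0: "0 < s" using False b by (simp add: s_def)
    have "ennreal (7/50 * (22/5)) = (\<integral>\<^sup>+r. ennreal (7/50 * (22/5) / s) * ennreal (r\<^sup>2) \<partial>\<rho>)"
    proof -
      have "(\<integral>\<^sup>+r. ennreal (7/50 * (22/5) / s) * ennreal (r\<^sup>2) \<partial>\<rho>) = ennreal (7/50 * (22/5) / s) * ennreal s"
        by (simp add: nn_integral_cmult m2 s_def[symmetric])
      then show ?thesis using s0 by (simp add: ennreal_mult'[symmetric])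
    qed
    also have "\<dots> \<le> (\<integral>\<^sup>+r. ?i r + (ennreal (7/50 * (8/5)) + ennreal (7/50 / s\<^sup>2) * ennreal (r ^ 4)) \<partial>\<rho>)"
    proof (rule nn_integral_mono_AE, use AE1 in eventually_elim)
      case (elim r)
      from dominant_radius_pointwise[OF elim b(1,2) s_def s0] show ?case
        using s0 by (simp add: ennreal_mult'[symmetric] ennreal_plus[symmetric] distrib_left del: ennreal_plus)
    qed
    also have "\<dots> = ?P + (ennreal (7/50 * (8/5)) + ennreal (7/50 / s\<^sup>2) * (\<integral>\<^sup>+R. ennreal (R ^ 4) \<partial>\<rho>))"
      using r1.emeasure_space_1 by (simp add: P nn_integral_add nn_integral_cmult)
    also have "\<dots> \<le> ?P + (ennreal (7/50 * (8/5)) + ennreal (7/50 / s\<^sup>2) * ennreal (K2 * s\<^sup>2))"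
      using m4 unfolding s_def by (intro add_left_mono mult_left_mono) auto
    also have "\<dots> = ?P + ennreal (7/50 * (8/5 + K2))"
      using s0 K2 by (simp add: ennreal_mult'[symmetric] ennreal_plus[symmetric] del: ennreal_plus)
    finally have "ennreal (7/50 * (22/5) - 7/50 * (8/5 + K2)) \<le> ?P"
      using K2 by (intro ennreal_le_diffI) auto
    moreover have "293/1000 - 593/10000 * K2\<^sup>2 \<le> 7/50 * (22/5) - 7/50 * (8/5 + K2)" using K by (simp add: field_simps)
    ultimately show ?thesis by (meson ennreal_leI order_trans)
  qed
qed

text \<open>
  If all weights are below \<open>1/3\<close>, a maximal set of total weight at most \<open>2/3\<close> has weight at least
  \<open>1/3\<close>, for otherwise another index could be added.
\<close>

lemma balanced_subset_exists:
  fixes b :: "'n::finite \<Rightarrow> real"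
  assumes b: "\<And>j. 0 \<le> b j" "(\<Sum>j\<in>UNIV. b j) = 1" "\<And>j. b j \<le> 2/3"
  obtains J where "1/3 \<le> sum b J" "sum b J \<le> 2/3"
proof (cases "\<exists>j. 1/3 \<le> b j")
  case True
  then obtain j where "1/3 \<le> b j" by blast
  then show ?thesis using that[of "{j}"] b by simp
next
  case False
  let ?F = "{J. sum b J \<le> 2/3}"
  have "finite ?F" "{} \<in> ?F" by auto
  then obtain J where J: "J \<in> ?F" and max: "\<And>J'. J' \<in> ?F \<Longrightarrow> J \<subseteq> J' \<Longrightarrow> J = J'"
    using finite_has_maximal2[of ?F "{}"] by blast
  have "1/3 \<le> sum b J"
  proof (rule ccontr)
    assume small: "\<not> ?thesis"
    then have "J \<noteq> UNIV" using b by auto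
    then obtain i where i: "i \<notin> J" by blast
    then have "sum b (insert i J) \<le> 2/3" using small False by (simp add: not_le) (smt (verit))
    then show False using max[of "insert i J"] i by blast
  qed
  then show ?thesis using J that by simp
qed

lemma radius_law_UNIV_exists:
  fixes a :: "'n::finite \<Rightarrow> 'k"
  assumes a: "(\<Sum>j\<in>UNIV. (norm (a j))\<^sup>2) = 1"
  obtains \<rho> where "radius_law UNIV a \<rho>" "ennreal (293/1000 - 593/10000 * K2\<^sup>2) \<le> emeasure \<rho> {1..}"
proof (cases "\<forall>j. (norm (a j))\<^sup>2 \<le> 2/3")
  case True
  then obtain J where J: "1/3 \<le> (\<Sum>j\<in>J. (norm (a j))\<^sup>2)" "(\<Sum>j\<in>J. (norm (a j))\<^sup>2) \<le> 2/3"
    using balanced_subset_exists[of "\<lambda>j. (norm (a j))\<^sup>2"] a by auto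
  obtain \<rho> where \<rho>: "radius_law J a \<rho>" by (rule radius_law_exists[of J]) auto
  obtain \<rho>' where \<rho>': "radius_law (- J) a \<rho>'" by (rule radius_law_exists[of "- J"]) auto
  have "1 - (\<Sum>j\<in>J. (norm (a j))\<^sup>2) = (\<Sum>j\<in>- J. (norm (a j))\<^sup>2)"
    using a sum.subset_diff[of J UNIV "\<lambda>j. (norm (a j))\<^sup>2"] by (simp add: Compl_eq_Diff_UNIV)
  from joint_radius_balanced[OF \<rho> \<rho>' refl this J] radius_law_Un[OF \<rho> \<rho>'] show ?thesis
    using that by (simp add: Compl_partition)
next
  case False
  then obtain i where i: "2/3 \<le> (norm (a i))\<^sup>2" by (auto simp: not_le intro: less_imp_le)
  obtain \<rho> where \<rho>: "radius_law (- {i}) a \<rho>" by (rule radius_law_exists[of "- {i}"]) auto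
  have s: "1 - (norm (a i))\<^sup>2 = (\<Sum>j\<in>- {i}. (norm (a j))\<^sup>2)"
    using a sum.subset_diff[of "{i}" UNIV "\<lambda>j. (norm (a j))\<^sup>2"] by (simp add: Compl_eq_Diff_UNIV)
  moreover have "0 \<le> (\<Sum>j\<in>- {i}. (norm (a j))\<^sup>2)" by (intro sum_nonneg) simp
  ultimately have "ennreal (293/1000 - 593/10000 * K2\<^sup>2) \<le> emeasure (join_radii \<rho> (return borel (norm (a i)))) {1..}"
    using i by (intro joint_radius_dominant[OF \<rho> s]) auto
  moreover have "radius_law (- {i} \<union> {i}) a (join_radii \<rho> (return borel (norm (a i))))"
    by (rule radius_law_Un[OF \<rho> radius_law_singleton]) auto
  moreover have "- {i} \<union> {i} = UNIV" by auto
  ultimately show ?thesis using that by metis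
qed

text \<open>
  Bounding \<open>R\<^sup>-\<^sup>k\<close> from below on \<open>R \<ge> 1\<close> by a multiple of the indicator, at the cost of a multiple of
  \<open>(R\<^sup>2 - \<theta>)\<^sup>2\<close>, whose mean is controlled by the first two moments of \<open>R\<^sup>2\<close>.
\<close>

lemma radius_law_functional_lower:
  assumes "radius_law UNIV (a :: 'n::finite \<Rightarrow> 'k) \<rho>" and a: "(\<Sum>j\<in>UNIV. (norm (a j))\<^sup>2) = 1"
    and P: "ennreal p \<le> emeasure \<rho> {1..}"
    and c: "0 \<le> A" "0 \<le> c" "0 \<le> \<theta>" "0 \<le> p" and [measurable]: "\<phi> \<in> borel_measurable borel"
    and \<phi>: "\<And>R. 0 \<le> R \<Longrightarrow> ennreal (A * indicator {1..} R) \<le> \<phi> R + ennreal (c * (R\<^sup>2 - \<theta>)\<^sup>2)"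
  shows "ennreal (A * p + 2 * c * \<theta> - c * (K2 + \<theta>\<^sup>2)) \<le> (\<integral>\<^sup>+R. \<phi> R \<partial>\<rho>)"
proof -
  have r1: "prob_space \<rho>" and s1[measurable_cong]: "sets \<rho> = sets borel" and AE1: "AE R in \<rho>. 0 \<le> R"
    and m2: "(\<integral>\<^sup>+R. ennreal (R\<^sup>2) \<partial>\<rho>) = ennreal 1"
    and m4: "(\<integral>\<^sup>+R. ennreal (R ^ 4) \<partial>\<rho>) \<le> ennreal K2"
    using assms(1) unfolding radius_law_def a by auto
  interpret r1: prob_space \<rho> by fact
  have sp: "emeasure \<rho> UNIV = 1"
    using r1.emeasure_space_1 sets_eq_imp_space_eq[OF s1] by simp
  have "ennreal (A * p + 2 * c * \<theta>) = ennreal A * ennreal p + ennreal (2 * c * \<theta>)"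
    using c by (simp add: ennreal_mult'[symmetric] ennreal_plus[symmetric] del: ennreal_plus)
  also have "\<dots> \<le> ennreal A * emeasure \<rho> {1..} + ennreal (2 * c * \<theta>)"
    by (intro add_right_mono mult_left_mono P) simp
  also have "\<dots> = (\<integral>\<^sup>+R. ennreal A * indicator {1..} R + ennreal (2 * c * \<theta>) * ennreal (R\<^sup>2) \<partial>\<rho>)"
    by (simp add: nn_integral_add nn_integral_cmult m2 s1)
  also have "\<dots> \<le> (\<integral>\<^sup>+R. \<phi> R + (ennreal c * ennreal (R ^ 4) + ennreal (c * \<theta>\<^sup>2)) \<partial>\<rho>)"
  proof (rule nn_integral_mono_AE, use AE1 in eventually_elim)
    case (elim R)
    have "ennreal A * indicator {1..} R + ennreal (2 * c * \<theta>) * ennreal (R\<^sup>2) = ennreal (A * indicator {1..} R) + ennreal (2 * c * \<theta> * R\<^sup>2)"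
      using c by (auto simp: ennreal_mult'[symmetric] split: split_indicator)
    also have "\<dots> \<le> \<phi> R + ennreal (c * (R\<^sup>2 - \<theta>)\<^sup>2) + ennreal (2 * c * \<theta> * R\<^sup>2)"
      by (intro add_right_mono \<phi> elim)
    also have "\<dots> = \<phi> R + ennreal (c * (R\<^sup>2 - \<theta>)\<^sup>2 + 2 * c * \<theta> * R\<^sup>2)"
      using c by (simp add: add.assoc ennreal_plus[symmetric] del: ennreal_plus)
    also have "c * (R\<^sup>2 - \<theta>)\<^sup>2 + 2 * c * \<theta> * R\<^sup>2 = c * R ^ 4 + c * \<theta>\<^sup>2"
      by (simp add: power2_eq_square power4_eq_xxxx algebra_simps)
    finally show ?case
      using c by (simp add: ennreal_mult'[symmetric] ennreal_plus[symmetric] del: ennreal_plus)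
  qed
  also have "\<dots> = (\<integral>\<^sup>+R. \<phi> R \<partial>\<rho>) + (ennreal c * (\<integral>\<^sup>+R. ennreal (R ^ 4) \<partial>\<rho>) + ennreal (c * \<theta>\<^sup>2))"
    by (simp add: nn_integral_add nn_integral_cmult sp sets_eq_imp_space_eq[OF s1])
  also have "\<dots> \<le> (\<integral>\<^sup>+R. \<phi> R \<partial>\<rho>) + (ennreal c * ennreal K2 + ennreal (c * \<theta>\<^sup>2))"
    by (intro add_left_mono add_right_mono mult_left_mono m4) simp
  also have "\<dots> = (\<integral>\<^sup>+R. \<phi> R \<partial>\<rho>) + ennreal (c * (K2 + \<theta>\<^sup>2))"
    using c K2 by (simp add: ennreal_mult'[symmetric] ennreal_plus[symmetric] distrib_left del: ennreal_plus)
  finally show ?thesis using c K2 by (intro ennreal_le_diffI) auto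
qed

end

section \<open>Sections of the polydisc\<close>

lemma nn_integral_PiM_uniform:
  fixes f :: "('i \<Rightarrow> 'k::euclidean_space) \<Rightarrow> ennreal"
  assumes I: "finite I" and [measurable]: "f \<in> borel_measurable (\<Pi>\<^sub>M j\<in>I. lborel)"
  shows "(\<integral>\<^sup>+x. f x \<partial>(\<Pi>\<^sub>M j\<in>I. ball_law))
    = (\<integral>\<^sup>+x. (\<Prod>j\<in>I. indicator (cball 0 1) (x j) / emeasure lborel (cball 0 1 :: 'k set)) * f x \<partial>(\<Pi>\<^sub>M j\<in>I. lborel))"
proof -
  let ?\<omega> = "emeasure lborel (cball 0 1 :: 'k set)"
  let ?d = "\<lambda>x :: 'i \<Rightarrow> 'k. \<Prod>j\<in>I. indicator (cball 0 1) (x j) / ?\<omega>"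
  interpret B: prob_space "ball_law :: 'k measure" by (rule prob_space_ball_law)
  interpret U: product_sigma_finite "\<lambda>_::'i. ball_law :: 'k measure" ..
  interpret L: product_sigma_finite "\<lambda>_::'i. lborel :: 'k measure" ..
  have c[measurable]: "cball 0 1 \<in> sets (borel :: 'k measure)" by simp
  have d[measurable]: "?d \<in> borel_measurable (\<Pi>\<^sub>M j\<in>I. lborel)" by measurable
  have s: "sets (\<Pi>\<^sub>M j\<in>I. (ball_law :: 'k measure)) = sets (\<Pi>\<^sub>M j\<in>I. lborel)"
    by (rule sets_PiM_cong) auto
  have "density (\<Pi>\<^sub>M j\<in>I. lborel) ?d = (\<Pi>\<^sub>M j\<in>I. ball_law)"
  proof (rule U.PiM_eqI[OF I])
    show "sets (density (\<Pi>\<^sub>M j\<in>I. lborel) ?d) = sets (\<Pi>\<^sub>M j\<in>I. (ball_law :: 'k measure))"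
      by (simp add: s)
    fix A :: "'i \<Rightarrow> 'k set" assume A: "\<And>j. j \<in> I \<Longrightarrow> A j \<in> sets ball_law"
    have m: "(\<lambda>y. indicator (cball 0 1) y / ?\<omega> * indicator (A j) y) \<in> borel_measurable lborel" if "j \<in> I" for j
      using A[OF that] by measurable
    have "emeasure (density (\<Pi>\<^sub>M j\<in>I. lborel) ?d) (Pi\<^sub>E I A) = (\<integral>\<^sup>+x. ?d x * indicator (Pi\<^sub>E I A) x \<partial>(\<Pi>\<^sub>M j\<in>I. lborel))"
      using A I by (intro emeasure_density d sets_PiM_I_finite) auto
    also have "\<dots> = (\<integral>\<^sup>+x. (\<Prod>j\<in>I. indicator (cball 0 1) (x j) / ?\<omega> * indicator (A j) (x j)) \<partial>(\<Pi>\<^sub>M j\<in>I. lborel))"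
    proof (rule nn_integral_cong)
      fix x :: "'i \<Rightarrow> 'k" assume "x \<in> space (\<Pi>\<^sub>M j\<in>I. lborel)"
      then have "indicator (Pi\<^sub>E I A) x = (\<Prod>j\<in>I. indicator (A j) (x j) :: ennreal)"
        using I by (auto simp: space_PiM PiE_iff prod_zero_iff indicator_def intro!: prod.neutral[symmetric])
      then show "?d x * indicator (Pi\<^sub>E I A) x = (\<Prod>j\<in>I. indicator (cball 0 1) (x j) / ?\<omega> * indicator (A j) (x j))"
        by (simp add: prod.distrib)
    qed
    also have "\<dots> = (\<Prod>j\<in>I. \<integral>\<^sup>+y. indicator (cball 0 1) y / ?\<omega> * indicator (A j) y \<partial>lborel)"
      by (rule L.product_nn_integral_prod[OF I m])
    also have "\<dots> = (\<Prod>j\<in>I. emeasure ball_law (A j))"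
    proof (rule prod.cong[OF refl])
      fix j assume "j \<in> I"
      then have [measurable]: "A j \<in> sets borel" using A by simp
      have "(\<integral>\<^sup>+y. indicator (cball 0 1) y / ?\<omega> * indicator (A j) y \<partial>lborel) = (\<integral>\<^sup>+y. indicator (cball 0 1 \<inter> A j) y / ?\<omega> \<partial>lborel)"
        by (intro nn_integral_cong) (auto split: split_indicator)
      also have "\<dots> = emeasure lborel (cball 0 1 \<inter> A j) / ?\<omega>"
        by (subst nn_integral_divide) auto
      finally show "(\<integral>\<^sup>+y. indicator (cball 0 1) y / ?\<omega> * indicator (A j) y \<partial>lborel) = emeasure ball_law (A j)"
        unfolding ball_law_def by (subst emeasure_uniform_measure) auto
    qed
    finally show "emeasure (density (\<Pi>\<^sub>M j\<in>I. lborel) ?d) (Pi\<^sub>E I A) = (\<Prod>j\<in>I. emeasure ball_law (A j))" .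
  qed
  then have "(\<integral>\<^sup>+x. f x \<partial>(\<Pi>\<^sub>M j\<in>I. ball_law)) = (\<integral>\<^sup>+x. f x \<partial>density (\<Pi>\<^sub>M j\<in>I. lborel) ?d)" by simp
  also have "\<dots> = (\<integral>\<^sup>+x. ?d x * f x \<partial>(\<Pi>\<^sub>M j\<in>I. lborel))"
    by (rule nn_integral_density) measurable
  finally show ?thesis .
qed

lemma ennreal_mult_right_le_cancel:
  fixes x y c :: ennreal
  assumes "x * c \<le> y * c" "c \<noteq> 0" "c \<noteq> \<infinity>"
  shows "x \<le> y"
  using assms by (metis ennreal_mult_le_mult_iff mult.commute infinity_ennreal_def)

context uniform_ball
begin

definition polydisc :: "real \<Rightarrow> ('k ^ 'n) set" where
  "polydisc r = {x. \<forall>j. norm (x $ j) \<le> r}"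

lemma polydisc_measurable[measurable]: "(polydisc r :: ('k ^ 'n) set) \<in> sets borel"
  and closed_polydisc: "closed (polydisc r :: ('k ^ 'n) set)"
  and convex_polydisc: "convex (polydisc r :: ('k ^ 'n) set)"
proof -
  have eq: "polydisc r = (\<Inter>j. (\<lambda>x :: 'k ^ 'n. x $ j) -` cball 0 r)"
    by (auto simp: polydisc_def)
  show closed: "closed (polydisc r :: ('k ^ 'n) set)"
    unfolding eq by (intro closed_INT ballI closed_vimage continuous_intros closed_cball)
  then show "(polydisc r :: ('k ^ 'n) set) \<in> sets borel" by simp
  show "convex (polydisc r :: ('k ^ 'n) set)"
    unfolding eq by (intro convex_INT convex_linear_vimage convex_cball) (auto intro: linearI)
qed

lemma polydisc_contains_cball: "norm x \<le> r \<Longrightarrow> x \<in> polydisc r"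
  using Finite_Cartesian_Product.norm_nth_le[of x] by (auto simp: polydisc_def intro: order_trans)

lemma bounded_polydisc: "bounded (polydisc r :: ('k ^ 'n) set)"
proof (rule boundedI)
  fix x :: "'k ^ 'n" assume "x \<in> polydisc r"
  then have "(\<Sum>j\<in>UNIV. norm (x $ j)) \<le> (\<Sum>j\<in>(UNIV :: 'n set). r)"
    by (intro sum_mono) (auto simp: polydisc_def)
  then show "norm x \<le> real CARD('n) * r"
    using L2_set_le_sum[of UNIV "\<lambda>j. norm (x $ j)"] by (simp add: norm_vec_def)
qed

text \<open>
  The volume of the polydisc is 1, so integration over it is the expectation for independent uniform
  coordinates, and the value of the linear form has the law described by \<open>\<rho>\<close>.
\<close>

lemma nn_integral_polydisc:
  fixes a :: "'n::finite \<Rightarrow> 'k" and f :: "'k \<Rightarrow> ennreal"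
  assumes \<alpha>: "\<alpha> > 0" "ennreal (\<alpha> ^ DIM('k)) * emeasure lborel (cball 0 1 :: 'k set) = 1"
    and [measurable]: "f \<in> borel_measurable borel" and \<rho>: "radius_law UNIV a \<rho>"
  shows "(\<integral>\<^sup>+x. indicator (polydisc \<alpha>) x * f ((\<Sum>j\<in>UNIV. x $ j * a j) /\<^sub>R \<alpha>) \<partial>(lborel :: ('k ^ 'n) measure))
    = (\<integral>\<^sup>+R. (\<integral>\<^sup>+v. f (R *\<^sub>R v) \<partial>U) \<partial>\<rho>)"
proof -
  let ?\<omega> = "emeasure lborel (cball 0 1 :: 'k set)"
  let ?M = "\<Pi>\<^sub>M j\<in>(UNIV :: 'n set). (lborel :: 'k measure)"
  let ?g = "\<lambda>x :: 'k ^ 'n. indicator (polydisc \<alpha>) x * f ((\<Sum>j\<in>UNIV. x $ j * a j) /\<^sub>R \<alpha>)"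
  have [measurable]: "(\<lambda>x :: 'k ^ 'n. x $ j) \<in> borel_measurable borel" for j
    by (intro borel_measurable_continuous_onI continuous_intros)
  have g[measurable]: "?g \<in> borel_measurable borel" by measurable
  have vec[measurable]: "(\<lambda>x. \<chi> j. x j) \<in> ?M \<rightarrow>\<^sub>M (borel :: ('k ^ 'n) measure)" by (rule vec_lambda_measurable)
  have [measurable]: "cball 0 1 \<in> sets (borel :: 'k measure)" by simp
  have \<omega>: "1 / ?\<omega> = ennreal (\<alpha> ^ DIM('k))"
  proof -
    have "?\<omega> \<noteq> 0" "?\<omega> \<noteq> \<infinity>" by (rule emeasure_unit_cball)+
    then have "1 / ?\<omega> = (ennreal (\<alpha> ^ DIM('k)) * ?\<omega>) / ?\<omega>" using \<alpha> by simp
    also have "\<dots> = ennreal (\<alpha> ^ DIM('k))" using \<open>?\<omega> \<noteq> 0\<close> \<open>?\<omega> \<noteq> \<infinity>\<close> by (simp add: ennreal_mult_divide_eq)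
    finally show ?thesis .
  qed
  have "(\<integral>\<^sup>+x. ?g x \<partial>lborel) = (\<integral>\<^sup>+x. ?g (\<chi> j. x j) \<partial>?M)"
    by (rule nn_integral_vec) measurable
  also have "\<dots> = ennreal (\<alpha> ^ (DIM('k) * CARD('n))) * (\<integral>\<^sup>+x. ?g (\<chi> j. (\<lambda>i\<in>UNIV. \<alpha> *\<^sub>R x i + 0) j) \<partial>?M)"
    using \<alpha>(1) by (intro nn_integral_PiM_lborel_affine[where u = "\<lambda>_. 0"]) (auto intro: measurable_compose[OF vec g])
  also have "\<dots> = ennreal (\<alpha> ^ (DIM('k) * CARD('n))) * (\<integral>\<^sup>+x. (\<Prod>j\<in>UNIV. indicator (cball 0 1) (x j)) * f (\<Sum>j\<in>UNIV. x j * a j) \<partial>?M)"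
  proof (rule arg_cong2[where f = "(*)", OF refl], rule nn_integral_cong)
    fix x :: "'n \<Rightarrow> 'k"
    have "indicator (polydisc \<alpha>) (\<chi> j. (\<lambda>i\<in>UNIV. \<alpha> *\<^sub>R x i + 0) j) = (\<Prod>j\<in>UNIV. indicator (cball 0 1) (x j) :: ennreal)"
    proof (cases "\<forall>j. norm (x j) \<le> 1")
      case True
      then show ?thesis using \<alpha>(1) by (simp add: polydisc_def)
    next
      case False
      then obtain j where "\<not> norm (x j) \<le> 1" by blast
      then have "\<not> norm (\<alpha> *\<^sub>R x j) \<le> \<alpha>" "indicator (cball 0 1) (x j) = (0 :: ennreal)" using \<alpha>(1) by (auto simp: not_le)
      then have "(\<chi> j. (\<lambda>i\<in>UNIV. \<alpha> *\<^sub>R x i + 0) j) \<notin> polydisc \<alpha>"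
        by (auto simp: polydisc_def)
      moreover have "(\<Prod>j\<in>UNIV. indicator (cball 0 1) (x j) :: ennreal) = 0"
        using \<open>indicator (cball 0 1) (x j) = (0 :: ennreal)\<close> by (intro prod_zero) auto
      ultimately show ?thesis by simp
    qed
    moreover have "(\<Sum>j\<in>UNIV. (\<chi> j. (\<lambda>i\<in>UNIV. \<alpha> *\<^sub>R x i + 0) j) $ j * a j) /\<^sub>R \<alpha> = (\<Sum>j\<in>UNIV. x j * a j)"
      using \<alpha>(1) by (simp add: scaleR_sum_right[symmetric])
    ultimately show "?g (\<chi> j. (\<lambda>i\<in>UNIV. \<alpha> *\<^sub>R x i + 0) j) = (\<Prod>j\<in>UNIV. indicator (cball 0 1) (x j)) * f (\<Sum>j\<in>UNIV. x j * a j)"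
      by simp
  qed
  also have "\<dots> = (\<integral>\<^sup>+x. ennreal (\<alpha> ^ (DIM('k) * CARD('n))) * ((\<Prod>j\<in>UNIV. indicator (cball 0 1) (x j)) * f (\<Sum>j\<in>UNIV. x j * a j)) \<partial>?M)"
    by (rule nn_integral_cmult[symmetric]) measurable
  also have "\<dots> = (\<integral>\<^sup>+x. (\<Prod>j\<in>UNIV. indicator (cball 0 1) (x j) / ?\<omega>) * f (\<Sum>j\<in>UNIV. x j * a j) \<partial>?M)"
  proof (intro nn_integral_cong)
    fix x :: "'n \<Rightarrow> 'k"
    have "(\<Prod>j\<in>(UNIV :: 'n set). indicator (cball 0 1) (x j) / ?\<omega>) = (\<Prod>j\<in>UNIV. indicator (cball 0 1) (x j) * ennreal (\<alpha> ^ DIM('k)))"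
      unfolding \<omega>[symmetric] by (simp add: ennreal_times_divide)
    also have "\<dots> = ennreal (\<alpha> ^ (DIM('k) * CARD('n))) * (\<Prod>j\<in>UNIV. indicator (cball 0 1) (x j))"
      using \<alpha>(1) by (simp add: prod.distrib ennreal_power power_mult mult.commute)
    finally show "ennreal (\<alpha> ^ (DIM('k) * CARD('n))) * ((\<Prod>j\<in>UNIV. indicator (cball 0 1) (x j)) * f (\<Sum>j\<in>UNIV. x j * a j))
        = (\<Prod>j\<in>UNIV. indicator (cball 0 1) (x j) / ?\<omega>) * f (\<Sum>j\<in>UNIV. x j * a j)"
      by (simp add: mult.assoc)
  qed
  also have "\<dots> = (\<integral>\<^sup>+x. f (\<Sum>j\<in>UNIV. x j * a j) \<partial>(\<Pi>\<^sub>M j\<in>UNIV. ball_law))"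
    by (rule nn_integral_PiM_uniform[symmetric]) auto
  also have "\<dots> = (\<integral>\<^sup>+R. (\<integral>\<^sup>+v. f (R *\<^sub>R v) \<partial>U) \<partial>\<rho>)"
    unfolding U_eq[symmetric] using \<rho> by (auto simp: radius_law_def)
  finally show ?thesis .
qed

text \<open>
  The vector \<open>R v\<close> has constant density on the ball of radius \<open>R\<close>.
\<close>

lemma nn_integral_U_scaled:
  assumes \<alpha>: "\<alpha> > 0" "ennreal (\<alpha> ^ DIM('k)) * emeasure lborel (cball 0 1 :: 'k set) = 1"
    and [measurable]: "N \<in> sets borel" and R: "0 < R"
  shows "(\<integral>\<^sup>+v. indicator N (R *\<^sub>R v) \<partial>U) = ennreal (\<alpha> ^ DIM('k)) * (ennreal (1 / R ^ DIM('k)) * emeasure lborel (N \<inter> cball 0 R))"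
proof -
  let ?\<omega> = "emeasure lborel (cball 0 1 :: 'k set)"
  have \<omega>: "?\<omega> \<noteq> 0" "?\<omega> \<noteq> \<infinity>" by (rule emeasure_unit_cball)+
  have [measurable]: "cball 0 r \<in> sets (borel :: 'k measure)" for r by simp
  have "emeasure lborel (N \<inter> cball 0 R) = (\<integral>\<^sup>+z. indicator (N \<inter> cball 0 R) z \<partial>lborel)" by simp
  also have "\<dots> = ennreal (R ^ DIM('k)) * (\<integral>\<^sup>+v. indicator (N \<inter> cball 0 R) (R *\<^sub>R v) \<partial>lborel)"
    using R by (intro nn_integral_lborel_scale) auto
  also have "(\<integral>\<^sup>+v. indicator (N \<inter> cball 0 R) (R *\<^sub>R v) \<partial>(lborel :: 'k measure)) = (\<integral>\<^sup>+v. indicator N (R *\<^sub>R v) * indicator (cball 0 1) v \<partial>lborel)"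
    using R by (intro nn_integral_cong) (auto split: split_indicator)
  also have "\<dots> = ?\<omega> * (\<integral>\<^sup>+v. indicator N (R *\<^sub>R v) \<partial>U)"
    unfolding U_eq by (subst nn_integral_ball_law) (use \<omega> in \<open>auto simp: ennreal_times_divide ennreal_mult_divide_eq mult.commute[of ?\<omega>]\<close>)
  finally have "emeasure lborel (N \<inter> cball 0 R) = ennreal (R ^ DIM('k)) * (?\<omega> * (\<integral>\<^sup>+v. indicator N (R *\<^sub>R v) \<partial>U))" .
  then have "ennreal (\<alpha> ^ DIM('k)) * (ennreal (1 / R ^ DIM('k)) * emeasure lborel (N \<inter> cball 0 R))
      = (ennreal (1 / R ^ DIM('k)) * ennreal (R ^ DIM('k))) * ((ennreal (\<alpha> ^ DIM('k)) * ?\<omega>) * (\<integral>\<^sup>+v. indicator N (R *\<^sub>R v) \<partial>U))"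
    by (simp add: mult_ac)
  also have "ennreal (1 / R ^ DIM('k)) * ennreal (R ^ DIM('k)) = 1"
    using R by (simp add: ennreal_mult'[symmetric])
  finally show ?thesis using \<alpha> by simp
qed

end

text \<open>
  The setting of the two cases: \<open>h x\<close> is the sum of the \<open>x\<^sub>j a\<^sub>j\<close>, \<open>E\<close> embeds the scalars as the
  line orthogonal to the kernel of \<open>h\<close>, and \<open>p\<close>, \<open>B\<close> is a frame of the affine hyperplane
  \<open>h x = \<alpha>\<close>.
\<close>

locale hyperplane_section = uniform_ball U K2
  for U :: "'k::{real_normed_field, euclidean_space} measure" and K2 :: real +
  fixes a :: "'n::finite \<Rightarrow> 'k" and \<alpha> :: real and E :: "'k \<Rightarrow> 'k ^ 'n" and p :: "'k ^ 'n" and B :: "('k ^ 'n) set"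
  assumes \<alpha>: "\<alpha> > 0" "ennreal (\<alpha> ^ DIM('k)) * emeasure lborel (cball 0 1 :: 'k set) = 1"
    and E: "linear E" "\<And>z. norm (E z) = norm z" "\<And>z. (\<Sum>j\<in>UNIV. E z $ j * a j) = z"
    and orth: "\<And>w. (\<Sum>j\<in>UNIV. w $ j * a j) = 0 \<longleftrightarrow> (\<forall>z. E z \<bullet> w = 0)"
    and frame: "orthonormal_frame {x. (\<Sum>j\<in>UNIV. x $ j * a j) = of_real \<alpha>} p B"
begin

definition h :: "'k ^ 'n \<Rightarrow> 'k" where "h x = (\<Sum>j\<in>UNIV. x $ j * a j)"

abbreviation M :: "('k ^ 'n \<Rightarrow> real) measure" where "M \<equiv> \<Pi>\<^sub>M b\<in>B. lborel"

abbreviation S :: "('k ^ 'n \<Rightarrow> real) \<Rightarrow> 'k ^ 'n" where "S c \<equiv> \<Sum>b\<in>B. c b *\<^sub>R b"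

lemma h_linear: "linear h"
  unfolding h_def by (intro linearI) (simp_all add: distrib_right sum.distrib scaleR_sum_right)

lemma h_E: "h (E z) = z"
  using E by (simp add: h_def)

lemma B: "pairwise orthogonal B" "\<And>b. b \<in> B \<Longrightarrow> norm b = 1"
  using frame by (auto simp: orthonormal_frame_def)

lemma finite_B: "finite B"
proof -
  have "independent B" using B by (intro pairwise_orthogonal_independent) (auto dest: B(2))
  then show ?thesis by (rule independent_imp_finite)
qed

lemma affine_hyperplane: "{x. h x = of_real \<alpha>} = (\<lambda>x. p + x) ` span B"
  using frame by (simp add: orthonormal_frame_def h_def)

lemma h_p: "h p = of_real \<alpha>"
  using affine_hyperplane span_zero[of B] by (metis (mono_tags, lifting) add.right_neutral imageI mem_Collect_eq)

lemma span_B: "w \<in> span B \<longleftrightarrow> h w = 0"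
proof -
  have "w \<in> span B \<longleftrightarrow> p + w \<in> {x. h x = of_real \<alpha>}"
    unfolding affine_hyperplane by auto
  then show ?thesis using h_p by (simp add: linear_add[OF h_linear])
qed

lemma S_span: "S c \<in> span B" by (intro span_sum span_scale span_base)

lemma h_S: "h (S c) = 0" using S_span span_B by blast

lemma h_measurable[measurable]: "h \<in> borel_measurable borel"
  using h_linear by (intro borel_measurable_continuous_onI linear_continuous_on) (simp add: linear_conv_bounded_linear)

lemma E_measurable[measurable]: "E \<in> borel_measurable borel"
  using E(1) by (intro borel_measurable_continuous_onI linear_continuous_on) (simp add: linear_conv_bounded_linear)

lemma E_scale: "E (r *\<^sub>R z) = r *\<^sub>R E z"
  by (rule linear_scale[OF E(1)])

text \<open>
  The volume of the section of the polydisc by \<open>h x = \<alpha> z\<close>, in the coordinates of the fixed basis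
  \<open>B\<close> of the kernel of \<open>h\<close> and with base point \<open>\<alpha> E z\<close>.
\<close>

definition G :: "'k \<Rightarrow> ennreal" where
  "G z = (\<integral>\<^sup>+c. indicator (polydisc \<alpha>) (\<alpha> *\<^sub>R E z + S c) \<partial>M)"

lemma G_measurable[measurable]: "G \<in> borel_measurable borel"
proof -
  interpret sigma_finite_measure M by (rule sigma_finite_PiM_lborel[OF finite_B])
  show ?thesis unfolding G_def by measurable
qed

text \<open>
  The given base point \<open>p\<close> differs from \<open>\<alpha> E 1\<close> by a vector in the span of \<open>B\<close>, and the product
  measure is translation invariant.
\<close>

lemma section_eq_G: "emeasure (frame_measure p B) (polydisc \<alpha> \<inter> {x. h x = of_real \<alpha>}) = G 1"
proof -
  have E1: "h (\<alpha> *\<^sub>R E 1) = of_real \<alpha>"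
    unfolding linear_scale[OF h_linear] h_E by (simp add: of_real_def)
  then have "p - \<alpha> *\<^sub>R E 1 \<in> span B"
    by (simp add: span_B linear_diff[OF h_linear] h_p)
  then obtain u where u: "p - \<alpha> *\<^sub>R E 1 = S u"
    using finite_B by (auto simp: span_finite)
  have m[measurable]: "(\<lambda>c. p + S c) \<in> M \<rightarrow>\<^sub>M borel" by measurable
  have [measurable]: "polydisc \<alpha> \<inter> {x. h x = of_real \<alpha>} \<in> sets borel" by measurable
  have "emeasure (frame_measure p B) (polydisc \<alpha> \<inter> {x. h x = of_real \<alpha>})
      = (\<integral>\<^sup>+x. indicator (polydisc \<alpha> \<inter> {x. h x = of_real \<alpha>}) x \<partial>frame_measure p B)"
    by (rule nn_integral_indicator[symmetric]) (simp add: frame_measure_def)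
  also have "\<dots> = (\<integral>\<^sup>+c. indicator (polydisc \<alpha> \<inter> {x. h x = of_real \<alpha>}) (p + S c) \<partial>M)"
    unfolding frame_measure_def by (rule nn_integral_distr) measurable
  also have "\<dots> = (\<integral>\<^sup>+c. indicator (polydisc \<alpha>) (\<alpha> *\<^sub>R E 1 + S (\<lambda>b\<in>B. 1 *\<^sub>R c b + u b)) \<partial>M)"
  proof (intro nn_integral_cong)
    fix c
    have "p + S c = \<alpha> *\<^sub>R E 1 + S (\<lambda>b\<in>B. 1 *\<^sub>R c b + u b)"
      using u by (simp add: scaleR_left_distrib sum.distrib algebra_simps)
    moreover have "h (p + S c) = of_real \<alpha>" by (simp add: linear_add[OF h_linear] h_p h_S)
    ultimately show "indicator (polydisc \<alpha> \<inter> {x. h x = of_real \<alpha>}) (p + S c) = (indicator (polydisc \<alpha>) (\<alpha> *\<^sub>R E 1 + S (\<lambda>b\<in>B. 1 *\<^sub>R c b + u b)) :: ennreal)"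
      by (auto split: split_indicator)
  qed
  also have "\<dots> = G 1"
    unfolding G_def
    using nn_integral_PiM_lborel_affine[OF finite_B, of 1 "\<lambda>c. indicator (polydisc \<alpha>) (\<alpha> *\<^sub>R E 1 + S c)" u] by simp
  finally show ?thesis .
qed

text \<open>
  The density of the linear form: up to normalisation, \<open>G z\<close> equals the mean of \<open>R\<^sup>-\<^sup>k\<close> over
  \<open>R \<ge> \<bar>z\<bar>\<close> for almost all \<open>z\<close>. The point 0 is excluded from \<open>N\<close> because an atom of \<open>R\<close> at 0
  would contribute there.
\<close>

lemma nn_integral_G:
  assumes N[measurable]: "N \<in> sets borel" and "0 \<notin> N" and \<rho>: "radius_law UNIV a \<rho>"
  shows "(\<integral>\<^sup>+z. indicator N z * G z \<partial>lborel)
    = (\<integral>\<^sup>+R. ennreal (1 / R ^ DIM('k)) * emeasure lborel (N \<inter> cball 0 R) \<partial>\<rho>)"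
proof -
  let ?g = "\<lambda>x :: 'k ^ 'n. indicator (polydisc \<alpha>) x * indicator N (h x /\<^sub>R \<alpha>) :: ennreal"
  let ?k = "ennreal (\<alpha> ^ DIM('k))"
  interpret sigma_finite_measure M by (rule sigma_finite_PiM_lborel[OF finite_B])
  have s1[measurable_cong]: "sets \<rho> = sets borel" and AE1: "AE R in \<rho>. 0 \<le> R" using \<rho> by (auto simp: radius_law_def)
  have g[measurable]: "?g \<in> borel_measurable borel" by measurable
  have [measurable]: "(\<lambda>(z, c). E z + S c) \<in> lborel \<Otimes>\<^sub>M M \<rightarrow>\<^sub>M borel" by measurable
  have split: "distr (lborel \<Otimes>\<^sub>M M) borel (\<lambda>(z, c). E z + S c) = lborel"
  proof (rule distr_orthogonal_split[OF B E(1,2)])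
    show "span B = {w. \<forall>z. E z \<bullet> w = 0}"
      using span_B orth by (auto simp: h_def)
  qed auto
  have "(\<integral>\<^sup>+x. ?g x \<partial>lborel) = (\<integral>\<^sup>+q. ?g ((\<lambda>(z, c). E z + S c) q) \<partial>(lborel \<Otimes>\<^sub>M M))"
    by (subst split[symmetric], rule nn_integral_distr) measurable
  also have "\<dots> = (\<integral>\<^sup>+z. (\<integral>\<^sup>+c. ?g ((\<lambda>(z, c). E z + S c) (z, c)) \<partial>M) \<partial>lborel)"
    by (rule nn_integral_fst[symmetric]) measurable
  also have "\<dots> = (\<integral>\<^sup>+z. (\<integral>\<^sup>+c. indicator N (z /\<^sub>R \<alpha>) * indicator (polydisc \<alpha>) (E z + S c) \<partial>M) \<partial>lborel)"
    by (simp add: linear_add[OF h_linear] h_E h_S mult.commute)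
  also have "\<dots> = ?k * (\<integral>\<^sup>+z. (\<integral>\<^sup>+c. indicator N (\<alpha> *\<^sub>R z /\<^sub>R \<alpha>) * indicator (polydisc \<alpha>) (E (\<alpha> *\<^sub>R z) + S c) \<partial>M) \<partial>lborel)"
    by (rule nn_integral_lborel_scale[OF _ \<alpha>(1)]) measurable
  also have "\<dots> = ?k * (\<integral>\<^sup>+z. indicator N z * G z \<partial>lborel)"
    using \<alpha>(1) by (simp add: G_def E_scale nn_integral_cmult)
  finally have "?k * (\<integral>\<^sup>+z. indicator N z * G z \<partial>lborel) = (\<integral>\<^sup>+R. (\<integral>\<^sup>+v. indicator N (R *\<^sub>R v) \<partial>U) \<partial>\<rho>)"
    using nn_integral_polydisc[OF \<alpha> _ \<rho>, of "indicator N"] by (simp add: h_def)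
  also have "\<dots> = (\<integral>\<^sup>+R. ?k * (ennreal (1 / R ^ DIM('k)) * emeasure lborel (N \<inter> cball 0 R)) \<partial>\<rho>)"
  proof (rule nn_integral_cong_AE, use AE1 in eventually_elim)
    case (elim R)
    show ?case
    proof (cases "R = 0")
      case True
      then show ?thesis using \<open>0 \<notin> N\<close> by simp
    next
      case False
      then show ?thesis using elim by (intro nn_integral_U_scaled[OF \<alpha> N]) auto
    qed
  qed
  also have "\<dots> = ?k * (\<integral>\<^sup>+R. ennreal (1 / R ^ DIM('k)) * emeasure lborel (N \<inter> cball 0 R) \<partial>\<rho>)"
  proof (rule nn_integral_cmult)
    have "(\<lambda>R. emeasure lborel (N \<inter> cball 0 R)) = (\<lambda>R. \<integral>\<^sup>+z. indicator N z * indicator {z. norm z \<le> R} z \<partial>lborel)"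
    proof (rule ext)
      fix R
      have "emeasure lborel (N \<inter> cball 0 R) = (\<integral>\<^sup>+z. indicator (N \<inter> cball 0 R) z \<partial>lborel)"
        by (rule nn_integral_indicator[symmetric]) simp
      also have "\<dots> = (\<integral>\<^sup>+z. indicator N z * indicator {z. norm z \<le> R} z \<partial>lborel)"
        by (intro nn_integral_cong) (auto split: split_indicator)
      finally show "emeasure lborel (N \<inter> cball 0 R) = (\<integral>\<^sup>+z. indicator N z * indicator {z. norm z \<le> R} z \<partial>lborel)" .
    qed
    then have "(\<lambda>R. emeasure lborel (N \<inter> cball 0 R)) \<in> borel_measurable borel" by simp
    then show "(\<lambda>R. ennreal (1 / R ^ DIM('k)) * emeasure lborel (N \<inter> cball 0 R)) \<in> borel_measurable \<rho>" by measurable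
  qed
  finally show ?thesis
    using \<alpha>(1) by (simp add: ennreal_mult_cancel_left)
qed

text \<open>
  If \<open>y\<close> lies in the section at level 1 and \<open>v\<close> in the polydisc, so does \<open>(1 - \<eta>) y + \<eta> v\<close> in the
  polydisc. With \<open>v\<close> a suitable multiple of a vector in the range of \<open>E\<close>, this embeds a copy of the
  section at level 1, shrunken by \<open>1 - \<eta>\<close>, into the section at every level \<open>z\<close> with
  \<open>\<bar>z - (1 - \<eta>)\<bar> \<le> \<eta>\<close>. The mean of \<open>G\<close> over these levels is at most \<open>(1 - 2 \<eta>)\<^sup>-\<^sup>k\<close>, because all of
  them have absolute value at least \<open>1 - 2 \<eta>\<close>. Then \<open>\<eta>\<close> tends to 0.
\<close>

lemma section_le_1: "G 1 \<le> 1"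
proof -
  obtain \<rho> where \<rho>: "radius_law UNIV a \<rho>" by (rule radius_law_exists[of UNIV a]) auto
  then have sp: "prob_space \<rho>" and AE1: "AE R in \<rho>. 0 \<le> R" by (auto simp: radius_law_def)
  let ?m = "card B" and ?k = "DIM('k)"
  have shrink: "ennreal ((1 - \<eta>) ^ ?m) * G 1 \<le> G z" if \<eta>: "0 < \<eta>" "\<eta> < 1" and z: "norm (z - of_real (1 - \<eta>)) \<le> \<eta>" for \<eta> z
  proof -
    have "G z = ennreal ((1 - \<eta>) ^ ?m) * (\<integral>\<^sup>+c. indicator (polydisc \<alpha>) (\<alpha> *\<^sub>R E z + S (\<lambda>b\<in>B. (1 - \<eta>) *\<^sub>R c b + 0)) \<partial>M)"
      unfolding G_def using \<eta> nn_integral_PiM_lborel_affine[OF finite_B, of "1 - \<eta>" "\<lambda>c. indicator (polydisc \<alpha>) (\<alpha> *\<^sub>R E z + S c)" "\<lambda>_. 0"] by simp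
    moreover have "G 1 \<le> (\<integral>\<^sup>+c. indicator (polydisc \<alpha>) (\<alpha> *\<^sub>R E z + S (\<lambda>b\<in>B. (1 - \<eta>) *\<^sub>R c b + 0)) \<partial>M)"
      unfolding G_def
    proof (rule nn_integral_mono)
      fix c
      define v where "v = (\<alpha> / \<eta>) *\<^sub>R E (z - of_real (1 - \<eta>))"
      have "norm v = (\<alpha> / \<eta>) * norm (z - of_real (1 - \<eta>))" using \<eta> \<alpha>(1) by (simp add: v_def E)
      also have "\<dots> \<le> (\<alpha> / \<eta>) * \<eta>" using \<eta> \<alpha>(1) z by (intro mult_left_mono) auto
      finally have v: "v \<in> polydisc \<alpha>" using \<eta> by (intro polydisc_contains_cball) simp
      have "E (of_real (1 - \<eta>)) = (1 - \<eta>) *\<^sub>R E 1"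
        using E_scale[of "1 - \<eta>" 1] by (simp add: of_real_def)
      then have ev: "\<eta> *\<^sub>R v = \<alpha> *\<^sub>R E z - (1 - \<eta>) *\<^sub>R (\<alpha> *\<^sub>R E 1)"
        using \<eta> by (simp add: v_def linear_diff[OF E(1)] scaleR_diff_right mult.commute)
      have eq: "\<alpha> *\<^sub>R E z + S (\<lambda>b\<in>B. (1 - \<eta>) *\<^sub>R c b + 0) = (1 - \<eta>) *\<^sub>R (\<alpha> *\<^sub>R E 1 + S c) + \<eta> *\<^sub>R v"
        unfolding ev by (simp add: scaleR_sum_right scaleR_add_right)
      have "\<alpha> *\<^sub>R E z + S (\<lambda>b\<in>B. (1 - \<eta>) *\<^sub>R c b + 0) \<in> polydisc \<alpha>" if "\<alpha> *\<^sub>R E 1 + S c \<in> polydisc \<alpha>"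
        unfolding eq using that v \<eta> convexD[OF convex_polydisc, of _ \<alpha> v "1 - \<eta>" \<eta>] by simp
      then show "indicator (polydisc \<alpha>) (\<alpha> *\<^sub>R E 1 + S c) \<le> (indicator (polydisc \<alpha>) (\<alpha> *\<^sub>R E z + S (\<lambda>b\<in>B. (1 - \<eta>) *\<^sub>R c b + 0)) :: ennreal)"
        by (auto split: split_indicator)
    qed
    ultimately show ?thesis by (simp add: mult_left_mono)
  qed
  have bound: "ennreal ((1 - \<eta>) ^ ?m * (1 - 2 * \<eta>) ^ ?k) * G 1 \<le> 1" if \<eta>: "0 < \<eta>" "\<eta> < 1/2" for \<eta>
  proof -
    let ?N = "cball (of_real (1 - \<eta>)) \<eta> :: 'k set"
    let ?V = "emeasure lborel ?N"
    have V: "?V \<noteq> 0" "?V \<noteq> \<infinity>"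
      using \<eta> unit_ball_vol_pos[of "real ?k"] by (auto simp: emeasure_cball simp del: unit_ball_vol_pos)
    have far: "1 - 2 * \<eta> \<le> norm z" if "z \<in> ?N" for z
    proof -
      have "norm (of_real (1 - \<eta>) :: 'k) - norm z \<le> norm (of_real (1 - \<eta>) - z)" by (rule norm_triangle_ineq2)
      moreover have "norm (of_real (1 - \<eta>) :: 'k) = 1 - \<eta>" unfolding norm_of_real using \<eta> by simp
      ultimately show ?thesis using that by (simp add: dist_norm)
    qed
    have "ennreal ((1 - \<eta>) ^ ?m) * G 1 * ?V = (\<integral>\<^sup>+z. ennreal ((1 - \<eta>) ^ ?m) * G 1 * indicator ?N z \<partial>lborel)"
      by (rule nn_integral_cmult_indicator[symmetric]) simp
    also have "\<dots> \<le> (\<integral>\<^sup>+z. indicator ?N z * G z \<partial>lborel)"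
      using \<eta> shrink[of \<eta>] by (intro nn_integral_mono) (auto simp: dist_norm norm_minus_commute split: split_indicator)
    also have "\<dots> = (\<integral>\<^sup>+R. ennreal (1 / R ^ ?k) * emeasure lborel (?N \<inter> cball 0 R) \<partial>\<rho>)"
      using far[of 0] \<eta> by (intro nn_integral_G[OF _ _ \<rho>]) auto
    also have "\<dots> \<le> (\<integral>\<^sup>+R. ennreal (1 / (1 - 2 * \<eta>) ^ ?k) * ?V \<partial>\<rho>)"
    proof (rule nn_integral_mono_AE, use AE1 in eventually_elim)
      case (elim R)
      show ?case
      proof (cases "1 - 2 * \<eta> \<le> R")
        case True
        then have "1 / R ^ ?k \<le> 1 / (1 - 2 * \<eta>) ^ ?k" using \<eta> by (intro divide_left_mono power_mono mult_pos_pos zero_less_power) auto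
        then show ?thesis by (intro mult_mono ennreal_leI emeasure_mono) auto
      next
        case False
        then have "?N \<inter> cball 0 R = {}" using far by (auto simp: not_le) (meson order_trans not_le)
        then show ?thesis by simp
      qed
    qed
    also have "\<dots> = ennreal (1 / (1 - 2 * \<eta>) ^ ?k) * ?V"
      using prob_space.emeasure_space_1[OF sp] by simp
    finally have "ennreal ((1 - \<eta>) ^ ?m) * G 1 \<le> ennreal (1 / (1 - 2 * \<eta>) ^ ?k)"
      using V by (rule ennreal_mult_right_le_cancel)
    then have "ennreal ((1 - 2 * \<eta>) ^ ?k) * (ennreal ((1 - \<eta>) ^ ?m) * G 1) \<le> ennreal ((1 - 2 * \<eta>) ^ ?k) * ennreal (1 / (1 - 2 * \<eta>) ^ ?k)"
      by (intro mult_left_mono) auto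
    moreover have "ennreal ((1 - 2 * \<eta>) ^ ?k) * ennreal (1 / (1 - 2 * \<eta>) ^ ?k) = 1"
      using \<eta> by (simp add: ennreal_mult'[symmetric])
    moreover have "ennreal ((1 - \<eta>) ^ ?m * (1 - 2 * \<eta>) ^ ?k) = ennreal ((1 - 2 * \<eta>) ^ ?k) * ennreal ((1 - \<eta>) ^ ?m)"
      using \<eta> by (simp add: ennreal_mult'[symmetric] mult.commute)
    ultimately show ?thesis by (simp only: mult.assoc)
  qed
  have fin: "G 1 < \<infinity>"
  proof (rule ccontr)
    assume "\<not> G 1 < \<infinity>"
    then have "G 1 = \<infinity>" by (simp add: less_top[symmetric])
    then show False using bound[of "1/4"] by (simp add: ennreal_mult_top top_unique split: if_splits)
  qed
  define g where "g = enn2real (G 1)"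
  have g: "G 1 = ennreal g" "0 \<le> g" using fin by (auto simp: g_def)
  have "((\<lambda>\<eta>. (1 - \<eta>) ^ ?m * (1 - 2 * \<eta>) ^ ?k * g) \<longlongrightarrow> (1 - 0) ^ ?m * (1 - 2 * 0) ^ ?k * g) (at_right 0)"
    by (intro tendsto_intros)
  moreover have "\<forall>\<^sub>F \<eta> in at_right 0. (1 - \<eta>) ^ ?m * (1 - 2 * \<eta>) ^ ?k * g \<le> 1"
  proof -
    have "\<forall>\<^sub>F \<eta> in at_right (0::real). \<eta> \<in> {0<..<1/2}" by (rule eventually_at_right_real) simp
    then show ?thesis
    proof eventually_elim
      case (elim \<eta>)
      then have "ennreal ((1 - \<eta>) ^ ?m * (1 - 2 * \<eta>) ^ ?k * g) \<le> ennreal 1"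
        using bound[of \<eta>] g by (simp add: ennreal_mult')
      then show ?case by (subst (asm) ennreal_le_iff) auto
    qed
  qed
  ultimately have "(1 - 0) ^ ?m * (1 - 2 * 0) ^ ?k * g \<le> 1"
    by (rule tendsto_upperbound) simp
  then show ?thesis using g by (simp add: ennreal_le_1)
qed

text \<open>
  A small ball of levels that touches the unit sphere at 1 from inside is contained in every ball of
  radius \<open>R \<ge> 1\<close>, so the mean of \<open>G\<close> over it is at least the integral on the left. All these sections
  lie, up to translation along \<open>E\<close>, in the set \<open>C \<epsilon>\<close> of points of the hyperplane close to the polydisc,
  and these bounded sets decrease to the section at level 1 because the polydisc is closed.
\<close>

lemma section_lower:
  assumes \<rho>: "radius_law UNIV a \<rho>"
  shows "(\<integral>\<^sup>+R. indicator {1..} R * ennreal (1 / R ^ DIM('k)) \<partial>\<rho>) \<le> G 1"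
proof -
  let ?L = "\<integral>\<^sup>+R. indicator {1..} R * ennreal (1 / R ^ DIM('k)) \<partial>\<rho>"
  let ?Q = "polydisc \<alpha> :: ('k ^ 'n) set"
  define C where "C \<epsilon> = {c \<in> space M. infdist (\<alpha> *\<^sub>R E 1 + S c) ?Q \<le> \<alpha> * \<epsilon>}" for \<epsilon>
  have AE1: "AE R in \<rho>. 0 \<le> R" and s1[measurable_cong]: "sets \<rho> = sets borel" using \<rho> by (auto simp: radius_law_def)
  have Q0: "0 \<in> ?Q" using \<alpha>(1) by (auto simp: polydisc_def)
  have inf_meas: "(\<lambda>x. infdist x ?Q) \<in> borel_measurable borel"
    by (intro borel_measurable_continuous_onI continuous_on_infdist continuous_on_id)
  have C_meas[measurable]: "C \<epsilon> \<in> sets M" for \<epsilon>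
    unfolding C_def using measurable_compose[OF _ inf_meas] by measurable
  have near: "G z \<le> emeasure M (C \<epsilon>)" if z: "norm (1 - z) \<le> \<epsilon>" for z \<epsilon>
  proof -
    have "G z \<le> (\<integral>\<^sup>+c. indicator (C \<epsilon>) c \<partial>M)"
      unfolding G_def
    proof (rule nn_integral_mono)
      fix c assume c: "c \<in> space M"
      have "c \<in> C \<epsilon>" if "\<alpha> *\<^sub>R E z + S c \<in> ?Q"
      proof -
        have "infdist (\<alpha> *\<^sub>R E 1 + S c) ?Q \<le> dist (\<alpha> *\<^sub>R E 1 + S c) (\<alpha> *\<^sub>R E z + S c)"
          by (rule infdist_le[OF that])
        also have "\<dots> = norm (\<alpha> *\<^sub>R E (1 - z))"
          by (simp add: dist_norm linear_diff[OF E(1)] scaleR_diff_right)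
        also have "\<dots> = \<alpha> * norm (1 - z)" using \<alpha>(1) by (simp add: E)
        also have "\<dots> \<le> \<alpha> * \<epsilon>" using \<alpha>(1) z by simp
        finally show ?thesis using c by (simp add: C_def)
      qed
      then show "indicator ?Q (\<alpha> *\<^sub>R E z + S c) \<le> (indicator (C \<epsilon>) c :: ennreal)"
        by (auto split: split_indicator)
    qed
    then show ?thesis by simp
  qed
  have L: "?L \<le> emeasure M (C \<epsilon>)" if \<epsilon>: "0 < \<epsilon>" "\<epsilon> < 1" for \<epsilon>
  proof -
    let ?N = "cball (of_real (1 - \<epsilon> / 2)) (\<epsilon> / 2) :: 'k set"
    let ?V = "emeasure lborel ?N"
    have V: "?V \<noteq> 0" "?V \<noteq> \<infinity>"
      using \<epsilon> unit_ball_vol_pos[of "real DIM('k)"] by (auto simp: emeasure_cball simp del: unit_ball_vol_pos)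
    have c: "norm (of_real (1 - \<epsilon> / 2) :: 'k) = 1 - \<epsilon> / 2" unfolding norm_of_real using \<epsilon> by simp
    have N1: "norm z \<le> 1" if "z \<in> ?N" for z
      using norm_triangle_ineq3[of "of_real (1 - \<epsilon> / 2)" z] that c by (simp add: dist_norm)
    have N2: "norm (1 - z) \<le> \<epsilon>" if "z \<in> ?N" for z
    proof -
      have "norm (1 - z) \<le> norm (1 - of_real (1 - \<epsilon> / 2) :: 'k) + norm (of_real (1 - \<epsilon> / 2) - z)"
        using norm_triangle_ineq[of "1 - of_real (1 - \<epsilon> / 2)" "of_real (1 - \<epsilon> / 2) - z"] by simp
      also have "1 - of_real (1 - \<epsilon> / 2) = (of_real (\<epsilon> / 2) :: 'k)" by simp
      also have "norm (of_real (\<epsilon> / 2) :: 'k) = \<epsilon> / 2" unfolding norm_of_real using \<epsilon> by simp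
      finally show ?thesis using that by (simp add: dist_norm)
    qed
    have N0: "0 \<notin> ?N" using c \<epsilon> by (simp add: dist_norm del: of_real_diff)
    have "?L * ?V = (\<integral>\<^sup>+R. indicator {1..} R * ennreal (1 / R ^ DIM('k)) * ?V \<partial>\<rho>)"
      by (rule nn_integral_multc[symmetric]) measurable
    also have "\<dots> \<le> (\<integral>\<^sup>+R. ennreal (1 / R ^ DIM('k)) * emeasure lborel (?N \<inter> cball 0 R) \<partial>\<rho>)"
    proof (rule nn_integral_mono)
      fix R
      have "?N \<inter> cball 0 R = ?N" if "1 \<le> R"
      proof -
        have "z \<in> cball 0 R" if "z \<in> ?N" for z using N1[OF that] \<open>1 \<le> R\<close> by simp
        then show ?thesis by blast
      qed
      then show "indicator {1..} R * ennreal (1 / R ^ DIM('k)) * ?V \<le> ennreal (1 / R ^ DIM('k)) * emeasure lborel (?N \<inter> cball 0 R)"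
        by (auto split: split_indicator)
    qed
    also have "\<dots> = (\<integral>\<^sup>+z. indicator ?N z * G z \<partial>lborel)"
      using N0 by (intro nn_integral_G[OF _ _ \<rho>, symmetric]) auto
    also have "\<dots> \<le> (\<integral>\<^sup>+z. emeasure M (C \<epsilon>) * indicator ?N z \<partial>lborel)"
      using N2 near by (intro nn_integral_mono) (auto split: split_indicator)
    also have "\<dots> = emeasure M (C \<epsilon>) * ?V"
      by (rule nn_integral_cmult_indicator) simp
    finally show ?thesis
      using V by (rule ennreal_mult_right_le_cancel)
  qed
  let ?e = "\<lambda>n. 1 / real (n + 2)"
  have fin: "emeasure M (C (?e n)) \<noteq> \<infinity>" for n
  proof -
    obtain K where "\<forall>x\<in>?Q. norm x \<le> K" using bounded_polydisc[of \<alpha>] unfolding bounded_iff by blast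
    then have K: "norm x \<le> K" if "x \<in> ?Q" for x using that by blast
    let ?D = "2 * \<alpha> + K"
    have "C (?e n) \<subseteq> Pi\<^sub>E B (\<lambda>_. {- ?D .. ?D})"
    proof
      fix c assume c: "c \<in> C (?e n)"
      obtain q where q: "q \<in> ?Q" "infdist (\<alpha> *\<^sub>R E 1 + S c) ?Q = dist (\<alpha> *\<^sub>R E 1 + S c) q"
        using infdist_attains_inf[OF closed_polydisc] Q0 by blast
      have "dist (\<alpha> *\<^sub>R E 1 + S c) q \<le> \<alpha> * ?e n" using c q by (simp add: C_def)
      also have "\<dots> \<le> \<alpha> * 1" using \<alpha>(1) by (intro mult_left_mono) auto
      finally have "norm (\<alpha> *\<^sub>R E 1 + S c) \<le> \<alpha> + K"
        using K[OF q(1)] norm_triangle_ineq2[of "\<alpha> *\<^sub>R E 1 + S c" q] by (simp add: dist_norm)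
      moreover have "norm (\<alpha> *\<^sub>R E 1) = \<alpha>" using \<alpha>(1) by (simp add: E)
      ultimately have Sc: "norm (S c) \<le> ?D"
        using norm_triangle_ineq4[of "\<alpha> *\<^sub>R E 1 + S c" "\<alpha> *\<^sub>R E 1"] by simp
      have "c b \<in> {- ?D .. ?D}" if b: "b \<in> B" for b
      proof -
        have "S c \<bullet> b = (\<Sum>b'\<in>B. if b' = b then c b else 0)"
          unfolding inner_sum_left using B b
          by (intro sum.cong) (auto simp: pairwise_def orthogonal_def norm_eq_1)
        then have "S c \<bullet> b = c b" using b finite_B by simp
        then have "\<bar>c b\<bar> \<le> ?D" using Cauchy_Schwarz_ineq2[of "S c" b] Sc B(2)[OF b] by simp
        then show ?thesis unfolding atLeastAtMost_iff by linarith
      qed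
      then show "c \<in> Pi\<^sub>E B (\<lambda>_. {- ?D .. ?D})"
        using c by (simp add: C_def space_PiM PiE_iff)
    qed
    then have "emeasure M (C (?e n)) \<le> emeasure M (Pi\<^sub>E B (\<lambda>_. {- ?D .. ?D}))"
      using finite_B by (intro emeasure_mono sets_PiM_I_finite) auto
    also have "\<dots> = (\<Prod>b\<in>B. emeasure lborel {- ?D .. ?D})"
    proof -
      interpret product_sigma_finite "\<lambda>_ :: 'k ^ 'n. lborel :: real measure" ..
      show ?thesis using finite_B by (intro emeasure_PiM) auto
    qed
    also have "\<dots> < \<infinity>"
      by (simp add: power_less_top_ennreal emeasure_lborel_Icc_eq)
    finally show ?thesis by simp
  qed
  have "decseq (\<lambda>n. C (?e n))"
    using \<alpha>(1) by (auto simp: decseq_def C_def intro!: divide_left_mono elim!: order_trans)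
  then have "(INF n. emeasure M (C (?e n))) = emeasure M (\<Inter>n. C (?e n))"
    by (intro INF_emeasure_decseq) (use fin in auto)
  moreover have "(\<Inter>n. C (?e n)) = {c \<in> space M. \<alpha> *\<^sub>R E 1 + S c \<in> ?Q}"
  proof (intro equalityI subsetI)
    fix c assume c: "c \<in> (\<Inter>n. C (?e n))"
    have "(\<lambda>n. \<alpha> * ?e n) \<longlonglongrightarrow> \<alpha> * 0"
      by (intro tendsto_mult tendsto_const LIMSEQ_ignore_initial_segment[of "\<lambda>n. 1 / real n" _ 2]) (rule lim_1_over_n)
    moreover have "\<forall>n. infdist (\<alpha> *\<^sub>R E 1 + S c) ?Q \<le> \<alpha> * ?e n" using c by (auto simp: C_def)
    ultimately have "infdist (\<alpha> *\<^sub>R E 1 + S c) ?Q \<le> 0" by (intro LIMSEQ_le_const[of _ _]) auto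
    then have "infdist (\<alpha> *\<^sub>R E 1 + S c) ?Q = 0" using infdist_nonneg by (metis order_antisym)
    then show "c \<in> {c \<in> space M. \<alpha> *\<^sub>R E 1 + S c \<in> ?Q}"
      using c in_closed_iff_infdist_zero[OF closed_polydisc] Q0 by (auto simp: C_def)
  qed (use \<alpha>(1) in \<open>auto simp: C_def\<close>)
  moreover have "emeasure M {c \<in> space M. \<alpha> *\<^sub>R E 1 + S c \<in> ?Q} = G 1"
  proof -
    have "{c \<in> space M. \<alpha> *\<^sub>R E 1 + S c \<in> ?Q} \<in> sets M" by measurable
    then have "emeasure M {c \<in> space M. \<alpha> *\<^sub>R E 1 + S c \<in> ?Q} = (\<integral>\<^sup>+c. indicator {c \<in> space M. \<alpha> *\<^sub>R E 1 + S c \<in> ?Q} c \<partial>M)"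
      by (rule nn_integral_indicator[symmetric])
    also have "\<dots> = G 1"
      unfolding G_def by (intro nn_integral_cong) (auto split: split_indicator)
    finally show ?thesis .
  qed
  moreover have "?L \<le> (INF n. emeasure M (C (?e n)))"
    by (intro INF_greatest L) auto
  ultimately show ?thesis by simp
qed

end

text \<open>
  The two bounds combined and freed from the choice of frame in the definition of \<^const>\<open>affine_lborel\<close>.
\<close>

lemma (in uniform_ball) section_bounds:
  fixes a :: "'n::finite \<Rightarrow> 'k" and E :: "'k \<Rightarrow> 'k ^ 'n" and \<alpha> :: real
  defines "V \<equiv> {x :: 'k ^ 'n. (\<Sum>j\<in>UNIV. x $ j * a j) = of_real \<alpha>}"
  assumes a: "(\<Sum>j\<in>UNIV. (norm (a j))\<^sup>2) = 1"
    and \<alpha>: "\<alpha> > 0" "ennreal (\<alpha> ^ DIM('k)) * emeasure lborel (cball 0 1 :: 'k set) = 1"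
    and E: "linear E" "\<And>z. norm (E z) = norm z" "\<And>z. (\<Sum>j\<in>UNIV. E z $ j * a j) = z"
      "\<And>w. (\<Sum>j\<in>UNIV. w $ j * a j) = 0 \<longleftrightarrow> (\<forall>z. E z \<bullet> w = 0)"
    and c: "0 \<le> A" "0 \<le> c" "0 \<le> \<theta>"
    and pointwise: "\<And>R. 1 \<le> R \<Longrightarrow> A \<le> 1 / R ^ DIM('k) + c * (R\<^sup>2 - \<theta>)\<^sup>2"
  shows "A * (293/1000 - 593/10000 * K2\<^sup>2) + 2 * c * \<theta> - c * (K2 + \<theta>\<^sup>2) \<le> measure (affine_lborel V) (polydisc \<alpha> \<inter> V)"
    and "measure (affine_lborel V) (polydisc \<alpha> \<inter> V) \<le> 1"
proof -
  have "affine V"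
    unfolding affine_def V_def
    by (auto simp: distrib_right sum.distrib scaleR_sum_right[symmetric] scaleR_left_distrib[symmetric])
  moreover have "E (of_real \<alpha>) \<in> V" using E by (simp add: V_def)
  ultimately have "\<exists>q. case q of (p, B) \<Rightarrow> orthonormal_frame V p B"
    using orthonormal_frame_exists[of V] by auto
  then have "case (SOME (p, B). orthonormal_frame V p B) of (p, B) \<Rightarrow> orthonormal_frame V p B"
    by (rule someI_ex)
  then obtain p B where pB: "(SOME (p, B). orthonormal_frame V p B) = (p, B)" "orthonormal_frame V p B"
    by (metis case_prod_conv surj_pair)
  interpret hyperplane_section U K2 a \<alpha> E p B
    using \<alpha> E pB(2) unfolding V_def by unfold_locales (auto simp: linear_add[OF E(1)] linear_scale[OF E(1)])
  have eq: "emeasure (affine_lborel V) (polydisc \<alpha> \<inter> V) = G 1"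
  proof -
    have "affine_lborel V = frame_measure p B" unfolding affine_lborel_def pB(1) by simp
    moreover have "V = {x. h x = of_real \<alpha>}" by (simp add: V_def h_def)
    ultimately show ?thesis using section_eq_G by simp
  qed
  show le1: "measure (affine_lborel V) (polydisc \<alpha> \<inter> V) \<le> 1"
    unfolding measure_def eq using section_le_1 by (intro enn2real_leI) auto
  obtain \<rho> where \<rho>: "radius_law UNIV a \<rho>" "ennreal (293/1000 - 593/10000 * K2\<^sup>2) \<le> emeasure \<rho> {1..}"
    using radius_law_UNIV_exists[OF a] by blast
  let ?X = "A * (293/1000 - 593/10000 * K2\<^sup>2) + 2 * c * \<theta> - c * (K2 + \<theta>\<^sup>2)"
  have "K2\<^sup>2 \<le> (5/3)\<^sup>2" using K2 by (intro power_mono) auto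
  then have p0: "0 \<le> 293/1000 - 593/10000 * K2\<^sup>2" by (simp add: power2_eq_square)
  have "ennreal (A * (293/1000 - 593/10000 * K2\<^sup>2) + 2 * c * \<theta> - c * (K2 + \<theta>\<^sup>2))
      \<le> (\<integral>\<^sup>+R. indicator {1..} R * ennreal (1 / R ^ DIM('k)) \<partial>\<rho>)"
  proof (rule radius_law_functional_lower[OF \<rho>(1) a \<rho>(2) c p0])
    fix R :: real assume "0 \<le> R"
    show "ennreal (A * indicator {1..} R) \<le> indicator {1..} R * ennreal (1 / R ^ DIM('k)) + ennreal (c * (R\<^sup>2 - \<theta>)\<^sup>2)"
    proof (cases "1 \<le> R")
      case True
      then show ?thesis using pointwise[OF True] c
        by (simp add: ennreal_plus[symmetric] ennreal_leI del: ennreal_plus)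
    qed simp
  qed auto
  also have "\<dots> \<le> G 1" by (rule section_lower[OF \<rho>(1)])
  finally have le: "ennreal ?X \<le> G 1" .
  have "?X \<le> enn2real (ennreal ?X)"
    by (cases "0 \<le> ?X") (simp_all add: ennreal_neg)
  also have "\<dots> \<le> enn2real (G 1)"
    using le section_le_1 by (intro enn2real_mono) (auto intro: le_less_trans)
  finally show "?X \<le> measure (affine_lborel V) (polydisc \<alpha> \<inter> V)"
    unfolding measure_def eq .
qed

lemma max_norm_le_iff: "max_norm x \<le> r \<longleftrightarrow> (\<forall>j. norm (x $ j) \<le> r)"
  by (auto simp: max_norm_def Max_le_iff)

section \<open>The real and the complex cube\<close>

interpretation real_ball: uniform_ball "ball_law :: real measure" "5/3"
proof
  fix w :: real
  show "1/2 - 2/3 * w \<le> measure ball_law {v :: real. w \<le> v \<bullet> 1}" if "0 \<le> w"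
  proof (cases "w \<le> 1")
    case True
    then show ?thesis using that by (subst measure_ball_law_tail_real) auto
  next
    case False
    then have "1/2 - 2/3 * w \<le> 0" by simp
    then show ?thesis using measure_nonneg by (rule order_trans)
  qed
  show "1/2 - w/2 \<le> measure ball_law {v :: real. w \<le> v \<bullet> 1}" if "-1 \<le> w" "w \<le> 0"
    using that by (subst measure_ball_law_tail_real) auto
qed (use nn_integral_ball_law_sum_real nn_integral_ball_law_square_real in auto)

interpretation complex_ball: uniform_ball "ball_law :: complex measure" "3/2"
  by standard (use nn_integral_ball_law_sum_complex nn_integral_ball_law_square_complex measure_ball_law_tail_complex in auto)

lemma real_section_bounds:
  fixes a :: "real ^ 'n"
  assumes a: "norm a = 1"
  shows "0.06011 < A_real a 1" "A_real a 1 \<le> 1"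
proof -
  have a2: "(\<Sum>j\<in>UNIV. (norm (a $ j))\<^sup>2) = 1"
    using a by (simp add: norm_vec_def L2_set_def real_sqrt_eq_1_iff)
  have inner: "x \<bullet> a = (\<Sum>j\<in>UNIV. x $ j * a $ j)" for x :: "real ^ 'n"
    by (simp add: inner_vec_def)
  have aa: "a \<bullet> a = 1" using a by (simp add: norm_eq_1)
  let ?V = "{x :: real ^ 'n. (\<Sum>j\<in>UNIV. x $ j * a $ j) = of_real (1/2)}"
  have sec: "A_real a 1 = measure (affine_lborel ?V) (real_ball.polydisc (1/2) \<inter> ?V)"
    unfolding A_real_def section_real_def hyperplane_real_def alpha_real_def inner real_ball.polydisc_def max_norm_le_iff
    by simp
  have vol: "ennreal ((1/2) ^ DIM(real)) * emeasure lborel (cball 0 1 :: real set) = 1"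
  proof -
    have "emeasure lborel (cball 0 1 :: real set) = ennreal 2" by (simp add: cball_eq_atLeastAtMost)
    then show ?thesis by (simp only: DIM_real power_one_right) (subst ennreal_mult'[symmetric], simp_all)
  qed
  have E: "linear (\<lambda>z. z *\<^sub>R a)" "\<And>z. norm (z *\<^sub>R a) = norm z" "\<And>z. (\<Sum>j\<in>UNIV. (z *\<^sub>R a) $ j * a $ j) = z"
      "\<And>w :: real ^ 'n. (\<Sum>j\<in>UNIV. w $ j * a $ j) = 0 \<longleftrightarrow> (\<forall>z. (z *\<^sub>R a) \<bullet> w = 0)"
    unfolding inner[symmetric] using a aa by (auto intro!: linearI simp: scaleR_left_distrib inner_commute dest: spec[of _ 1])
  have pw: "11/16 \<le> 1 / R ^ DIM(real) + 5/256 * (R\<^sup>2 - 1/5)\<^sup>2" if R: "1 \<le> R" for R :: real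
  proof -
    \<comment> \<open>the bound of \<open>1 / R\<close> by its tangent in the variable \<open>R\<^sup>2\<close> at \<open>R = 2\<close>\<close>
    have "0 \<le> (R - 2)\<^sup>2 * (R + 4)" using R by simp
    then have "R * (3 - R\<^sup>2 / 4) \<le> 4" by (simp add: power2_eq_square algebra_simps)
    then have "3/4 - R\<^sup>2 / 16 \<le> 1 / R" using R by (simp add: field_simps)
    moreover have "5/256 * (R\<^sup>2 - 1/5)\<^sup>2 = 5/256 * (R\<^sup>2 - 9/5)\<^sup>2 + R\<^sup>2 / 16 - 1/16"
      by (simp add: power2_eq_square field_simps)
    moreover have "0 \<le> 5/256 * (R\<^sup>2 - 9/5)\<^sup>2" by simp
    ultimately have "11/16 \<le> 1 / R + 5/256 * (R\<^sup>2 - 1/5)\<^sup>2" by linarith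
    then show ?thesis by simp
  qed
  note bounds = real_ball.section_bounds[OF a2 _ vol E _ _ _ pw]
  show "A_real a 1 \<le> 1" unfolding sec by (rule bounds(2)) auto
  have "11/16 * (293/1000 - 593/10000 * (5/3)\<^sup>2) + 2 * (5/256) * (1/5) - 5/256 * (5/3 + (1/5)\<^sup>2) \<le> A_real a 1"
    unfolding sec by (rule bounds(1)) auto
  then show "0.06011 < A_real a 1" by (simp add: power2_eq_square)
qed

lemma complex_section_bounds:
  fixes a :: "complex ^ 'n"
  assumes a: "norm a = 1"
  shows "0.03789 < A_complex a 1" "A_complex a 1 \<le> 1"
proof -
  let ?\<alpha> = "1 / sqrt pi"
  have a1: "(\<Sum>j\<in>UNIV. (norm (a $ j))\<^sup>2) = 1"
    using a by (simp add: norm_vec_def L2_set_def real_sqrt_eq_1_iff)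
  then have a2: "(\<Sum>j\<in>UNIV. (norm (cnj (a $ j)))\<^sup>2) = 1" by simp
  have aa: "(\<Sum>j\<in>UNIV. a $ j * cnj (a $ j)) = 1"
    using arg_cong[OF a1, of complex_of_real] unfolding of_real_sum complex_norm_square by simp
  let ?V = "{x :: complex ^ 'n. (\<Sum>j\<in>UNIV. x $ j * cnj (a $ j)) = of_real ?\<alpha>}"
  have sec: "A_complex a 1 = measure (affine_lborel ?V) (complex_ball.polydisc ?\<alpha> \<inter> ?V)"
    unfolding A_complex_def section_complex_def hyperplane_complex_def alpha_complex_def hermitian_inner_def
      complex_ball.polydisc_def max_norm_le_iff
    by simp
  have vol: "ennreal (?\<alpha> ^ DIM(complex)) * emeasure lborel (cball 0 1 :: complex set) = 1"
    by (simp add: emeasure_cball eval_unit_ball_vol ennreal_mult'[symmetric] power_divide)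
  let ?E = "\<lambda>z. \<chi> j. z * a $ j"
  have E: "linear ?E" "\<And>z. norm (?E z) = norm z" "\<And>z. (\<Sum>j\<in>UNIV. ?E z $ j * cnj (a $ j)) = z"
  proof -
    show "linear ?E" by (intro linearI) (simp_all add: vec_eq_iff algebra_simps)
    fix z
    have "norm (?E z) = norm z * norm a"
      by (simp add: norm_vec_def norm_mult L2_set_right_distrib)
    then show "norm (?E z) = norm z" using a by simp
    show "(\<Sum>j\<in>UNIV. ?E z $ j * cnj (a $ j)) = z"
      using aa by (simp add: mult.assoc sum_distrib_left[symmetric])
  qed
  have orth: "(\<Sum>j\<in>UNIV. w $ j * cnj (a $ j)) = 0 \<longleftrightarrow> (\<forall>z. ?E z \<bullet> w = 0)" for w :: "complex ^ 'n"
  proof -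
    let ?h = "\<Sum>j\<in>UNIV. w $ j * cnj (a $ j)"
    have inner: "?E z \<bullet> w = z \<bullet> ?h" for z
    proof -
      have "?E z \<bullet> w = (\<Sum>j\<in>UNIV. z \<bullet> (w $ j * cnj (a $ j)))"
        by (simp add: inner_vec_def inner_complex_def algebra_simps)
      then show ?thesis by (simp add: inner_sum_right)
    qed
    show ?thesis unfolding inner by (metis inner_eq_zero_iff inner_zero_right)
  qed
  have pw: "51/100 \<le> 1 / R ^ DIM(complex) + 9/280 * (R\<^sup>2 - 3/10)\<^sup>2" if R: "1 \<le> R" for R :: real
  proof -
    \<comment> \<open>the bound of \<open>1 / R\<^sup>2\<close> by its tangent in the variable \<open>R\<^sup>2\<close> at \<open>R\<^sup>2 = 10/3\<close>\<close>
    have "0 \<le> (1 - 3/10 * R\<^sup>2)\<^sup>2" by simp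
    then have "R\<^sup>2 * (3/5 - 9/100 * R\<^sup>2) \<le> 1" by (simp add: power2_eq_square field_simps)
    then have "3/5 - 9/100 * R\<^sup>2 \<le> 1 / R\<^sup>2" using R by (simp add: field_simps)
    moreover have "9/280 * (R\<^sup>2 - 3/10)\<^sup>2 = 9/280 * (R\<^sup>2 - 17/10)\<^sup>2 + 9/100 * R\<^sup>2 - 9/100"
      by (simp add: power2_eq_square field_simps)
    moreover have "0 \<le> 9/280 * (R\<^sup>2 - 17/10)\<^sup>2" by simp
    ultimately have "51/100 \<le> 1 / R\<^sup>2 + 9/280 * (R\<^sup>2 - 3/10)\<^sup>2" by linarith
    then show ?thesis by simp
  qed
  note bounds = complex_ball.section_bounds[OF a2 _ vol E orth _ _ _ pw]
  show "A_complex a 1 \<le> 1" unfolding sec by (rule bounds(2)) auto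
  have "51/100 * (293/1000 - 593/10000 * (3/2)\<^sup>2) + 2 * (9/280) * (3/10) - 9/280 * (3/2 + (3/10)\<^sup>2) \<le> A_complex a 1"
    unfolding sec by (rule bounds(1)) auto
  then show "0.03789 < A_complex a 1" by (simp add: power2_eq_square)
qed

theorem theorem1p2:
  shows "(\<forall>a :: real ^ 'n. norm a = 1 \<longrightarrow>
            (1 / 17 :: real) < 0.06011 \<and> 0.06011 < A_real a 1 \<and> A_real a 1 \<le> 1) \<and>
         (\<forall>a :: complex ^ 'n. norm a = 1 \<longrightarrow>
            (1 / 27 :: real) < 0.03789 \<and> 0.03789 < A_complex a 1 \<and> A_complex a 1 \<le> 1)"
  using real_section_bounds complex_section_bounds by auto

end
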